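(* There exist absolute constants $0<c\le C$ such that for all integers $d\ge1$, $s\in\{1,\dots,d\}$, all $\rho\in[\sqrt d,d]$ and all $\sigma>0$: \[ \sup_{(\boldsymbol\theta,\boldsymbol\Sigma)\in\Theta(s,d,\rho)}\mathbf E_{\boldsymbol\theta,\boldsymbol\Sigma}[(\tilde N-\|\boldsymbol\theta\|_2)^2]\le C\sigma^2\phi(s,\rho^2), \] and \[ c\,\sigma^2\le \inf_{\hat T}\sup_{(\boldsymbol\theta,\boldsymbol\Sigma)\in\Theta(s,d,\rho)}\frac{\mathbf E_{\boldsymbol\theta,\boldsymbol\Sigma}[(\hat T-\|\boldsymbol\theta\|_2)^2]}{\phi(s,\rho^2)}\le C\sigma^2, \] the infimum being over all estimators $\hat T$.
   Context: Model: one observes $\boldsymbol Y=\boldsymbol\theta+\sigma\boldsymbol\varepsilon\in\mathbb R^d$, $\boldsymbol\varepsilon\sim\mathcal N(\boldsymbol0,\boldsymbol\Sigma)$, $\sigma>0$ known; $\mathbf E_{\boldsymbol\theta,\boldsymbol\Sigma}$ is the expectation under this model. $B_0(s,d)=\{\boldsymbol\theta:\|\boldsymbol\theta\|_0\le s\}$. $\Theta(s,d,\rho)=\{(\boldsymbol\theta,\boldsymbol\Sigma):\boldsymbol\theta\in B_0(s,d),\ \boldsymbol\Sigma\text{ covariance matrix with }\boldsymbol\Sigma_{ii}=1\ \forall i,\ \|\boldsymbol\Sigma\|_F\le\rho\}$. For $t>0$: $\phi(s,t)=s\log(1+t/s^2)$ if $s\le\sqrt t$, $\phi(s,t)=\sqrt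 t$ otherwise. Estimator $\tilde N$: let $\tau=3\sqrt{\log(1+\rho^2/s^2)}$, $\beta_s=\mathbf E[Z^2\mid|Z|\ge\tau]$ with $Z\sim\mathcal N(0,1)$, $\sigma_i^2=\boldsymbol\Sigma_{ii}$, \[ \tilde Q=\begin{cases}\sum_{i=1}^d(Y_i^2-\sigma^2\sigma_i^2\beta_s)\mathbb 1\{|Y_i|>\sigma\sigma_i\tau\}, & s\le\rho,\\ \sum_{i=1}^d(Y_i^2-\sigma^2\sigma_i^2), &\text{otherwise},\end{cases}\qquad\tilde N=\sqrt{|\tilde Q|}. \] *)

theory Defs
  imports "HOL-Probability.Probability"
begin

text \<open>Vectors in R^d are functions nat => real (coordinates 0..d-1, zero outside);
 d x d matrices are functions nat => nat => real.\<close>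

definition std_gauss :: "real measure" where
  "std_gauss = density lborel (\<lambda>x. ennreal (std_normal_density x))"

definition l2norm :: "nat \<Rightarrow> (nat \<Rightarrow> real) \<Rightarrow> real" where
  "l2norm d x = sqrt (\<Sum>i<d. (x i)\<^sup>2)"

definition l0norm :: "nat \<Rightarrow> (nat \<Rightarrow> real) \<Rightarrow> nat" where
  "l0norm d x = card {i\<in>{..<d}. x i \<noteq> 0}"

definition frob_norm :: "nat \<Rightarrow> (nat \<Rightarrow> nat \<Rightarrow> real) \<Rightarrow> real" where
  "frob_norm d S = sqrt (\<Sum>i<d. \<Sum>j<d. (S i j)\<^sup>2)"

definition is_cov :: "nat \<Rightarrow> (nat \<Rightarrow> nat \<Rightarrow> real) \<Rightarrow> bool" where
  "is_cov d S \<longleftrightarrow> (\<forall>i<d. \<forall>j<d. S i j = S j i)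
     \<and> (\<forall>x::nat\<Rightarrow>real. 0 \<le> (\<Sum>i<d. \<Sum>j<d. x i * S i j * x j))"

text \<open>A square root factor A with A A^T = S (exists for covariance matrices).\<close>
definition cov_factor :: "nat \<Rightarrow> (nat \<Rightarrow> nat \<Rightarrow> real) \<Rightarrow> (nat \<Rightarrow> nat \<Rightarrow> real)" where
  "cov_factor d S = (SOME A. \<forall>i<d. \<forall>j<d. (\<Sum>k<d. A i k * A j k) = S i j)"

text \<open>Law of Y = theta + sigma * eps, eps ~ N(0, S): image of the standard Gaussian
  vector Z under z \<mapsto> theta + sigma A z with A A^T = S.\<close>
definition obs_law :: "nat \<Rightarrow> (nat \<Rightarrow> real) \<Rightarrow> real \<Rightarrow> (nat \<Rightarrow> nat \<Rightarrow> real) \<Rightarrow> (nat \<Rightarrow> real) measure" where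
  "obs_law d \<theta> \<sigma> S =
     distr (PiM {..<d} (\<lambda>_. std_gauss)) (PiM {..<d} (\<lambda>_. borel))
       (\<lambda>z. \<lambda>i\<in>{..<d}. \<theta> i + \<sigma> * (\<Sum>k<d. cov_factor d S i k * z k))"

definition risk :: "nat \<Rightarrow> ((nat \<Rightarrow> real) \<Rightarrow> real) \<Rightarrow> (nat \<Rightarrow> real) \<Rightarrow> real \<Rightarrow> (nat \<Rightarrow> nat \<Rightarrow> real) \<Rightarrow> ennreal" where
  "risk d T \<theta> \<sigma> S = (\<integral>\<^sup>+ Y. ennreal ((T Y - l2norm d \<theta>)\<^sup>2) \<partial>obs_law d \<theta> \<sigma> S)"

definition Theta :: "nat \<Rightarrow> nat \<Rightarrow> real \<Rightarrow> ((nat \<Rightarrow> real) \<times> (nat \<Rightarrow> nat \<Rightarrow> real)) set" where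
  "Theta s d \<rho> = {(\<theta>, S). (\<forall>i\<ge>d. \<theta> i = 0) \<and> l0norm d \<theta> \<le> s
      \<and> (\<forall>i j. (i \<ge> d \<or> j \<ge> d) \<longrightarrow> S i j = 0)
      \<and> is_cov d S \<and> (\<forall>i<d. S i i = 1) \<and> frob_norm d S \<le> \<rho>}"

definition phi :: "nat \<Rightarrow> real \<Rightarrow> real" where
  "phi s t = (if real s \<le> sqrt t then real s * ln (1 + t / (real s)\<^sup>2) else sqrt t)"

definition estimators :: "nat \<Rightarrow> ((nat \<Rightarrow> real) \<Rightarrow> real) set" where
  "estimators d = borel_measurable (PiM {..<d} (\<lambda>_. borel))"

definition tau :: "nat \<Rightarrow> real \<Rightarrow> real" where
  "tau s \<rho> = 3 * sqrt (ln (1 + \<rho>\<^sup>2 / (real s)\<^sup>2))"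

definition beta :: "nat \<Rightarrow> real \<Rightarrow> real" where
  "beta s \<rho> = (\<integral>z. indicator {z. tau s \<rho> \<le> \<bar>z\<bar>} z * z\<^sup>2 \<partial>std_gauss)
               / measure std_gauss {z. tau s \<rho> \<le> \<bar>z\<bar>}"

text \<open>The estimator N tilde (with sigma_i = Sigma_ii = 1 on Theta).\<close>
definition Q_tilde :: "nat \<Rightarrow> nat \<Rightarrow> real \<Rightarrow> real \<Rightarrow> (nat \<Rightarrow> real) \<Rightarrow> real" where
  "Q_tilde d s \<rho> \<sigma> Y =
     (if real s \<le> \<rho> then
        (\<Sum>i<d. (if \<bar>Y i\<bar> > \<sigma> * tau s \<rho> then (Y i)\<^sup>2 - \<sigma>\<^sup>2 * beta s \<rho> else 0))
      else (\<Sum>i<d. (Y i)\<^sup>2 - \<sigma>\<^sup>2))"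

definition N_tilde :: "nat \<Rightarrow> nat \<Rightarrow> real \<Rightarrow> real \<Rightarrow> (nat \<Rightarrow> real) \<Rightarrow> real" where
  "N_tilde d s \<rho> \<sigma> Y = sqrt \<bar>Q_tilde d s \<rho> \<sigma> Y\<bar>"

end

theory Submission
  imports Defs
begin

text \<open>
  Everything is computed in the space of the standard Gaussian vector \<open>z\<close>: the noise coordinates
  are \<open>\<epsilon>\<^sub>i = \<langle>A\<^sub>i, z\<rangle>\<close> with \<open>A A\<^sup>T = \<Sigma>\<close>, and any two of them are standard bivariate normal.

  Upper bound. With \<open>t = \<parallel>\<theta>\<parallel>\<close>, \<open>U = 2 \<langle>\<theta>, \<epsilon>\<rangle>\<close> and \<open>V = |Q - t\<^sup>2 - U|\<close> one has
  \<open>(\<surd>|Q| - t)\<^sup>2 \<le> 4 U\<^sup>2 / t\<^sup>2 + 2 V\<close>. The first term is controlled by \<open>\<theta>\<^sup>T \<Sigma> \<theta> \<le> min(s, \<rho>) t\<^sup>2\<close>.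
  In the second term the support contributes \<open>O(s (1 + \<tau>\<^sup>2))\<close>, because thresholding changes \<open>Y\<^sub>i\<^sup>2\<close> by at
  most \<open>8 \<tau>\<^sup>2\<close>; off the support one sums \<open>g(\<epsilon>\<^sub>i)\<close> for an even centred \<open>g\<close> with \<open>|g(y)| \<le> K exp(3 y\<^sup>2 / 20)\<close>.
  The density of a bivariate normal relative to its marginals is \<open>1 + r u y + O(r\<^sup>2)\<close>, and the first two
  terms integrate to zero against \<open>g(u) g(y)\<close>, so \<open>|Cov(g(\<epsilon>\<^sub>i), g(\<epsilon>\<^sub>j))| = O(K\<^sup>2 \<Sigma>\<^sub>i\<^sub>j\<^sup>2)\<close> and the sum is \<open>O(K \<rho>)\<close>
  in mean. The threshold gives \<open>K = O(exp(- \<tau>\<^sup>2 / 18))\<close>, and the choice of \<open>\<tau>\<close> makes \<open>K \<rho> = O(s)\<close>.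

  Lower bound. Let \<open>\<Sigma>\<close> consist of perfectly correlated blocks of size \<open>m \<approx> min(\<rho>\<^sup>2 / d, s)\<close>, so that a
  block acts as a single observation, and group the blocks into \<open>n \<approx> s / m\<close> groups of \<open>k \<approx> d / s\<close>
  blocks. The signal occupies one uniformly chosen block in each group, with amplitude \<open>\<sigma> a\<close> where
  \<open>a\<^sup>2 = ln (1 + k / n)\<close>. The likelihood ratio of this mixture against \<open>\<theta> = 0\<close> has second moment
  \<open>(1 + 1 / n)\<^sup>n \<le> e\<close>, so the two hypotheses cannot be separated although the norms differ by
  \<open>\<sigma> a \<surd>(n m)\<close>. For \<open>s > \<rho>\<close> the sparsity \<open>\<lfloor>\<rho>\<rfloor>\<close> is used instead.
\<close>

subsection \<open>Rotations of the Gaussian plane\<close>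

definition plane_rotation :: "real \<Rightarrow> real \<Rightarrow> real \<times> real \<Rightarrow> real \<times> real" where
  "plane_rotation c s = (\<lambda>(x, y). (c * x - s * y, s * x + c * y))"

lemma measurable_plane_rotation [measurable]:
  "plane_rotation c s \<in> borel \<Otimes>\<^sub>M borel \<rightarrow>\<^sub>M borel \<Otimes>\<^sub>M borel"
  unfolding plane_rotation_def by measurable

lemma measure_eqI_nn_integral:
  assumes "sets M = sets N"
    and "\<And>f. f \<in> borel_measurable N \<Longrightarrow> (\<integral>\<^sup>+x. f x \<partial>M) = (\<integral>\<^sup>+x. f x \<partial>N)"
  shows "M = N"
proof (rule measure_eqI)
  fix A assume "A \<in> sets M"
  then show "emeasure M A = emeasure N A"
    using assms(2)[of "indicator A"] by (simp add: assms(1))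
qed fact

lemma distr_lborel_shear_fst:
  "distr (lborel \<Otimes>\<^sub>M lborel) (borel \<Otimes>\<^sub>M borel) (\<lambda>(x, y). (x + t * y, y)) = (lborel \<Otimes>\<^sub>M lborel :: (real \<times> real) measure)"
    (is "?L = ?R")
proof (rule measure_eqI_nn_integral)
  fix f :: "real \<times> real \<Rightarrow> ennreal" assume [measurable]: "f \<in> borel_measurable (lborel \<Otimes>\<^sub>M lborel)"
  have "(\<integral>\<^sup>+p. f p \<partial>?L) = (\<integral>\<^sup>+p. f (case p of (x, y) \<Rightarrow> (x + t * y, y)) \<partial>?R)"
    by (rule nn_integral_distr) measurable
  also have "\<dots> = (\<integral>\<^sup>+y. \<integral>\<^sup>+x. f (t * y + 1 * x, y) \<partial>lborel \<partial>lborel)"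
    by (subst lborel_pair.nn_integral_snd[symmetric]) (simp_all add: add.commute)
  also have "\<dots> = (\<integral>\<^sup>+y. \<integral>\<^sup>+x. f (x, y) \<partial>lborel \<partial>lborel)"
  proof (rule nn_integral_cong)
    fix y :: real
    show "(\<integral>\<^sup>+x. f (t * y + 1 * x, y) \<partial>lborel) = (\<integral>\<^sup>+x. f (x, y) \<partial>lborel)"
      using nn_integral_real_affine[of "\<lambda>x. f (x, y)" 1 "t * y"] by simp
  qed
  also have "\<dots> = (\<integral>\<^sup>+p. f p \<partial>?R)"
    by (rule lborel_pair.nn_integral_snd) simp
  finally show "(\<integral>\<^sup>+p. f p \<partial>?L) = (\<integral>\<^sup>+p. f p \<partial>?R)" .
qed (simp cong: sets_pair_measure_cong)

lemma distr_lborel_shear_snd: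
  "distr (lborel \<Otimes>\<^sub>M lborel) (borel \<Otimes>\<^sub>M borel) (\<lambda>(x, y). (x, y + t * x)) = (lborel \<Otimes>\<^sub>M lborel :: (real \<times> real) measure)"
proof -
  let ?L = "lborel \<Otimes>\<^sub>M lborel :: (real \<times> real) measure" and ?B = "borel \<Otimes>\<^sub>M borel :: (real \<times> real) measure"
  let ?swap = "\<lambda>(x, y). (y, x)" and ?X = "\<lambda>(x, y). (x + t * y, y)"
  have "distr ?L ?B ?swap = distr ?L ?L ?swap" by (rule distr_cong) (simp_all cong: sets_pair_measure_cong)
  then have swap: "distr ?L ?B ?swap = ?L" using lborel_pair.distr_pair_swap by (rule trans[OF _ sym])
  have "(\<lambda>(x, y). (x, y + t * x)) = ?swap \<circ> ?X \<circ> ?swap" by auto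
  moreover have "distr ?L ?B (?swap \<circ> ?X \<circ> ?swap) = distr (distr (distr ?L ?B ?swap) ?B ?X) ?B ?swap"
    by (simp add: distr_distr comp_assoc)
  ultimately show ?thesis by (simp add: distr_lborel_shear_fst swap)
qed

lemma distr_lborel_plane_rotation_of_shears:
  assumes circle: "c\<^sup>2 + s\<^sup>2 = 1" and not_half_turn: "c \<noteq> - 1"
  shows "distr (lborel \<Otimes>\<^sub>M lborel) (borel \<Otimes>\<^sub>M borel) (plane_rotation c s) = lborel \<Otimes>\<^sub>M lborel"
proof -
  define t where "t = - s / (1 + c)"
  let ?X = "\<lambda>(x, y). (x + t * y, y)" and ?Y = "\<lambda>(x, y). (x, y + s * x)"
  let ?L = "lborel \<Otimes>\<^sub>M lborel :: (real \<times> real) measure" and ?B = "borel \<Otimes>\<^sub>M borel :: (real \<times> real) measure"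
  have nonzero: "1 + c \<noteq> 0" using not_half_turn by (simp add: add_eq_0_iff)
  then have t_times: "t * (1 + c) = - s" by (simp add: t_def)
  have "(1 + c) * (1 + t * s) = 1 + c + (t * (1 + c)) * s" by (simp add: algebra_simps)
  also have "\<dots> = (1 + c) * c" using circle unfolding t_times by (simp add: power2_eq_square algebra_simps)
  finally have one_plus_t_times_s: "1 + t * s = c" using nonzero by simp
  have "(x + t * y) + t * (y + s * (x + t * y)) = (1 + t * s) * x + t * (1 + (1 + t * s)) * y"
    and "y + s * (x + t * y) = s * x + (1 + t * s) * y" for x y
    by (simp_all add: algebra_simps)
  then have "plane_rotation c s = ?X \<circ> ?Y \<circ> ?X"
    unfolding one_plus_t_times_s t_times by (auto simp: plane_rotation_def)
  moreover have "distr ?L ?B (?X \<circ> ?Y \<circ> ?X) = distr (distr (distr ?L ?B ?X) ?B ?Y) ?B ?X"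
    by (simp add: distr_distr comp_assoc)
  ultimately show ?thesis by (simp add: distr_lborel_shear_fst distr_lborel_shear_snd)
qed

lemma distr_lborel_plane_rotation:
  assumes circle: "c\<^sup>2 + s\<^sup>2 = 1"
  shows "distr (lborel \<Otimes>\<^sub>M lborel) (borel \<Otimes>\<^sub>M borel) (plane_rotation c s) = lborel \<Otimes>\<^sub>M lborel"
proof (cases "c = - 1")
  case True
  let ?L = "lborel \<Otimes>\<^sub>M lborel :: (real \<times> real) measure" and ?B = "borel \<Otimes>\<^sub>M borel :: (real \<times> real) measure"
  have quarter_turn: "distr ?L ?B (plane_rotation 0 1) = ?L"
    by (rule distr_lborel_plane_rotation_of_shears) simp_all
  have "plane_rotation c s = plane_rotation 0 1 \<circ> plane_rotation 0 1"
    using True circle by (auto simp: plane_rotation_def)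
  moreover have "distr ?L ?B (plane_rotation 0 1 \<circ> plane_rotation 0 1)
      = distr (distr ?L ?B (plane_rotation 0 1)) ?B (plane_rotation 0 1)"
    by (simp add: distr_distr)
  ultimately show ?thesis by (simp add: quarter_turn)
qed (rule distr_lborel_plane_rotation_of_shears[OF circle])

lemma sets_std_gauss [simp, measurable_cong]: "sets std_gauss = sets borel"
  by (simp add: std_gauss_def)

lemma space_std_gauss [simp]: "space std_gauss = UNIV"
  by (simp add: std_gauss_def)

lemma prob_space_std_gauss: "prob_space std_gauss"
  unfolding std_gauss_def by (rule prob_space_normal_density) simp

interpretation std_gauss: prob_space std_gauss by (rule prob_space_std_gauss)

interpretation std_gauss_pair: pair_prob_space std_gauss std_gauss ..

lemma emeasure_std_gauss_UNIV [simp]: "emeasure std_gauss UNIV = 1"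
  using std_gauss.emeasure_space_1 by simp

lemma measure_std_gauss_UNIV [simp]: "measure std_gauss UNIV = 1"
  using std_gauss.prob_space by simp

lemma std_gauss_pair_density:
  "std_gauss \<Otimes>\<^sub>M std_gauss
    = density (lborel \<Otimes>\<^sub>M lborel) (\<lambda>p. ennreal (std_normal_density (fst p) * std_normal_density (snd p)))"
  using prob_space_imp_sigma_finite[OF prob_space_std_gauss] unfolding std_gauss_def
  by (subst pair_measure_density) (simp_all add: lborel.sigma_finite_measure_axioms case_prod_beta' ennreal_mult)

lemma distr_std_gauss_plane_rotation:
  assumes circle: "c\<^sup>2 + s\<^sup>2 = 1"
  shows "distr (std_gauss \<Otimes>\<^sub>M std_gauss) (borel \<Otimes>\<^sub>M borel) (plane_rotation c s) = std_gauss \<Otimes>\<^sub>M std_gauss"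
proof -
  let ?L = "lborel \<Otimes>\<^sub>M lborel :: (real \<times> real) measure"
  let ?f = "\<lambda>p. ennreal (std_normal_density (fst p) * std_normal_density (snd p))"
  have invariant: "?f (plane_rotation c s p) = ?f p" for p
  proof -
    obtain x y where p_eq: "p = (x, y)" by force
    have "(c * x - s * y)\<^sup>2 + (s * x + c * y)\<^sup>2 = (c\<^sup>2 + s\<^sup>2) * (x\<^sup>2 + y\<^sup>2)"
      by (simp add: power2_eq_square algebra_simps)
    then have "- (c * x - s * y)\<^sup>2 / 2 + - (s * x + c * y)\<^sup>2 / 2 = - x\<^sup>2 / 2 + - y\<^sup>2 / 2" using circle by simp
    then show ?thesis
      unfolding p_eq by (simp add: plane_rotation_def std_normal_density_def exp_add[symmetric])
  qed
  have "distr (density ?L ?f) (borel \<Otimes>\<^sub>M borel) (plane_rotation c s)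
      = distr (density ?L (\<lambda>p. ?f (plane_rotation c s p))) (borel \<Otimes>\<^sub>M borel) (plane_rotation c s)"
    unfolding invariant ..
  also have "\<dots> = density (distr ?L (borel \<Otimes>\<^sub>M borel) (plane_rotation c s)) ?f"
    by (rule density_distr[symmetric]) measurable
  also have "\<dots> = density ?L ?f" unfolding distr_lborel_plane_rotation[OF circle] ..
  finally show ?thesis unfolding std_gauss_pair_density .
qed

definition planar_gauss :: "real \<Rightarrow> real \<Rightarrow> real \<Rightarrow> real \<Rightarrow> (real \<times> real) measure" where
  "planar_gauss \<alpha> a \<beta> b
    = distr (std_gauss \<Otimes>\<^sub>M std_gauss) (borel \<Otimes>\<^sub>M borel) (\<lambda>(u, v). (\<alpha> * u + a * v, \<beta> * u + b * v))"

lemma sets_planar_gauss [simp, measurable_cong]: "sets (planar_gauss \<alpha> a \<beta> b) = sets (borel \<Otimes>\<^sub>M borel)"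
  by (simp add: planar_gauss_def)

lemma nn_integral_planar_gauss:
  assumes [measurable]: "F \<in> borel_measurable (borel \<Otimes>\<^sub>M borel)"
  shows "(\<integral>\<^sup>+p. F p \<partial>planar_gauss \<alpha> a \<beta> b) = (\<integral>\<^sup>+u. \<integral>\<^sup>+v. F (\<alpha> * u + a * v, \<beta> * u + b * v) \<partial>std_gauss \<partial>std_gauss)"
  unfolding planar_gauss_def by (subst nn_integral_distr) (simp_all add: std_gauss.nn_integral_fst[symmetric])

lemma planar_gauss_triangularize:
  obtains R \<beta>' b' where "0 \<le> R" "R\<^sup>2 = \<alpha>\<^sup>2 + a\<^sup>2" "R * \<beta>' = \<alpha> * \<beta> + a * b" "\<beta>'\<^sup>2 + b'\<^sup>2 = \<beta>\<^sup>2 + b\<^sup>2"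
    "planar_gauss \<alpha> a \<beta> b = planar_gauss R 0 \<beta>' b'"
proof -
  define R c s where "R = cmod (Complex \<alpha> a)" and "c = cos (Arg (Complex \<alpha> a))" and "s = sin (Arg (Complex \<alpha> a))"
  have R_nonneg: "0 \<le> R" and circle: "c\<^sup>2 + s\<^sup>2 = 1" by (simp_all add: R_def c_def s_def)
  have "rcis R (Arg (Complex \<alpha> a)) = Complex \<alpha> a" unfolding R_def by (rule rcis_cmod_Arg)
  then have \<alpha>_eq: "\<alpha> = R * c" and a_eq: "a = R * s" by (simp_all add: complex_eq_iff c_def s_def)
  define \<beta>' b' where "\<beta>' = \<beta> * c + b * s" and "b' = b * c - \<beta> * s"
  let ?G = "std_gauss \<Otimes>\<^sub>M std_gauss" and ?B = "borel \<Otimes>\<^sub>M borel :: (real \<times> real) measure"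
  let ?f = "\<lambda>(u, v). (\<alpha> * u + a * v, \<beta> * u + b * v)"
  have "\<alpha> * (c * u - s * v) + a * (s * u + c * v) = R * (c\<^sup>2 + s\<^sup>2) * u"
    and "\<beta> * (c * u - s * v) + b * (s * u + c * v) = \<beta>' * u + b' * v" for u v
    by (simp_all add: \<alpha>_eq a_eq \<beta>'_def b'_def algebra_simps power2_eq_square)
  then have rotated: "?f \<circ> plane_rotation c s = (\<lambda>(u, v). (R * u + 0 * v, \<beta>' * u + b' * v))"
    unfolding circle by (auto simp: plane_rotation_def)
  have "planar_gauss \<alpha> a \<beta> b = distr (distr ?G ?B (plane_rotation c s)) ?B ?f"
    unfolding planar_gauss_def distr_std_gauss_plane_rotation[OF circle] ..
  also have "\<dots> = planar_gauss R 0 \<beta>' b'"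
    unfolding planar_gauss_def rotated[symmetric] by (rule distr_distr) measurable
  finally have law_eq: "planar_gauss \<alpha> a \<beta> b = planar_gauss R 0 \<beta>' b'" .
  have "\<alpha>\<^sup>2 + a\<^sup>2 = R\<^sup>2 * (c\<^sup>2 + s\<^sup>2)" and "\<beta>'\<^sup>2 + b'\<^sup>2 = (\<beta>\<^sup>2 + b\<^sup>2) * (c\<^sup>2 + s\<^sup>2)"
    by (simp_all add: \<alpha>_eq a_eq \<beta>'_def b'_def power2_eq_square algebra_simps)
  moreover have "R * \<beta>' = \<alpha> * \<beta> + a * b" by (simp add: \<alpha>_eq a_eq \<beta>'_def algebra_simps)
  ultimately show ?thesis using that[OF R_nonneg _ _ _ law_eq] circle by simp
qed

lemma nn_integral_planar_gauss_add:
  obtains R \<beta>' \<gamma>' where "0 \<le> R" "0 \<le> \<gamma>'" "R\<^sup>2 = \<alpha>\<^sup>2 + a\<^sup>2" "R * \<beta>' = \<alpha> * \<beta> + a * b" "\<beta>'\<^sup>2 + \<gamma>'\<^sup>2 = \<beta>\<^sup>2 + \<gamma>\<^sup>2 + b\<^sup>2"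
    "\<And>F. F \<in> borel_measurable (borel \<Otimes>\<^sub>M borel) \<Longrightarrow>
      (\<integral>\<^sup>+y. \<integral>\<^sup>+p. F (fst p + a * y, snd p + b * y) \<partial>planar_gauss \<alpha> 0 \<beta> \<gamma> \<partial>std_gauss)
      = (\<integral>\<^sup>+p. F p \<partial>planar_gauss R 0 \<beta>' \<gamma>')"
proof -
  obtain R \<beta>' b' where row_fst: "0 \<le> R" "R\<^sup>2 = \<alpha>\<^sup>2 + a\<^sup>2" "R * \<beta>' = \<alpha> * \<beta> + a * b" "\<beta>'\<^sup>2 + b'\<^sup>2 = \<beta>\<^sup>2 + b\<^sup>2"
    and clear_fst: "planar_gauss \<alpha> a \<beta> b = planar_gauss R 0 \<beta>' b'"
    by (rule planar_gauss_triangularize)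
  obtain \<gamma>' \<delta> \<epsilon> where row_snd: "0 \<le> \<gamma>'" "\<gamma>'\<^sup>2 = b'\<^sup>2 + \<gamma>\<^sup>2" and clear_snd: "planar_gauss b' \<gamma> 0 0 = planar_gauss \<gamma>' 0 \<delta> \<epsilon>"
    by (rule planar_gauss_triangularize)
  show ?thesis
  proof (rule that[OF row_fst(1) row_snd(1) row_fst(2,3)])
    show "\<beta>'\<^sup>2 + \<gamma>'\<^sup>2 = \<beta>\<^sup>2 + \<gamma>\<^sup>2 + b\<^sup>2" using row_fst(4) row_snd(2) by simp
    fix F :: "real \<times> real \<Rightarrow> ennreal" assume [measurable]: "F \<in> borel_measurable (borel \<Otimes>\<^sub>M borel)"
    define H where "H p = (\<integral>\<^sup>+v. F (fst p, snd p + \<gamma> * v) \<partial>std_gauss)" for p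
    have [measurable]: "H \<in> borel_measurable (borel \<Otimes>\<^sub>M borel)" unfolding H_def by measurable
    have merge: "(\<integral>\<^sup>+y. \<integral>\<^sup>+v. f (b' * y + \<gamma> * v) \<partial>std_gauss \<partial>std_gauss) = (\<integral>\<^sup>+v. f (\<gamma>' * v) \<partial>std_gauss)"
      if [measurable]: "f \<in> borel_measurable borel" for f :: "real \<Rightarrow> ennreal"
      using arg_cong[OF clear_snd, of "\<lambda>M. \<integral>\<^sup>+p. f (fst p) \<partial>M"] by (simp add: nn_integral_planar_gauss)
    have "(\<integral>\<^sup>+y. \<integral>\<^sup>+p. F (fst p + a * y, snd p + b * y) \<partial>planar_gauss \<alpha> 0 \<beta> \<gamma> \<partial>std_gauss)
        = (\<integral>\<^sup>+y. \<integral>\<^sup>+u. H (\<alpha> * u + a * y, \<beta> * u + b * y) \<partial>std_gauss \<partial>std_gauss)"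
      by (simp add: H_def nn_integral_planar_gauss algebra_simps)
    also have "\<dots> = (\<integral>\<^sup>+u. \<integral>\<^sup>+y. H (\<alpha> * u + a * y, \<beta> * u + b * y) \<partial>std_gauss \<partial>std_gauss)"
      by (rule std_gauss_pair.Fubini') measurable
    also have "\<dots> = (\<integral>\<^sup>+u. \<integral>\<^sup>+y. H (R * u, \<beta>' * u + b' * y) \<partial>std_gauss \<partial>std_gauss)"
      using arg_cong[OF clear_fst, of "\<lambda>M. \<integral>\<^sup>+p. H p \<partial>M"] by (simp add: nn_integral_planar_gauss)
    also have "\<dots> = (\<integral>\<^sup>+u. \<integral>\<^sup>+y. \<integral>\<^sup>+v. F (R * u, \<beta>' * u + (b' * y + \<gamma> * v)) \<partial>std_gauss \<partial>std_gauss \<partial>std_gauss)"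
      by (simp add: H_def add.assoc)
    also have "\<dots> = (\<integral>\<^sup>+p. F p \<partial>planar_gauss R 0 \<beta>' \<gamma>')"
      by (subst merge) (simp_all add: nn_integral_planar_gauss)
    finally show "(\<integral>\<^sup>+y. \<integral>\<^sup>+p. F (fst p + a * y, snd p + b * y) \<partial>planar_gauss \<alpha> 0 \<beta> \<gamma> \<partial>std_gauss)
      = (\<integral>\<^sup>+p. F p \<partial>planar_gauss R 0 \<beta>' \<gamma>')" .
  qed
qed

subsection \<open>Linear images of the standard Gaussian vector\<close>

abbreviation gauss_vec :: "nat \<Rightarrow> (nat \<Rightarrow> real) measure" where
  "gauss_vec n \<equiv> PiM {..<n} (\<lambda>_. std_gauss)"

abbreviation (input) dot :: "nat \<Rightarrow> (nat \<Rightarrow> real) \<Rightarrow> (nat \<Rightarrow> real) \<Rightarrow> real" where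
  "dot n a b \<equiv> (\<Sum>k<n. a k * b k)"

interpretation gauss_vec: prob_space "gauss_vec n" for n
  by (intro prob_space_PiM prob_space_std_gauss)

lemma sets_gauss_vec: "sets (gauss_vec n) = sets (PiM {..<n} (\<lambda>_. borel))"
  by (intro sets_PiM_cong) simp_all

lemma measurable_fun_upd_lessThan_Suc [measurable]:
  "(\<lambda>p. (snd p)(n := fst p)) \<in> borel \<Otimes>\<^sub>M PiM {..<n} (\<lambda>_. borel) \<rightarrow>\<^sub>M PiM {..<Suc n} (\<lambda>_. borel)"
  unfolding lessThan_Suc by (intro measurable_fun_upd[where J="{..<n}"]) auto

lemma nn_integral_gauss_vec_Suc:
  assumes [measurable]: "f \<in> borel_measurable (PiM {..<Suc n} (\<lambda>_. borel))"
  shows "(\<integral>\<^sup>+z. f z \<partial>gauss_vec (Suc n)) = (\<integral>\<^sup>+y. \<integral>\<^sup>+x. f (x(n := y)) \<partial>gauss_vec n \<partial>std_gauss)"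
proof -
  interpret product_prob_space "\<lambda>_. std_gauss" "{..<n}" ..
  have "f \<in> borel_measurable (gauss_vec (Suc n))"
    using assms by (simp add: measurable_cong_sets[OF sets_gauss_vec refl])
  then show ?thesis
    unfolding lessThan_Suc by (intro product_nn_integral_insert_rev) auto
qed

lemma distr_gauss_vec_dot_pair_triangular:
  obtains \<alpha> \<beta> \<gamma> where "0 \<le> \<alpha>" "0 \<le> \<gamma>" "\<alpha>\<^sup>2 = dot n a a" "\<alpha> * \<beta> = dot n a b" "\<beta>\<^sup>2 + \<gamma>\<^sup>2 = dot n b b"
    "distr (gauss_vec n) (borel \<Otimes>\<^sub>M borel) (\<lambda>z. (dot n a z, dot n b z)) = planar_gauss \<alpha> 0 \<beta> \<gamma>"
proof (induction n arbitrary: thesis)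
  case 0
  have "distr (gauss_vec 0) (borel \<Otimes>\<^sub>M borel) (\<lambda>z. (dot 0 a z, dot 0 b z)) = planar_gauss 0 0 0 0"
    by (rule measure_eqI_nn_integral)
      (simp_all add: nn_integral_distr nn_integral_planar_gauss gauss_vec.emeasure_space_1[of 0, simplified])
  then show ?case using "0.prems"[of 0 0 0] by simp
next
  case (Suc n)
  let ?law = "\<lambda>n. distr (gauss_vec n) (borel \<Otimes>\<^sub>M borel) (\<lambda>z. (dot n a z, dot n b z))"
  obtain \<alpha> \<beta> \<gamma> where gram: "0 \<le> \<alpha>" "0 \<le> \<gamma>" "\<alpha>\<^sup>2 = dot n a a" "\<alpha> * \<beta> = dot n a b" "\<beta>\<^sup>2 + \<gamma>\<^sup>2 = dot n b b"
    and law_eq: "?law n = planar_gauss \<alpha> 0 \<beta> \<gamma>"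
    by (rule Suc.IH)
  obtain R \<beta>' \<gamma>' where gram_Suc: "0 \<le> R" "0 \<le> \<gamma>'" "R\<^sup>2 = \<alpha>\<^sup>2 + (a n)\<^sup>2" "R * \<beta>' = \<alpha> * \<beta> + a n * b n"
      "\<beta>'\<^sup>2 + \<gamma>'\<^sup>2 = \<beta>\<^sup>2 + \<gamma>\<^sup>2 + (b n)\<^sup>2"
    and law_add: "\<And>F. F \<in> borel_measurable (borel \<Otimes>\<^sub>M borel) \<Longrightarrow>
      (\<integral>\<^sup>+y. \<integral>\<^sup>+p. F (fst p + a n * y, snd p + b n * y) \<partial>planar_gauss \<alpha> 0 \<beta> \<gamma> \<partial>std_gauss)
      = (\<integral>\<^sup>+p. F p \<partial>planar_gauss R 0 \<beta>' \<gamma>')"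
    by (rule nn_integral_planar_gauss_add[of \<alpha> "a n" \<beta> "b n" \<gamma>]) blast
  have "?law (Suc n) = planar_gauss R 0 \<beta>' \<gamma>'"
  proof (rule measure_eqI_nn_integral)
    fix F :: "real \<times> real \<Rightarrow> ennreal" assume "F \<in> borel_measurable (planar_gauss R 0 \<beta>' \<gamma>')"
    then have F [measurable]: "F \<in> borel_measurable (borel \<Otimes>\<^sub>M borel)" by simp
    have "(\<integral>\<^sup>+p. F p \<partial>?law (Suc n)) = (\<integral>\<^sup>+z. F (dot (Suc n) a z, dot (Suc n) b z) \<partial>gauss_vec (Suc n))"
      by (rule nn_integral_distr) measurable
    also have "\<dots> = (\<integral>\<^sup>+y. \<integral>\<^sup>+x. F (dot (Suc n) a (x(n := y)), dot (Suc n) b (x(n := y))) \<partial>gauss_vec n \<partial>std_gauss)"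
      by (rule nn_integral_gauss_vec_Suc) measurable
    also have "\<dots> = (\<integral>\<^sup>+y. \<integral>\<^sup>+p. F (fst p + a n * y, snd p + b n * y) \<partial>?law n \<partial>std_gauss)"
      by (subst nn_integral_distr) simp_all
    also have "\<dots> = (\<integral>\<^sup>+p. F p \<partial>planar_gauss R 0 \<beta>' \<gamma>')"
      unfolding law_eq by (rule law_add) fact
    finally show "(\<integral>\<^sup>+p. F p \<partial>?law (Suc n)) = (\<integral>\<^sup>+p. F p \<partial>planar_gauss R 0 \<beta>' \<gamma>')" .
  qed simp
  then show ?case
    by (rule Suc.prems[OF gram_Suc(1,2), rotated -1]) (use gram gram_Suc in \<open>simp_all add: power2_eq_square\<close>)
qed

subsection \<open>The standard bivariate normal law\<close>

abbreviation binormal :: "real \<Rightarrow> (real \<times> real) measure" where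
  "binormal r \<equiv> planar_gauss 1 0 r (sqrt (1 - r\<^sup>2))"

lemma distr_gauss_vec_dot_pair:
  assumes "dot n a a = 1" "dot n b b = 1" "dot n a b = r"
  shows "distr (gauss_vec n) (borel \<Otimes>\<^sub>M borel) (\<lambda>z. (dot n a z, dot n b z)) = binormal r"
proof -
  obtain \<alpha> \<beta> \<gamma> where gram: "0 \<le> \<alpha>" "0 \<le> \<gamma>" "\<alpha>\<^sup>2 = dot n a a" "\<alpha> * \<beta> = dot n a b" "\<beta>\<^sup>2 + \<gamma>\<^sup>2 = dot n b b"
    and law_eq: "distr (gauss_vec n) (borel \<Otimes>\<^sub>M borel) (\<lambda>z. (dot n a z, dot n b z)) = planar_gauss \<alpha> 0 \<beta> \<gamma>"
    by (rule distr_gauss_vec_dot_pair_triangular)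
  have \<alpha>: "\<alpha> = 1" using gram assms(1) by (simp add: power2_eq_1_iff)
  moreover from this have \<beta>: "\<beta> = r" using gram assms(3) by simp
  moreover have "\<gamma> = sqrt (1 - r\<^sup>2)"
    using gram assms(2) \<beta> by (metis add_diff_cancel_left' real_sqrt_unique)
  ultimately show ?thesis by (simp add: law_eq)
qed

lemma distr_std_gauss_fst: "distr (std_gauss \<Otimes>\<^sub>M std_gauss) borel fst = std_gauss"
proof -
  have "distr (std_gauss \<Otimes>\<^sub>M std_gauss) borel fst = distr (std_gauss \<Otimes>\<^sub>M std_gauss) std_gauss fst"
    by (rule distr_cong) simp_all
  then show ?thesis by (simp only: std_gauss.distr_pair_fst)
qed

lemma distr_binormal_fst: "distr (binormal r) borel fst = std_gauss"
  unfolding planar_gauss_def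
  by (subst distr_distr) (simp_all add: comp_def case_prod_beta' distr_std_gauss_fst)

lemma distr_binormal_snd:
  assumes "\<bar>r\<bar> \<le> 1"
  shows "distr (binormal r) borel snd = std_gauss"
proof -
  have circle: "r\<^sup>2 + (- sqrt (1 - r\<^sup>2))\<^sup>2 = 1" using assms by (simp add: abs_square_le_1)
  have "distr (binormal r) borel snd
      = distr (distr (std_gauss \<Otimes>\<^sub>M std_gauss) (borel \<Otimes>\<^sub>M borel) (plane_rotation r (- sqrt (1 - r\<^sup>2)))) borel fst"
    unfolding planar_gauss_def plane_rotation_def by (subst (1 2) distr_distr) (auto simp: comp_def case_prod_beta')
  then show ?thesis by (simp only: distr_std_gauss_plane_rotation[OF circle] distr_std_gauss_fst)
qed

lemma integral_binormal:
  fixes F :: "real \<times> real \<Rightarrow> real"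
  assumes "integrable (binormal r) F"
  shows "(\<integral>p. F p \<partial>binormal r) = (\<integral>u. \<integral>v. F (u, r * u + sqrt (1 - r\<^sup>2) * v) \<partial>std_gauss \<partial>std_gauss)"
proof -
  let ?f = "\<lambda>(u, v). (1 * u + 0 * v, r * u + sqrt (1 - r\<^sup>2) * v)"
  have [measurable]: "F \<in> borel_measurable (borel \<Otimes>\<^sub>M borel)"
    using borel_measurable_integrable[OF assms] by simp
  have "integrable (std_gauss \<Otimes>\<^sub>M std_gauss) (\<lambda>p. F (?f p))"
    using assms unfolding planar_gauss_def by (subst (asm) integrable_distr_eq) measurable
  then have "(\<integral>u. \<integral>v. F (?f (u, v)) \<partial>std_gauss \<partial>std_gauss) = (\<integral>p. F (?f p) \<partial>(std_gauss \<Otimes>\<^sub>M std_gauss))"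
    by (rule std_gauss_pair.integral_fst')
  also have "\<dots> = (\<integral>p. F p \<partial>binormal r)"
    unfolding planar_gauss_def by (rule integral_distr[symmetric]) measurable
  finally show ?thesis by simp
qed

subsection \<open>Covariance matrices and their factors\<close>

lemma is_cov_gram:
  assumes gram: "\<And>i j. i < d \<Longrightarrow> j < d \<Longrightarrow> S i j = (\<Sum>k\<in>K. F k i * F k j)"
  shows "is_cov d S"
  unfolding is_cov_def
proof (intro conjI allI impI)
  fix x :: "nat \<Rightarrow> real"
  have "(\<Sum>i<d. \<Sum>j<d. x i * S i j * x j) = (\<Sum>i<d. \<Sum>j<d. \<Sum>k\<in>K. (x i * F k i) * (x j * F k j))"
    by (intro sum.cong refl) (simp add: gram sum_distrib_left sum_distrib_right mult_ac)
  also have "\<dots> = (\<Sum>i<d. \<Sum>k\<in>K. \<Sum>j<d. (x i * F k i) * (x j * F k j))"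
    by (intro sum.cong refl sum.swap)
  also have "\<dots> = (\<Sum>k\<in>K. \<Sum>i<d. \<Sum>j<d. (x i * F k i) * (x j * F k j))"
    by (rule sum.swap)
  also have "\<dots> = (\<Sum>k\<in>K. (\<Sum>i<d. x i * F k i)\<^sup>2)"
    by (simp only: power2_eq_square sum_product)
  also have "\<dots> \<ge> 0" by (intro sum_nonneg) simp
  finally show "0 \<le> (\<Sum>i<d. \<Sum>j<d. x i * S i j * x j)" .
qed (simp add: gram mult.commute)

lemma is_cov_sym: "is_cov d S \<Longrightarrow> i < d \<Longrightarrow> j < d \<Longrightarrow> S i j = S j i"
  unfolding is_cov_def by blast

lemma is_cov_quadratic_form_nonneg: "is_cov d S \<Longrightarrow> 0 \<le> (\<Sum>i<d. \<Sum>j<d. x i * S i j * x j)"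
  unfolding is_cov_def by blast

lemma is_cov_principal_minor:
  assumes S: "is_cov d S" and "i < d" "j < d"
  shows "0 \<le> a\<^sup>2 * S i i + 2 * a * b * S i j + b\<^sup>2 * S j j"
proof -
  define x where "x k = (if k = i then a else 0) + (if k = j then b else 0)" for k
  have sum_x: "(\<Sum>k<d. f k * x k) = a * f i + b * f j" for f
    using assms(2,3) by (simp add: x_def algebra_simps sum.distrib if_distrib[where f="\<lambda>y. _ * y"] cong: if_cong)
  have "0 \<le> (\<Sum>k<d. \<Sum>l<d. x k * S k l * x l)"
    using S by (rule is_cov_quadratic_form_nonneg)
  also have "\<dots> = (\<Sum>k<d. x k * (\<Sum>l<d. S k l * x l))"
    by (simp add: sum_distrib_left mult.assoc)
  also have "\<dots> = (\<Sum>k<d. (a * S k i + b * S k j) * x k)"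
    by (intro sum.cong refl, subst sum_x) (rule mult.commute)
  also have "\<dots> = a\<^sup>2 * S i i + 2 * a * b * S i j + b\<^sup>2 * S j j"
    unfolding sum_x using is_cov_sym[OF S assms(3,2)] by (simp add: power2_eq_square algebra_simps)
  finally show ?thesis .
qed

lemma is_cov_entry_eq_0:
  assumes S: "is_cov d S" and "i < d" "j < d" and zero: "S j j = 0"
  shows "S i j = 0"
proof (rule ccontr)
  assume "S i j \<noteq> 0"
  then show False
    using is_cov_principal_minor[OF assms(1-3), of 1 "- (S i i + 1) / (2 * S i j)"] zero
    by (simp add: field_simps)
qed

lemma abs_correlation_le_1:
  assumes "is_cov d S" "i < d" "j < d" "S i i = 1" "S j j = 1"
  shows "\<bar>S i j\<bar> \<le> 1"
  using is_cov_principal_minor[OF assms(1-3), of 1 1] is_cov_principal_minor[OF assms(1-3), of 1 "- 1"] assms(4,5)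
  by simp

definition schur_complement :: "nat \<Rightarrow> (nat \<Rightarrow> nat \<Rightarrow> real) \<Rightarrow> nat \<Rightarrow> nat \<Rightarrow> real" where
  "schur_complement d S i j = S i j - S i d * S j d / S d d"

lemma quadratic_form_Suc:
  fixes S :: "nat \<Rightarrow> nat \<Rightarrow> real"
  assumes sym: "\<And>i. i < d \<Longrightarrow> S d i = S i d"
  shows "(\<Sum>i<Suc d. \<Sum>j<Suc d. x i * S i j * x j)
    = (\<Sum>i<d. \<Sum>j<d. x i * S i j * x j) + 2 * x d * (\<Sum>i<d. x i * S i d) + (x d)\<^sup>2 * S d d"
proof -
  have "(\<Sum>j<d. x d * S d j * x j) = x d * (\<Sum>i<d. x i * S i d)"
    unfolding sum_distrib_left by (rule sum.cong) (simp_all add: sym)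
  then show ?thesis
    by (simp add: sum.distrib sum_distrib_left sum_distrib_right power2_eq_square algebra_simps)
qed

lemma is_cov_schur_complement:
  assumes S: "is_cov (Suc d) S"
  shows "is_cov d (schur_complement d S)"
  unfolding is_cov_def
proof (intro conjI allI impI)
  show "schur_complement d S i j = schur_complement d S j i" if "i < d" "j < d" for i j
    using is_cov_sym[OF S, of i j] that by (simp add: schur_complement_def)
  fix x :: "nat \<Rightarrow> real"
  define q l where "q = (\<Sum>i<d. \<Sum>j<d. x i * S i j * x j)" and "l = (\<Sum>i<d. x i * S i d)"
  have "(\<Sum>i<d. \<Sum>j<d. x i * schur_complement d S i j * x j) = q - (\<Sum>i<d. \<Sum>j<d. (x i * S i d) * (x j * S j d)) / S d d"
    unfolding q_def schur_complement_def sum_divide_distrib sum_subtractf[symmetric]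
    by (intro sum.cong refl) (simp add: algebra_simps)
  also have "\<dots> = q - l * l / S d d"
    unfolding l_def sum_product ..
  also have "\<dots> = q + 2 * (- l / S d d) * l + (- l / S d d)\<^sup>2 * S d d"
    by (simp add: power2_eq_square field_simps)
  also have "\<dots> = (\<Sum>i<Suc d. \<Sum>j<Suc d. (x(d := - l / S d d)) i * S i j * (x(d := - l / S d d)) j)"
    by (subst quadratic_form_Suc) (use is_cov_sym[OF S] in \<open>auto simp: q_def l_def\<close>)
  also have "\<dots> \<ge> 0" using S by (rule is_cov_quadratic_form_nonneg)
  finally show "0 \<le> (\<Sum>i<d. \<Sum>j<d. x i * schur_complement d S i j * x j)" .
qed

lemma is_cov_factor_exists:
  assumes "is_cov d S"
  shows "\<exists>A. \<forall>i<d. \<forall>j<d. dot d (A i) (A j) = S i j"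
  using assms
proof (induction d arbitrary: S)
  case 0
  then show ?case by simp
next
  case (Suc d)
  obtain A where A: "\<And>i j. i < d \<Longrightarrow> j < d \<Longrightarrow> dot d (A i) (A j) = schur_complement d S i j"
    using Suc.IH[OF is_cov_schur_complement[OF Suc.prems]] by blast
  have diag: "0 \<le> S d d"
    using is_cov_principal_minor[OF Suc.prems, of d d 1 0] by simp
  define B where "B i k = (if k < d then (if i < d then A i k else 0) else S i d / sqrt (S d d))" for i k
  have "dot (Suc d) (B i) (B j) = S i j" if ij: "i < Suc d" "j < Suc d" for i j
  proof -
    have "dot d (B i) (B j) = (if i < d \<and> j < d then schur_complement d S i j else 0)"
      by (auto simp: B_def A)
    then have dot_B: "dot (Suc d) (B i) (B j)
        = (if i < d \<and> j < d then schur_complement d S i j else 0) + S i d * S j d / S d d"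
      using diag by (simp add: B_def)
    have last: "S k d * S d d / S d d = S k d" if "k < Suc d" for k
      using is_cov_entry_eq_0[OF Suc.prems that, of d] by simp
    consider "i < d" "j < d" | "i = d" | "j = d" using ij by (auto simp: less_Suc_eq)
    then show ?thesis
    proof cases
      case 1
      then show ?thesis unfolding dot_B by (simp add: schur_complement_def)
    next
      case 2
      then show ?thesis unfolding dot_B using last[OF ij(2)] is_cov_sym[OF Suc.prems ij] by (simp add: mult.commute)
    next
      case 3
      then show ?thesis unfolding dot_B using last[OF ij(1)] by simp
    qed
  qed
  then show ?case by blast
qed

lemma dot_cov_factor:
  assumes "is_cov d S" "i < d" "j < d"
  shows "dot d (cov_factor d S i) (cov_factor d S j) = S i j"
  using someI_ex[OF is_cov_factor_exists[OF assms(1)]] assms(2,3) unfolding cov_factor_def by blast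

abbreviation (input) cov_factor_transpose :: "nat \<Rightarrow> (nat \<Rightarrow> nat \<Rightarrow> real) \<Rightarrow> (nat \<Rightarrow> real) \<Rightarrow> nat \<Rightarrow> real" where
  "cov_factor_transpose d S w k \<equiv> (\<Sum>j<d. w j * cov_factor d S j k)"

lemma dot_cov_factor_transpose:
  assumes "is_cov d S" "i < d"
  shows "dot d (cov_factor d S i) (cov_factor_transpose d S w) = dot d (S i) w"
proof -
  have "dot d (cov_factor d S i) (cov_factor_transpose d S w)
      = (\<Sum>k<d. \<Sum>j<d. (cov_factor d S i k * cov_factor d S j k) * w j)"
    by (simp add: sum_distrib_left mult_ac)
  also have "\<dots> = (\<Sum>j<d. dot d (cov_factor d S i) (cov_factor d S j) * w j)"
    by (subst sum.swap) (simp add: sum_distrib_right)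
  also have "\<dots> = dot d (S i) w"
    using assms by (intro sum.cong) (simp_all add: dot_cov_factor)
  finally show ?thesis .
qed

lemma dot_cov_factor_transpose_transpose:
  assumes "is_cov d S"
  shows "dot d (cov_factor_transpose d S v) (cov_factor_transpose d S w) = (\<Sum>i<d. v i * dot d (S i) w)"
proof -
  have "dot d (cov_factor_transpose d S v) (cov_factor_transpose d S w)
      = (\<Sum>i<d. v i * dot d (cov_factor d S i) (cov_factor_transpose d S w))"
    unfolding sum_distrib_right by (subst sum.swap) (simp add: sum_distrib_left mult_ac)
  also have "\<dots> = (\<Sum>i<d. v i * dot d (S i) w)"
    by (intro sum.cong refl) (simp add: dot_cov_factor_transpose[OF assms])
  finally show ?thesis .
qed

subsection \<open>Likelihood ratios of shifted Gaussian vectors\<close>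

lemma nn_integral_std_gauss:
  "f \<in> borel_measurable borel \<Longrightarrow>
    (\<integral>\<^sup>+x. f x \<partial>std_gauss) = (\<integral>\<^sup>+x. ennreal (std_normal_density x) * f x \<partial>lborel)"
  unfolding std_gauss_def by (rule nn_integral_density) simp_all

lemma nn_integral_std_gauss_shift:
  fixes f :: "real \<Rightarrow> ennreal"
  assumes [measurable]: "f \<in> borel_measurable borel"
  shows "(\<integral>\<^sup>+y. f (y + h) \<partial>std_gauss) = (\<integral>\<^sup>+y. f y * ennreal (exp (h * y - h * h / 2)) \<partial>std_gauss)"
proof -
  have "(\<integral>\<^sup>+y. f y * ennreal (exp (h * y - h * h / 2)) \<partial>std_gauss)
      = (\<integral>\<^sup>+y. ennreal (std_normal_density y) * (f y * ennreal (exp (h * y - h * h / 2))) \<partial>lborel)"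
    by (rule nn_integral_std_gauss) simp
  also have "\<dots> = (\<integral>\<^sup>+y. ennreal (std_normal_density (y - h)) * f y \<partial>lborel)"
  proof (rule nn_integral_cong)
    fix y
    have "std_normal_density (y - h) = std_normal_density y * exp (h * y - h * h / 2)"
      by (simp add: std_normal_density_def exp_add[symmetric] power2_eq_square field_simps)
    then show "ennreal (std_normal_density y) * (f y * ennreal (exp (h * y - h * h / 2)))
        = ennreal (std_normal_density (y - h)) * f y"
      by (simp add: ennreal_mult mult_ac)
  qed
  also have "\<dots> = (\<integral>\<^sup>+y. ennreal (std_normal_density y) * f (y + h) \<partial>lborel)"
    by (subst nn_integral_real_affine[of _ 1 h]) (simp_all add: add.commute)
  also have "\<dots> = (\<integral>\<^sup>+y. f (y + h) \<partial>std_gauss)"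
    by (rule nn_integral_std_gauss[symmetric]) simp
  finally show ?thesis by simp
qed

abbreviation gauss_lr :: "nat \<Rightarrow> (nat \<Rightarrow> real) \<Rightarrow> (nat \<Rightarrow> real) \<Rightarrow> real" where
  "gauss_lr n h z \<equiv> exp (dot n h z - dot n h h / 2)"

lemma nn_integral_gauss_vec_shift:
  assumes "F \<in> borel_measurable (PiM {..<n} (\<lambda>_. borel))"
  shows "(\<integral>\<^sup>+z. F (\<lambda>i\<in>{..<n}. z i + h i) \<partial>gauss_vec n) = (\<integral>\<^sup>+z. F z * ennreal (gauss_lr n h z) \<partial>gauss_vec n)"
  using assms
proof (induction n arbitrary: F)
  case 0
  then show ?case by (intro nn_integral_cong) (simp add: space_PiM PiE_def extensional_def restrict_def)
next
  case (Suc n)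
  note F [measurable] = Suc.prems
  have [measurable]: "(\<lambda>x. x(n := y)) \<in> PiM {..<n} (\<lambda>_. borel) \<rightarrow>\<^sub>M PiM {..<Suc n} (\<lambda>_. borel)" for y :: real
    unfolding lessThan_Suc by (intro measurable_fun_upd[where J="{..<n}"]) auto
  define f where "f y = (\<integral>\<^sup>+x. F (x(n := y)) * ennreal (gauss_lr n h x) \<partial>gauss_vec n)" for y
  have "(\<lambda>y. \<integral>\<^sup>+x. F ((snd (y, x))(n := fst (y, x))) * ennreal (gauss_lr n h (snd (y, x))) \<partial>gauss_vec n)
      \<in> borel_measurable borel"
    by measurable
  then have [measurable]: "f \<in> borel_measurable borel" unfolding f_def by simp
  have "(\<integral>\<^sup>+z. F (\<lambda>i\<in>{..<Suc n}. z i + h i) \<partial>gauss_vec (Suc n))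
      = (\<integral>\<^sup>+y. \<integral>\<^sup>+x. F (\<lambda>i\<in>{..<Suc n}. (x(n := y)) i + h i) \<partial>gauss_vec n \<partial>std_gauss)"
    by (rule nn_integral_gauss_vec_Suc) measurable
  also have "\<dots> = (\<integral>\<^sup>+y. \<integral>\<^sup>+x. F ((\<lambda>i\<in>{..<n}. x i + h i)(n := y + h n)) \<partial>gauss_vec n \<partial>std_gauss)"
    by (intro nn_integral_cong arg_cong[where f=F]) (auto simp: fun_eq_iff restrict_def)
  also have "\<dots> = (\<integral>\<^sup>+y. f (y + h n) \<partial>std_gauss)"
    unfolding f_def by (intro nn_integral_cong Suc.IH) measurable
  also have "\<dots> = (\<integral>\<^sup>+y. f y * ennreal (exp (h n * y - h n * h n / 2)) \<partial>std_gauss)"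
    by (rule nn_integral_std_gauss_shift) simp
  also have "\<dots> = (\<integral>\<^sup>+y. \<integral>\<^sup>+x. F (x(n := y)) * ennreal (gauss_lr n h x)
      * ennreal (exp (h n * y - h n * h n / 2)) \<partial>gauss_vec n \<partial>std_gauss)"
    unfolding f_def by (intro nn_integral_cong nn_integral_multc[symmetric]) measurable
  also have "\<dots> = (\<integral>\<^sup>+y. \<integral>\<^sup>+x. F (x(n := y)) * ennreal (gauss_lr (Suc n) h (x(n := y))) \<partial>gauss_vec n \<partial>std_gauss)"
    by (intro nn_integral_cong)
      (simp add: mult.assoc ennreal_mult[symmetric] exp_add[symmetric] algebra_simps add_divide_distrib)
  also have "\<dots> = (\<integral>\<^sup>+z. F z * ennreal (gauss_lr (Suc n) h z) \<partial>gauss_vec (Suc n))"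
    by (rule nn_integral_gauss_vec_Suc[symmetric]) measurable
  finally show ?case .
qed

lemma nn_integral_gauss_lr: "(\<integral>\<^sup>+z. ennreal (gauss_lr n h z) \<partial>gauss_vec n) = 1"
  using nn_integral_gauss_vec_shift[of "\<lambda>_. 1" n h] gauss_vec.emeasure_space_1[of n] by simp

lemma nn_integral_gauss_lr_mult:
  "(\<integral>\<^sup>+z. ennreal (gauss_lr n h z * gauss_lr n h' z) \<partial>gauss_vec n) = ennreal (exp (dot n h h'))"
proof -
  have "(\<integral>\<^sup>+z. ennreal (gauss_lr n h z * gauss_lr n h' z) \<partial>gauss_vec n)
      = (\<integral>\<^sup>+z. ennreal (gauss_lr n h' z) * ennreal (gauss_lr n h z) \<partial>gauss_vec n)"
    by (simp add: ennreal_mult mult.commute)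
  also have "\<dots> = (\<integral>\<^sup>+z. ennreal (gauss_lr n h' (\<lambda>i\<in>{..<n}. z i + h i)) \<partial>gauss_vec n)"
    by (rule nn_integral_gauss_vec_shift[symmetric]) measurable
  also have "\<dots> = (\<integral>\<^sup>+z. ennreal (exp (dot n h h')) * ennreal (gauss_lr n h' z) \<partial>gauss_vec n)"
    by (intro nn_integral_cong)
      (simp add: ennreal_mult[symmetric] exp_add[symmetric] algebra_simps sum.distrib)
  also have "\<dots> = ennreal (exp (dot n h h'))"
    by (subst nn_integral_cmult) (measurable, simp add: nn_integral_gauss_lr)
  finally show ?thesis .
qed

definition gauss_mixture_lr :: "nat \<Rightarrow> 'c set \<Rightarrow> ('c \<Rightarrow> nat \<Rightarrow> real) \<Rightarrow> (nat \<Rightarrow> real) \<Rightarrow> real" where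
  "gauss_mixture_lr n C H z = (\<Sum>c\<in>C. gauss_lr n (H c) z) / real (card C)"

lemma borel_measurable_gauss_mixture_lr [measurable]:
  "gauss_mixture_lr n C H \<in> borel_measurable (PiM {..<n} (\<lambda>_. borel))"
  unfolding gauss_mixture_lr_def by measurable

lemma gauss_mixture_lr_nonneg: "0 \<le> gauss_mixture_lr n C H z"
  unfolding gauss_mixture_lr_def by (intro divide_nonneg_nonneg sum_nonneg) auto

lemma nn_integral_gauss_mixture_lr:
  assumes [measurable]: "F \<in> borel_measurable (PiM {..<n} (\<lambda>_. borel))"
  shows "(\<integral>\<^sup>+z. F z * ennreal (gauss_mixture_lr n C H z) \<partial>gauss_vec n)
    = (\<Sum>c\<in>C. \<integral>\<^sup>+z. F (\<lambda>i\<in>{..<n}. z i + H c i) \<partial>gauss_vec n) * ennreal (1 / real (card C))"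
proof -
  have "F z * ennreal (gauss_mixture_lr n C H z)
      = (\<Sum>c\<in>C. F z * ennreal (gauss_lr n (H c) z)) * ennreal (1 / real (card C))" for z
    unfolding gauss_mixture_lr_def
    by (simp add: ennreal_mult[symmetric] sum_nonneg mult.assoc flip: sum_distrib_left)
  then have "(\<integral>\<^sup>+z. F z * ennreal (gauss_mixture_lr n C H z) \<partial>gauss_vec n)
      = (\<integral>\<^sup>+z. (\<Sum>c\<in>C. F z * ennreal (gauss_lr n (H c) z)) \<partial>gauss_vec n) * ennreal (1 / real (card C))"
    by (simp only:) (rule nn_integral_multc, measurable)
  also have "(\<integral>\<^sup>+z. (\<Sum>c\<in>C. F z * ennreal (gauss_lr n (H c) z)) \<partial>gauss_vec n)
      = (\<Sum>c\<in>C. \<integral>\<^sup>+z. F (\<lambda>i\<in>{..<n}. z i + H c i) \<partial>gauss_vec n)"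
    by (subst nn_integral_sum, measurable) (simp add: nn_integral_gauss_vec_shift)
  finally show ?thesis .
qed

lemma nn_integral_gauss_mixture_lr_eq_1:
  assumes "finite C" "C \<noteq> {}"
  shows "(\<integral>\<^sup>+z. ennreal (gauss_mixture_lr n C H z) \<partial>gauss_vec n) = 1"
proof -
  have "0 < card C" using assms by (simp add: card_gt_0_iff)
  then have "ennreal (real (card C)) * ennreal (1 / real (card C)) = 1"
    by (simp flip: ennreal_mult)
  then show ?thesis
    using nn_integral_gauss_mixture_lr[of "\<lambda>_. 1" n C H] gauss_vec.emeasure_space_1[of n]
    by (simp add: ennreal_of_nat_eq_real_of_nat)
qed

lemma nn_integral_gauss_mixture_lr_square:
  "(\<integral>\<^sup>+z. (ennreal (gauss_mixture_lr n C H z))\<^sup>2 \<partial>gauss_vec n)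
    = ennreal ((\<Sum>c\<in>C. \<Sum>c'\<in>C. exp (dot n (H c) (H c'))) / (real (card C))\<^sup>2)"
proof -
  let ?N = "ennreal (1 / (real (card C))\<^sup>2)"
  have "(gauss_mixture_lr n C H z)\<^sup>2
      = (\<Sum>c\<in>C. \<Sum>c'\<in>C. gauss_lr n (H c) z * gauss_lr n (H c') z) / (real (card C))\<^sup>2" for z
    unfolding gauss_mixture_lr_def sum_product[symmetric] by (simp add: power2_eq_square)
  then have "(ennreal (gauss_mixture_lr n C H z))\<^sup>2
      = (\<Sum>c\<in>C. \<Sum>c'\<in>C. ennreal (gauss_lr n (H c) z * gauss_lr n (H c') z)) * ?N" for z
    by (simp add: ennreal_power gauss_mixture_lr_nonneg ennreal_mult[symmetric] sum_nonneg del: mult_exp_exp)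
  then have "(\<integral>\<^sup>+z. (ennreal (gauss_mixture_lr n C H z))\<^sup>2 \<partial>gauss_vec n)
      = (\<Sum>c\<in>C. \<Sum>c'\<in>C. \<integral>\<^sup>+z. ennreal (gauss_lr n (H c) z * gauss_lr n (H c') z) \<partial>gauss_vec n) * ?N"
    by (simp only:, subst nn_integral_multc, measurable, simp add: nn_integral_sum del: mult_exp_exp sum_ennreal)
  also have "\<dots> = ennreal ((\<Sum>c\<in>C. \<Sum>c'\<in>C. exp (dot n (H c) (H c'))) / (real (card C))\<^sup>2)"
    unfolding nn_integral_gauss_lr_mult by (simp add: ennreal_mult[symmetric] sum_nonneg)
  finally show ?thesis .
qed

subsection \<open>A constrained risk inequality\<close>

lemma ennreal_power2_sum_le: "(x + y)\<^sup>2 \<le> 2 * x\<^sup>2 + 2 * (y :: ennreal)\<^sup>2"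
proof (cases "x = \<top> \<or> y = \<top>")
  case False
  then obtain a b where "x = ennreal a" "y = ennreal b" "0 \<le> a" "0 \<le> b"
    by (metis ennreal_cases)
  moreover have "(a + b)\<^sup>2 \<le> 2 * a\<^sup>2 + 2 * b\<^sup>2"
    using sum_squares_bound[of a b] by (simp add: power2_sum)
  ultimately show ?thesis
    by (simp add: ennreal_power ennreal_plus[symmetric] ennreal_mult[symmetric] ennreal_numeral[symmetric]
        del: ennreal_plus ennreal_numeral)
qed (auto simp: power2_eq_square ennreal_mult_top)

text \<open>Split \<open>t = \<integral> t L\<close> by \<open>t \<le> |T - t| + |T|\<close> and apply the Cauchy-Schwarz inequality to both halves.\<close>
lemma constrained_risk_inequality:
  fixes T L :: "'z \<Rightarrow> real"
  assumes [measurable]: "T \<in> borel_measurable M" "L \<in> borel_measurable M"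
    and L: "\<And>z. 0 \<le> L z" "(\<integral>\<^sup>+z. ennreal (L z) \<partial>M) = 1"
  shows "ennreal (t\<^sup>2) \<le> 2 * (\<integral>\<^sup>+z. ennreal ((T z - t)\<^sup>2) * ennreal (L z) \<partial>M)
    + 2 * (\<integral>\<^sup>+z. (ennreal (L z))\<^sup>2 \<partial>M) * (\<integral>\<^sup>+z. ennreal ((T z)\<^sup>2) \<partial>M)"
proof -
  define A where "A = (\<integral>\<^sup>+z. ennreal \<bar>T z - t\<bar> * ennreal (L z) \<partial>M)"
  define B where "B = (\<integral>\<^sup>+z. ennreal (L z) * ennreal \<bar>T z\<bar> \<partial>M)"
  have "A = (\<integral>\<^sup>+z. ennreal (\<bar>T z - t\<bar> * sqrt (L z)) * ennreal (sqrt (L z)) \<partial>M)"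
    unfolding A_def using L(1) by (intro nn_integral_cong) (simp flip: ennreal_mult)
  then have "A\<^sup>2 \<le> (\<integral>\<^sup>+z. (ennreal (\<bar>T z - t\<bar> * sqrt (L z)))\<^sup>2 \<partial>M) * (\<integral>\<^sup>+z. (ennreal (sqrt (L z)))\<^sup>2 \<partial>M)"
    by (simp only:) (rule Cauchy_Schwarz_nn_integral, measurable)
  also have "\<dots> = (\<integral>\<^sup>+z. ennreal ((T z - t)\<^sup>2) * ennreal (L z) \<partial>M)"
    using L by (simp add: ennreal_power power_mult_distrib ennreal_mult)
  finally have A_le: "A\<^sup>2 \<le> (\<integral>\<^sup>+z. ennreal ((T z - t)\<^sup>2) * ennreal (L z) \<partial>M)" .
  have "B\<^sup>2 \<le> (\<integral>\<^sup>+z. (ennreal (L z))\<^sup>2 \<partial>M) * (\<integral>\<^sup>+z. (ennreal \<bar>T z\<bar>)\<^sup>2 \<partial>M)"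
    unfolding B_def by (rule Cauchy_Schwarz_nn_integral) measurable
  then have B_le: "B\<^sup>2 \<le> (\<integral>\<^sup>+z. (ennreal (L z))\<^sup>2 \<partial>M) * (\<integral>\<^sup>+z. ennreal ((T z)\<^sup>2) \<partial>M)"
    by (simp add: ennreal_power)
  have "ennreal \<bar>t\<bar> = (\<integral>\<^sup>+z. ennreal \<bar>t\<bar> * ennreal (L z) \<partial>M)"
    using L(2) by (simp add: nn_integral_cmult)
  also have "\<dots> \<le> (\<integral>\<^sup>+z. ennreal \<bar>T z - t\<bar> * ennreal (L z) + ennreal (L z) * ennreal \<bar>T z\<bar> \<partial>M)"
  proof (rule nn_integral_mono)
    fix z
    have "\<bar>t\<bar> * L z \<le> (\<bar>T z - t\<bar> + \<bar>T z\<bar>) * L z"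
      using L(1) by (intro mult_right_mono) auto
    then show "ennreal \<bar>t\<bar> * ennreal (L z) \<le> ennreal \<bar>T z - t\<bar> * ennreal (L z) + ennreal (L z) * ennreal \<bar>T z\<bar>"
      using L(1) by (simp add: ennreal_mult[symmetric] ennreal_plus[symmetric] algebra_simps del: ennreal_plus)
  qed
  also have "\<dots> = A + B" unfolding A_def B_def by (rule nn_integral_add) measurable
  finally have "(ennreal \<bar>t\<bar>)\<^sup>2 \<le> (A + B)\<^sup>2" by (intro power_mono) auto
  also have "\<dots> \<le> 2 * A\<^sup>2 + 2 * B\<^sup>2" by (rule ennreal_power2_sum_le)
  also have "\<dots> \<le> 2 * (\<integral>\<^sup>+z. ennreal ((T z - t)\<^sup>2) * ennreal (L z) \<partial>M)
      + 2 * ((\<integral>\<^sup>+z. (ennreal (L z))\<^sup>2 \<partial>M) * (\<integral>\<^sup>+z. ennreal ((T z)\<^sup>2) \<partial>M))"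
    using A_le B_le by (intro add_mono mult_left_mono) auto
  finally show ?thesis by (simp add: ennreal_power mult.assoc)
qed

abbreviation noise :: "nat \<Rightarrow> (nat \<Rightarrow> nat \<Rightarrow> real) \<Rightarrow> nat \<Rightarrow> (nat \<Rightarrow> real) \<Rightarrow> real" where
  "noise d S i z \<equiv> dot d (cov_factor d S i) z"

lemma risk_eq:
  assumes T: "T \<in> estimators d"
  shows "risk d T \<theta> \<sigma> S
    = (\<integral>\<^sup>+z. ennreal ((T (\<lambda>i\<in>{..<d}. \<theta> i + \<sigma> * noise d S i z) - l2norm d \<theta>)\<^sup>2) \<partial>gauss_vec d)"
proof -
  have [measurable]: "T \<in> borel_measurable (PiM {..<d} (\<lambda>_. borel))"
    using T by (simp add: estimators_def)
  show ?thesis unfolding risk_def obs_law_def by (rule nn_integral_distr) measurable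
qed

lemma risk_eq_shift:
  assumes T: "T \<in> estimators d" and S: "is_cov d S" and \<theta>: "\<And>i. i < d \<Longrightarrow> \<theta> i = \<sigma> * dot d (S i) w"
  shows "risk d T \<theta> \<sigma> S = (\<integral>\<^sup>+z. ennreal ((T (\<lambda>i\<in>{..<d}.
    \<sigma> * noise d S i (\<lambda>k\<in>{..<d}. z k + cov_factor_transpose d S w k)) - l2norm d \<theta>)\<^sup>2) \<partial>gauss_vec d)"
proof -
  have "\<sigma> * noise d S i (\<lambda>k\<in>{..<d}. z k + cov_factor_transpose d S w k) = \<theta> i + \<sigma> * noise d S i z" if "i < d" for i z
    using dot_cov_factor_transpose[OF S that, of w] \<theta>[OF that] by (simp add: sum.distrib distrib_left)
  then have "(\<lambda>i\<in>{..<d}. \<sigma> * noise d S i (\<lambda>k\<in>{..<d}. z k + cov_factor_transpose d S w k))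
      = (\<lambda>i\<in>{..<d}. \<theta> i + \<sigma> * noise d S i z)" for z
    by (intro restrict_ext) simp
  then show ?thesis unfolding risk_eq[OF T] by (simp only:)
qed

lemma gauss_mixture_lower_bound:
  fixes w \<theta> :: "'c \<Rightarrow> nat \<Rightarrow> real"
  assumes choices: "finite C" "C \<noteq> {}" and S: "is_cov d S" and T: "T \<in> estimators d" and \<kappa>: "0 \<le> \<kappa>"
    and \<theta>_eq: "\<And>c i. c \<in> C \<Longrightarrow> i < d \<Longrightarrow> \<theta> c i = \<sigma> * dot d (S i) (w c)"
    and norm: "\<And>c. c \<in> C \<Longrightarrow> l2norm d (\<theta> c) = t"
    and null: "(\<lambda>_. 0, S) \<in> P" and alternatives: "\<And>c. c \<in> C \<Longrightarrow> (\<theta> c, S) \<in> P"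
    and overlap: "(\<Sum>c\<in>C. \<Sum>c'\<in>C. exp (\<Sum>i<d. w c i * dot d (S i) (w c'))) \<le> \<kappa> * (real (card C))\<^sup>2"
  shows "ennreal (t\<^sup>2) \<le> ennreal (2 * (1 + \<kappa>)) * (SUP p\<in>P. risk d T (fst p) \<sigma> (snd p))"
proof -
  define R where "R = (SUP p\<in>P. risk d T (fst p) \<sigma> (snd p))"
  have risk_le: "risk d T \<theta>' \<sigma> S \<le> R" if "(\<theta>', S) \<in> P" for \<theta>'
    using SUP_upper[OF that, of "\<lambda>p. risk d T (fst p) \<sigma> (snd p)"] by (simp add: R_def)
  have [measurable]: "T \<in> borel_measurable (PiM {..<d} (\<lambda>_. borel))"
    using T by (simp add: estimators_def)
  define H where "H c = cov_factor_transpose d S (w c)" for c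
  define T' where "T' z = T (\<lambda>i\<in>{..<d}. \<sigma> * noise d S i z)" for z
  have [measurable]: "T' \<in> borel_measurable (PiM {..<d} (\<lambda>_. borel))" unfolding T'_def by measurable
  have shift: "(\<integral>\<^sup>+z. ennreal ((T' (\<lambda>k\<in>{..<d}. z k + H c k) - t)\<^sup>2) \<partial>gauss_vec d) = risk d T (\<theta> c) \<sigma> S" if "c \<in> C" for c
    using risk_eq_shift[OF T S \<theta>_eq[OF that]] norm[OF that] by (simp only: T'_def H_def)
  let ?L = "gauss_mixture_lr d C H"
  have "(\<integral>\<^sup>+z. ennreal ((T' z - t)\<^sup>2) * ennreal (?L z) \<partial>gauss_vec d)
      = (\<Sum>c\<in>C. risk d T (\<theta> c) \<sigma> S) * ennreal (1 / real (card C))"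
    by (subst nn_integral_gauss_mixture_lr) (simp_all add: shift)
  also have "\<dots> \<le> (\<Sum>c\<in>C. R) * ennreal (1 / real (card C))"
    by (intro mult_right_mono sum_mono risk_le alternatives) simp_all
  also have "\<dots> = R"
    using choices
    by (simp add: ennreal_of_nat_eq_real_of_nat mult.commute[of _ R] mult.assoc card_gt_0_iff flip: ennreal_mult)
  finally have alternatives_le: "(\<integral>\<^sup>+z. ennreal ((T' z - t)\<^sup>2) * ennreal (?L z) \<partial>gauss_vec d) \<le> R" .
  have "(\<integral>\<^sup>+z. ennreal ((T' z)\<^sup>2) \<partial>gauss_vec d) = risk d T (\<lambda>_. 0) \<sigma> S"
    unfolding risk_eq[OF T] by (simp add: T'_def l2norm_def)
  then have null_le: "(\<integral>\<^sup>+z. ennreal ((T' z)\<^sup>2) \<partial>gauss_vec d) \<le> R" using risk_le[OF null] by simp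
  have second_moment_le: "(\<integral>\<^sup>+z. (ennreal (?L z))\<^sup>2 \<partial>gauss_vec d) \<le> ennreal \<kappa>"
    unfolding nn_integral_gauss_mixture_lr_square H_def dot_cov_factor_transpose_transpose[OF S]
    using overlap choices by (intro ennreal_leI) (simp add: divide_le_eq card_gt_0_iff)
  have "ennreal (t\<^sup>2) \<le> 2 * (\<integral>\<^sup>+z. ennreal ((T' z - t)\<^sup>2) * ennreal (?L z) \<partial>gauss_vec d)
      + 2 * (\<integral>\<^sup>+z. (ennreal (?L z))\<^sup>2 \<partial>gauss_vec d) * (\<integral>\<^sup>+z. ennreal ((T' z)\<^sup>2) \<partial>gauss_vec d)"
    by (rule constrained_risk_inequality)
      (simp_all add: gauss_mixture_lr_nonneg nn_integral_gauss_mixture_lr_eq_1 choices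
        measurable_cong_sets[OF sets_gauss_vec refl])
  also have "\<dots> \<le> 2 * R + 2 * ennreal \<kappa> * R"
    by (intro add_mono mult_mono alternatives_le null_le second_moment_le) auto
  also have "\<dots> = ennreal (2 * (1 + \<kappa>)) * R"
    using \<kappa> by (simp add: ennreal_mult distrib_left distrib_right)
  finally show ?thesis unfolding R_def .
qed

subsection \<open>Perfectly correlated blocks\<close>

lemma div_eq_iff_mem_interval: "0 < m \<Longrightarrow> i div m = b \<longleftrightarrow> i \<in> {b * m..<b * m + (m :: nat)}"
  using dividend_less_div_times[of m i] by (auto simp: div_nat_eqI algebra_simps)

lemma card_block:
  assumes "0 < m" "b * m + m \<le> d"
  shows "card {j\<in>{..<d}. j div m = b} = (m :: nat)"
proof -
  have "{j\<in>{..<d}. j div m = b} = {b * m..<b * m + m}"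
    using assms by (auto simp: div_eq_iff_mem_interval)
  then show ?thesis by simp
qed

lemma card_block_le:
  assumes "0 < m"
  shows "card {j\<in>{..<d}. j div m = b} \<le> (m :: nat)"
proof -
  have "{j\<in>{..<d}. j div m = b} \<subseteq> {b * m..<b * m + m}"
    using assms by (auto simp: div_eq_iff_mem_interval)
  then show ?thesis using card_mono[of "{b * m..<b * m + m}"] by simp
qed

definition block_cov :: "nat \<Rightarrow> nat \<Rightarrow> nat \<Rightarrow> nat \<Rightarrow> real" where
  "block_cov d m i j = of_bool (i < d \<and> j < d \<and> i div m = j div m)"

lemma is_cov_block_cov: "is_cov d (block_cov d m)"
proof (rule is_cov_gram)
  fix i j assume "i < d" "j < d"
  moreover have "i div m < d" using \<open>i < d\<close> div_le_dividend[of i m] by linarith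
  moreover have "(\<Sum>b<d. of_bool (i div m = b) * of_bool (j div m = b))
      = (\<Sum>b<d. if i div m = b then of_bool (j div m = i div m) else (0 :: real))"
    by (intro sum.cong) auto
  ultimately show "block_cov d m i j = (\<Sum>b<d. of_bool (i div m = b) * of_bool (j div m = b))"
    by (simp add: block_cov_def eq_commute)
qed

lemma frob_norm_block_cov_le:
  assumes m: "0 < m" and \<rho>: "real d * real m \<le> \<rho>\<^sup>2" "0 \<le> \<rho>"
  shows "frob_norm d (block_cov d m) \<le> \<rho>"
proof -
  have "(\<Sum>j<d. (block_cov d m i j)\<^sup>2) = (\<Sum>j<d. if j div m = i div m then 1 else 0)" if "i < d" for i
    using that by (intro sum.cong) (auto simp: block_cov_def)
  then have "(\<Sum>j<d. (block_cov d m i j)\<^sup>2) = real (card {j\<in>{..<d}. j div m = i div m})" if "i < d" for i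
    using that by (simp add: sum.If_cases Int_def)
  then have "(\<Sum>i<d. \<Sum>j<d. (block_cov d m i j)\<^sup>2) \<le> (\<Sum>i<d. real m)"
    using card_block_le[OF m] by (intro sum_mono) simp
  also have "\<dots> \<le> \<rho>\<^sup>2" using \<rho>(1) by simp
  finally show ?thesis unfolding frob_norm_def using \<rho>(2) by (intro real_le_lsqrt)
qed

text \<open>Group \<open>g\<close> consists of the blocks \<open>g * k, \<dots>, g * k + k - 1\<close>, of which \<open>c\<close> selects the block \<open>g * k + c g\<close>.\<close>
definition block_support :: "nat \<Rightarrow> nat \<Rightarrow> nat \<Rightarrow> (nat \<Rightarrow> nat) \<Rightarrow> nat set" where
  "block_support m n k c = {i. i div m div k < n \<and> i div m mod k = c (i div m div k)}"

lemma mem_block_support_cong: "i div m = j div m \<Longrightarrow> i \<in> block_support m n k c \<longleftrightarrow> j \<in> block_support m n k c"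
  by (simp add: block_support_def)

lemma block_support_bound:
  assumes "0 < m" "0 < k" "i \<in> block_support m n k c"
  shows "i div m * m + m \<le> n * k * m"
proof -
  have "i div m < n * k"
    using assms by (simp add: block_support_def div_less_iff_less_mult)
  then have "(i div m + 1) * m \<le> n * k * m" by (intro mult_right_mono) auto
  then show ?thesis by simp
qed

lemma block_support_subset:
  assumes "0 < m" "0 < k"
  shows "block_support m n k c \<subseteq> {..<n * k * m}"
proof
  fix i assume "i \<in> block_support m n k c"
  then have "i div m * m + m \<le> n * k * m" using assms by (intro block_support_bound)
  then show "i \<in> {..<n * k * m}" using dividend_less_div_times[OF assms(1), of i] by (simp add: algebra_simps)
qed

abbreviation agreements :: "nat \<Rightarrow> (nat \<Rightarrow> nat) \<Rightarrow> (nat \<Rightarrow> nat) \<Rightarrow> nat" where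
  "agreements n c c' \<equiv> card {g\<in>{..<n}. c g = c' g}"

lemma card_block_support_Int:
  assumes m: "0 < m" and k: "0 < k" and choice: "\<And>g. g < n \<Longrightarrow> c g < k"
  shows "card (block_support m n k c \<inter> block_support m n k c') = m * agreements n c c'"
proof -
  have agreeing: "c' g < k" if "g < n" "c g = c' g" for g using choice that by metis
  let ?A = "{g\<in>{..<n}. c g = c' g} \<times> {..<m}" and ?B = "block_support m n k c \<inter> block_support m n k c'"
  let ?f = "\<lambda>(g, r). (g * k + c g) * m + r" and ?f' = "\<lambda>i. (i div m div k, i mod m)"
  have "bij_betw ?f ?A ?B"
  proof (rule bij_betw_byWitness[where f'="?f'"])
    show "\<forall>p\<in>?A. ?f' (?f p) = p"
      using agreeing k by auto
    show "\<forall>i\<in>?B. ?f (?f' i) = i"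
      by (auto simp: block_support_def simp flip: div_mod_decomp) (metis div_mod_decomp)
    show "?f ` ?A \<subseteq> ?B"
      using agreeing k by (auto simp: block_support_def)
    show "?f' ` ?B \<subseteq> ?A"
      using m by (auto simp: block_support_def)
  qed
  then show ?thesis by (auto dest!: bij_betw_same_card simp: card_cartesian_product mult.commute)
qed

lemma card_block_support:
  assumes "0 < m" "0 < k" "\<And>g. g < n \<Longrightarrow> c g < k"
  shows "card (block_support m n k c) = n * m"
  using card_block_support_Int[of m k n c c] assms by simp

lemma block_cov_dot_block_support:
  assumes m: "0 < m" and k: "0 < k" and size: "n * k * m \<le> d" and i: "i < d"
  shows "dot d (block_cov d m i) (\<lambda>j. x * of_bool (j \<in> block_support m n k c))
    = x * real m * of_bool (i \<in> block_support m n k c)"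
proof -
  have "block_cov d m i j * (x * of_bool (j \<in> block_support m n k c))
      = (if j div m = i div m then x * of_bool (i \<in> block_support m n k c) else 0)" if "j < d" for j
    using that i mem_block_support_cong[of i m j n k c] by (auto simp: block_cov_def)
  then have "dot d (block_cov d m i) (\<lambda>j. x * of_bool (j \<in> block_support m n k c))
      = real (card {j\<in>{..<d}. j div m = i div m}) * (x * of_bool (i \<in> block_support m n k c))"
    by (simp add: sum.If_cases Int_def)
  also have "\<dots> = x * real m * of_bool (i \<in> block_support m n k c)"
    using card_block[OF m order_trans[OF block_support_bound[OF m k] size], of i c] by simp
  finally show ?thesis .
qed

lemma sum_exp_agreements:
  fixes c :: "nat \<Rightarrow> nat" and x :: real
  assumes choice: "\<And>g. g < n \<Longrightarrow> c g < k"
  shows "(\<Sum>c'\<in>{..<n} \<rightarrow>\<^sub>E {..<k}. exp (x * real (agreements n c c'))) = (exp x + (real k - 1)) ^ n"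
proof -
  have "exp (x * real (agreements n c c')) = (\<Prod>g<n. if c g = c' g then exp x else 1)" for c'
    by (simp add: prod.If_cases Int_def exp_of_nat2_mult)
  then have "(\<Sum>c'\<in>{..<n} \<rightarrow>\<^sub>E {..<k}. exp (x * real (agreements n c c')))
      = (\<Sum>c'\<in>{..<n} \<rightarrow>\<^sub>E {..<k}. \<Prod>g<n. if c g = c' g then exp x else 1)"
    by simp
  also have "\<dots> = (\<Prod>g<n. \<Sum>y<k. if c g = y then exp x else 1)"
    by (rule prod_sum_PiE[symmetric]) auto
  also have "\<dots> = (\<Prod>g<n. exp x + (real k - 1))"
  proof (rule prod.cong)
    fix g assume "g \<in> {..<n}"
    then have "c g < k" using choice by simp
    have "(\<Sum>y<k. if c g = y then exp x else 1) = (\<Sum>y<k. 1 + (if c g = y then exp x - 1 else 0))"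
      by (intro sum.cong) auto
    also have "\<dots> = exp x + (real k - 1)" using \<open>c g < k\<close> by (simp add: sum.distrib)
    finally show "(\<Sum>y<k. if c g = y then exp x else 1) = exp x + (real k - 1)" .
  qed simp
  finally show ?thesis by simp
qed

lemma sum_exp_agreements_le:
  assumes n: "0 < n" and k: "0 < k" and x: "x = ln (1 + real k / real n)"
  shows "(\<Sum>c\<in>{..<n} \<rightarrow>\<^sub>E {..<k}. \<Sum>c'\<in>{..<n} \<rightarrow>\<^sub>E {..<k}. exp (x * real (agreements n c c')))
    \<le> exp 1 * (real (card ({..<n} \<rightarrow>\<^sub>E {..<k})))\<^sup>2"
proof -
  let ?C = "{..<n} \<rightarrow>\<^sub>E {..<k}"
  have card_choices: "real (card ?C) = real k ^ n" by (simp add: card_PiE)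
  have "exp x + (real k - 1) = real k * (1 + 1 / real n)"
    unfolding x using n k by (simp add: add_pos_nonneg algebra_simps)
  then have "(\<Sum>c\<in>?C. \<Sum>c'\<in>?C. exp (x * real (agreements n c c'))) = (\<Sum>c\<in>?C. (real k * (1 + 1 / real n)) ^ n)"
    by (intro sum.cong refl) (subst sum_exp_agreements, auto)
  also have "\<dots> = (1 + 1 / real n) ^ n * (real (card ?C))\<^sup>2"
    unfolding card_choices by (simp add: card_choices power_mult_distrib power2_eq_square)
  also have "\<dots> \<le> exp 1 * (real (card ?C))\<^sup>2"
    using exp_ge_one_plus_x_over_n_power_n[of n 1] n by (intro mult_right_mono) auto
  finally show ?thesis .
qed

abbreviation worst_risk :: "nat \<Rightarrow> nat \<Rightarrow> real \<Rightarrow> real \<Rightarrow> ((nat \<Rightarrow> real) \<Rightarrow> real) \<Rightarrow> ennreal" where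
  "worst_risk s d \<rho> \<sigma> T \<equiv> (SUP p\<in>Theta s d \<rho>. risk d T (fst p) \<sigma> (snd p))"

lemma block_signal_in_Theta:
  assumes m: "0 < m" and k: "0 < k" and choice: "\<And>g. g < n \<Longrightarrow> c g < k" and size: "n * k * m \<le> d" and s: "n * m \<le> s"
    and \<rho>: "real d * real m \<le> \<rho>\<^sup>2" "0 \<le> \<rho>"
  shows "(\<lambda>i. x * of_bool (i \<in> block_support m n k c), block_cov d m) \<in> Theta s d \<rho>"
proof -
  have support: "block_support m n k c \<subseteq> {..<d}"
    using block_support_subset[OF m k] size by fastforce
  have "l0norm d (\<lambda>i. x * of_bool (i \<in> block_support m n k c)) \<le> card (block_support m n k c)"
    unfolding l0norm_def using support by (intro card_mono) (auto intro: finite_subset)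
  then have "l0norm d (\<lambda>i. x * of_bool (i \<in> block_support m n k c)) \<le> s"
    using card_block_support[OF m k choice] s by simp
  then show ?thesis
    using support is_cov_block_cov[of d m] frob_norm_block_cov_le[OF m \<rho>]
    by (auto simp: Theta_def block_cov_def)
qed

lemma l2norm_block_signal:
  assumes m: "0 < m" and k: "0 < k" and choice: "\<And>g. g < n \<Longrightarrow> c g < k" and size: "n * k * m \<le> d"
  shows "l2norm d (\<lambda>i. x * of_bool (i \<in> block_support m n k c)) = \<bar>x\<bar> * sqrt (real (n * m))"
proof -
  have "block_support m n k c \<subseteq> {..<d}"
    using block_support_subset[OF m k] size by fastforce
  then have "{..<d} \<inter> block_support m n k c = block_support m n k c" by blast
  moreover have "(\<Sum>i<d. (x * of_bool (i \<in> block_support m n k c))\<^sup>2)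
      = (\<Sum>i<d. if i \<in> block_support m n k c then x\<^sup>2 else 0)"
    by (intro sum.cong) auto
  ultimately have "(\<Sum>i<d. (x * of_bool (i \<in> block_support m n k c))\<^sup>2) = x\<^sup>2 * real (n * m)"
    using card_block_support[OF m k choice] by (simp add: sum.If_cases)
  then show ?thesis unfolding l2norm_def by (simp add: real_sqrt_mult)
qed

lemma worst_risk_ge_block:
  assumes m: "0 < m" and n: "0 < n" and k: "0 < k" and size: "n * k * m \<le> d" and s: "n * m \<le> s"
    and \<rho>: "real d * real m \<le> \<rho>\<^sup>2" "0 \<le> \<rho>" and T: "T \<in> estimators d"
  shows "ennreal (\<sigma>\<^sup>2 * (real (n * m) * ln (1 + real k / real n))) \<le> 8 * worst_risk s d \<rho> \<sigma> T"
proof -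
  define a where "a = sqrt (ln (1 + real k / real n))"
  define C where "C = {..<n} \<rightarrow>\<^sub>E {..<k}"
  define \<theta> w where "\<theta> c i = \<sigma> * a * of_bool (i \<in> block_support m n k c)"
    and "w c i = a / real m * of_bool (i \<in> block_support m n k c)" for c i
  have a_square: "a\<^sup>2 = ln (1 + real k / real n)" by (simp add: a_def)
  have block_cov_w: "dot d (block_cov d m i) (w c) = a * of_bool (i \<in> block_support m n k c)" if "i < d" for i c
    unfolding w_def using block_cov_dot_block_support[OF m k size that, of "a / real m" c] m by simp
  have overlap_eq: "(\<Sum>i<d. w c i * dot d (block_cov d m i) (w c')) = a\<^sup>2 * real (agreements n c c')" if "c \<in> C" for c c'
  proof -
    have "{..<d} \<inter> (block_support m n k c \<inter> block_support m n k c') = block_support m n k c \<inter> block_support m n k c'"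
      using block_support_subset[OF m k, of n c] size by fastforce
    moreover have "(\<Sum>i<d. w c i * dot d (block_cov d m i) (w c'))
        = (\<Sum>i<d. if i \<in> block_support m n k c \<inter> block_support m n k c' then a\<^sup>2 / real m else 0)"
      by (intro sum.cong refl, subst block_cov_w) (auto simp: w_def power2_eq_square)
    moreover have "card (block_support m n k c \<inter> block_support m n k c') = m * agreements n c c'"
      using that by (intro card_block_support_Int[OF m k]) (auto simp: C_def)
    ultimately show ?thesis using m by (simp add: sum.If_cases del: Int_iff)
  qed
  have choices: "finite C" "C \<noteq> {}"
    unfolding C_def using k by (auto intro!: finite_PiE simp: PiE_eq_empty_iff lessThan_empty_iff)
  have "ennreal ((\<bar>\<sigma> * a\<bar> * sqrt (real (n * m)))\<^sup>2) \<le> ennreal (2 * (1 + exp 1)) * worst_risk s d \<rho> \<sigma> T"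
  proof (rule gauss_mixture_lower_bound[OF choices is_cov_block_cov T exp_ge_zero])
    show "\<theta> c i = \<sigma> * dot d (block_cov d m i) (w c)" if "i < d" for c i
      using block_cov_w[OF that] by (simp add: \<theta>_def)
    show "l2norm d (\<theta> c) = \<bar>\<sigma> * a\<bar> * sqrt (real (n * m))" if "c \<in> C" for c
      unfolding \<theta>_def using that by (intro l2norm_block_signal[OF m k _ size]) (auto simp: C_def)
    show "(\<theta> c, block_cov d m) \<in> Theta s d \<rho>" if "c \<in> C" for c
      unfolding \<theta>_def using that by (intro block_signal_in_Theta[OF m k _ size s \<rho>]) (auto simp: C_def)
    show "(\<lambda>_. 0, block_cov d m) \<in> Theta s d \<rho>"
      using block_signal_in_Theta[OF m k _ size s \<rho>, of "\<lambda>_. 0" 0] k by simp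
    show "(\<Sum>c\<in>C. \<Sum>c'\<in>C. exp (\<Sum>i<d. w c i * dot d (block_cov d m i) (w c'))) \<le> exp 1 * (real (card C))\<^sup>2"
      using sum_exp_agreements_le[OF n k a_square] by (simp add: overlap_eq C_def)
  qed
  also have "\<dots> \<le> ennreal 8 * worst_risk s d \<rho> \<sigma> T"
    using exp_le by (intro mult_right_mono ennreal_leI) auto
  finally show ?thesis by (simp add: power_mult_distrib a_square mult_ac)
qed

subsection \<open>The minimax lower bound\<close>

lemma le_twice_div_mult:
  assumes "0 < m" "m \<le> (s :: nat)"
  shows "0 < s div m" "s \<le> 2 * (s div m * m)"
proof -
  show quotient_pos: "0 < s div m" using assms by (simp add: div_greater_zero_iff)
  have "m \<le> s div m * m" using quotient_pos by simp
  then show "s \<le> 2 * (s div m * m)" using dividend_less_div_times[OF assms(1), of s] by linarith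
qed

lemma ln_one_plus_le_four_ln:
  fixes x y :: real
  assumes "0 \<le> x" "0 \<le> y" "x \<le> 4 * y + 4 * y\<^sup>2"
  shows "ln (1 + x) \<le> 4 * ln (1 + y)"
proof -
  have "0 \<le> 2 * y\<^sup>2 + 4 * y ^ 3 + y ^ 4" using assms(2) by simp
  then have "1 + x \<le> 1 + 4 * y + 6 * y\<^sup>2 + 4 * y ^ 3 + y ^ 4" using assms(3) by linarith
  also have "\<dots> = (1 + y) ^ 4" by (simp add: numeral_eq_Suc algebra_simps)
  finally have "ln (1 + x) \<le> ln ((1 + y) ^ 4)" using assms by (subst ln_le_cancel_iff) auto
  also have "\<dots> = 4 * ln (1 + y)" using assms by (subst ln_realpow) auto
  finally show ?thesis .
qed

lemma block_size_exists:
  fixes s d :: nat and \<rho> :: real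
  assumes s: "0 < s" and d: "0 < d" and \<rho>: "real d \<le> \<rho>\<^sup>2"
  obtains m where "0 < m" "m \<le> s" "real d * real m \<le> \<rho>\<^sup>2" "m = s \<or> \<rho>\<^sup>2 \<le> 2 * real m * real d"
proof -
  define m where "m = nat \<lfloor>\<rho>\<^sup>2 / real d\<rfloor>"
  have "1 \<le> \<rho>\<^sup>2 / real d" using \<rho> d by simp
  then have m: "1 \<le> m" "real m \<le> \<rho>\<^sup>2 / real d" "\<rho>\<^sup>2 / real d < real m + 1"
    unfolding m_def by (auto intro: le_nat_floor)
  then have "\<rho>\<^sup>2 / real d \<le> 2 * real m" by linarith
  then have upper: "\<rho>\<^sup>2 \<le> 2 * real m * real d" using d by (simp add: field_simps)
  have "real d * real (min m s) \<le> real d * real m" by (intro mult_left_mono) auto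
  also have "\<dots> \<le> \<rho>\<^sup>2" using m(2) d by (simp add: field_simps)
  finally show ?thesis using that[of "min m s"] m(1) s upper by (auto simp: min_def)
qed

lemma block_sizes_exist:
  fixes s d :: nat and \<rho> :: real
  assumes s: "0 < s" "s \<le> d" and \<rho>: "0 \<le> \<rho>" "real d \<le> \<rho>\<^sup>2" "\<rho> \<le> real d"
  obtains m n k :: nat where "0 < m" "0 < n" "0 < k" "n * k * m \<le> d" "n * m \<le> s" "s \<le> 2 * (n * m)"
    "real d * real m \<le> \<rho>\<^sup>2"
    "\<rho>\<^sup>2 / (real s)\<^sup>2 \<le> 4 * (real k / real n) + 4 * (real k / real n)\<^sup>2"
proof -
  obtain m where m: "0 < m" "m \<le> s" "real d * real m \<le> \<rho>\<^sup>2" "m = s \<or> \<rho>\<^sup>2 \<le> 2 * real m * real d"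
    using block_size_exists[of s d \<rho>] s \<rho>(2) by auto
  define n where "n = s div m"
  define k where "k = d div (n * m)"
  have n: "0 < n" "n * m \<le> s" "s \<le> 2 * (n * m)" using le_twice_div_mult[OF m(1,2)] by (auto simp: n_def)
  have k: "0 < k" "d \<le> 2 * (k * (n * m))"
    using le_twice_div_mult[of "n * m" d] m(1) n s(2) by (auto simp: k_def)
  have size: "n * k * m \<le> d" using div_times_less_eq_dividend[of d "n * m"] by (simp add: k_def mult_ac)
  have "real d \<le> real (2 * (k * (n * m)))" using k(2) by (simp only: of_nat_le_iff)
  then have d_le: "real d \<le> 2 * real k * real (n * m)" by simp
  have "\<rho>\<^sup>2 / (real s)\<^sup>2 \<le> 4 * (real k / real n) + 4 * (real k / real n)\<^sup>2"
  proof (cases "m = s")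
    case True
    then have "n = 1" using s(1) by (simp add: n_def)
    have "\<rho> \<le> 2 * real k * real s" using \<rho>(3) d_le True \<open>n = 1\<close> by simp
    then have "\<rho>\<^sup>2 \<le> (2 * real k * real s)\<^sup>2" using \<rho>(1) by (rule power_mono)
    then have "\<rho>\<^sup>2 / (real s)\<^sup>2 \<le> 4 * (real k / real n)\<^sup>2"
      using s(1) \<open>n = 1\<close> by (simp add: divide_le_eq power_mult_distrib)
    then show ?thesis by (rule order_trans) simp
  next
    case False
    then have "\<rho>\<^sup>2 \<le> 2 * real m * real d" using m(4) by simp
    also have "\<dots> \<le> 2 * real m * (2 * real k * real (n * m))" using d_le by (rule mult_left_mono) simp
    also have "\<dots> = 4 * (real k / real n) * (real (n * m))\<^sup>2" using n(1) by (simp add: power2_eq_square)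
    also have "\<dots> \<le> 4 * (real k / real n) * (real s)\<^sup>2"
      using n(2) by (intro mult_left_mono power_mono) (auto simp flip: of_nat_mult)
    finally have "\<rho>\<^sup>2 / (real s)\<^sup>2 \<le> 4 * (real k / real n)" using s(1) by (simp add: divide_le_eq)
    then show ?thesis by (rule order_trans) simp
  qed
  then show ?thesis by (rule that[OF m(1) n(1) k(1) size n(2,3) m(3)])
qed

lemma worst_risk_ge_log:
  assumes s: "0 < s" "s \<le> d" and \<rho>: "sqrt (real d) \<le> \<rho>" "\<rho> \<le> real d" and T: "T \<in> estimators d"
  shows "ennreal (\<sigma>\<^sup>2 * (real s * ln (1 + \<rho>\<^sup>2 / (real s)\<^sup>2))) \<le> 64 * worst_risk s d \<rho> \<sigma> T"
proof -
  have \<rho>0: "0 \<le> \<rho>" using \<rho>(1) by (rule order_trans[rotated]) simp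
  have "real d \<le> \<rho>\<^sup>2" using \<rho>(1) by (rule sqrt_le_D)
  then obtain m n k :: nat where sizes: "0 < m" "0 < n" "0 < k" "n * k * m \<le> d" "n * m \<le> s" "real d * real m \<le> \<rho>\<^sup>2"
    and s_le: "s \<le> 2 * (n * m)" and ratio: "\<rho>\<^sup>2 / (real s)\<^sup>2 \<le> 4 * (real k / real n) + 4 * (real k / real n)\<^sup>2"
    using block_sizes_exist[OF s \<rho>0 _ \<rho>(2)] by metis
  have "real s * ln (1 + \<rho>\<^sup>2 / (real s)\<^sup>2) \<le> (2 * real (n * m)) * (4 * ln (1 + real k / real n))"
    using s_le ratio by (intro mult_mono ln_one_plus_le_four_ln) (auto simp flip: of_nat_mult)
  then have "\<sigma>\<^sup>2 * (real s * ln (1 + \<rho>\<^sup>2 / (real s)\<^sup>2)) \<le> \<sigma>\<^sup>2 * ((2 * real (n * m)) * (4 * ln (1 + real k / real n)))"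
    by (rule mult_left_mono) simp
  then have "ennreal (\<sigma>\<^sup>2 * (real s * ln (1 + \<rho>\<^sup>2 / (real s)\<^sup>2)))
      \<le> ennreal (8 * (\<sigma>\<^sup>2 * (real (n * m) * ln (1 + real k / real n))))"
    by (intro ennreal_leI) (simp add: mult_ac)
  also have "\<dots> = 8 * ennreal (\<sigma>\<^sup>2 * (real (n * m) * ln (1 + real k / real n)))"
    by (simp add: ennreal_mult')
  also have "\<dots> \<le> 8 * (8 * worst_risk s d \<rho> \<sigma> T)"
    by (intro mult_left_mono worst_risk_ge_block[OF sizes \<rho>0 T]) simp
  finally show ?thesis by (simp add: mult.assoc[symmetric])
qed

lemma worst_risk_mono: "s \<le> s' \<Longrightarrow> worst_risk s d \<rho> \<sigma> T \<le> worst_risk s' d \<rho> \<sigma> T"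
  by (intro SUP_subset_mono) (auto simp: Theta_def)

lemma phi_pos: "1 \<le> s \<Longrightarrow> 0 < \<rho> \<Longrightarrow> 0 < phi s (\<rho>\<^sup>2)"
  unfolding phi_def by (auto intro!: mult_pos_pos ln_gt_zero)

lemma ln2_le_ln_one_plus_ratio:
  assumes "1 \<le> s" "real s \<le> \<rho>"
  shows "ln 2 \<le> ln (1 + \<rho>\<^sup>2 / (real s)\<^sup>2)"
proof -
  have "(real s)\<^sup>2 \<le> \<rho>\<^sup>2" using assms by (intro power_mono) auto
  then have "1 \<le> \<rho>\<^sup>2 / (real s)\<^sup>2" using assms by simp
  then show ?thesis by simp
qed

lemma worst_risk_ge_of_rho_less:
  assumes s: "s \<le> d" "\<rho> < real s" and \<rho>: "1 \<le> \<rho>" "sqrt (real d) \<le> \<rho>" "\<rho> \<le> real d" and T: "T \<in> estimators d"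
  shows "ennreal (\<sigma>\<^sup>2 * \<rho>) \<le> 256 * worst_risk s d \<rho> \<sigma> T"
proof -
  define s' where "s' = nat \<lfloor>\<rho>\<rfloor>"
  have s': "1 \<le> s'" "real s' \<le> \<rho>" "\<rho> < real s' + 1"
    unfolding s'_def using \<rho>(1) by (auto intro: le_nat_floor)
  have "s' \<le> s" using s'(2) s(2) by linarith
  have "1 / 2 \<le> ln (1 + \<rho>\<^sup>2 / (real s')\<^sup>2)"
    using ln2_le_ln_one_plus_ratio[OF s'(1,2)] ln2_ge_two_thirds by linarith
  then have "(\<rho> / 2) * (1 / 2) \<le> real s' * ln (1 + \<rho>\<^sup>2 / (real s')\<^sup>2)"
    using s' by (intro mult_mono) auto
  then have "\<sigma>\<^sup>2 * \<rho> \<le> \<sigma>\<^sup>2 * (4 * (real s' * ln (1 + \<rho>\<^sup>2 / (real s')\<^sup>2)))"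
    by (intro mult_left_mono) auto
  then have "ennreal (\<sigma>\<^sup>2 * \<rho>) \<le> ennreal (4 * (\<sigma>\<^sup>2 * (real s' * ln (1 + \<rho>\<^sup>2 / (real s')\<^sup>2))))"
    by (intro ennreal_leI) (simp add: mult_ac)
  also have "\<dots> = 4 * ennreal (\<sigma>\<^sup>2 * (real s' * ln (1 + \<rho>\<^sup>2 / (real s')\<^sup>2)))"
    by (simp add: ennreal_mult')
  also have "\<dots> \<le> 4 * (64 * worst_risk s' d \<rho> \<sigma> T)"
    using s' \<open>s' \<le> s\<close> s by (intro mult_left_mono worst_risk_ge_log \<rho> T) auto
  also have "\<dots> \<le> 4 * (64 * worst_risk s d \<rho> \<sigma> T)"
    by (intro mult_left_mono worst_risk_mono \<open>s' \<le> s\<close>) auto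
  finally show ?thesis by (simp add: mult.assoc[symmetric])
qed

lemma worst_risk_ge_phi:
  assumes s: "1 \<le> s" "s \<le> d" and \<rho>: "sqrt (real d) \<le> \<rho>" "\<rho> \<le> real d" and T: "T \<in> estimators d"
  shows "ennreal (\<sigma>\<^sup>2 * phi s (\<rho>\<^sup>2) / 256) \<le> worst_risk s d \<rho> \<sigma> T"
proof -
  have "1 \<le> sqrt (real d)" using s by simp
  then have "1 \<le> \<rho>" using \<rho>(1) by linarith
  have "ennreal (\<sigma>\<^sup>2 * phi s (\<rho>\<^sup>2)) \<le> 256 * worst_risk s d \<rho> \<sigma> T"
  proof (cases "real s \<le> \<rho>")
    case True
    then have "ennreal (\<sigma>\<^sup>2 * phi s (\<rho>\<^sup>2)) \<le> 64 * worst_risk s d \<rho> \<sigma> T"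
      using worst_risk_ge_log[OF _ s(2) \<rho> T] s(1) \<open>1 \<le> \<rho>\<close> by (simp add: phi_def)
    also have "\<dots> \<le> 256 * worst_risk s d \<rho> \<sigma> T" by (intro mult_right_mono) auto
    finally show ?thesis .
  next
    case False
    then show ?thesis
      using worst_risk_ge_of_rho_less[OF s(2) _ \<open>1 \<le> \<rho>\<close> \<rho> T] \<open>1 \<le> \<rho>\<close> by (simp add: phi_def)
  qed
  then have "ennreal (\<sigma>\<^sup>2 * phi s (\<rho>\<^sup>2)) / 256 \<le> worst_risk s d \<rho> \<sigma> T"
    by (intro divide_le_posI_ennreal) (simp_all add: mult.commute)
  moreover have "0 < phi s (\<rho>\<^sup>2)" using s \<open>1 \<le> \<rho>\<close> by (intro phi_pos) auto
  ultimately show ?thesis by (simp add: ennreal_divide_numeral)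
qed

subsection \<open>Moments of the standard Gaussian\<close>

lemma integral_std_gauss:
  fixes f :: "real \<Rightarrow> real"
  assumes "f \<in> borel_measurable borel"
  shows "(\<integral>x. f x \<partial>std_gauss) = (\<integral>x. std_normal_density x * f x \<partial>lborel)"
  unfolding std_gauss_def using assms by (subst integral_density) auto

lemma integrable_std_gauss:
  fixes f :: "real \<Rightarrow> real"
  assumes "f \<in> borel_measurable borel"
  shows "integrable std_gauss f \<longleftrightarrow> integrable lborel (\<lambda>x. std_normal_density x * f x)"
  unfolding std_gauss_def using assms by (subst integrable_density) auto

lemma integrable_std_gauss_power [simp, intro]: "integrable std_gauss (\<lambda>x. x ^ k)"
  using integrable_std_normal_moment by (simp add: integrable_std_gauss)

lemma integrable_std_gauss_id [simp, intro]: "integrable std_gauss (\<lambda>x. x)"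
  using integrable_std_gauss_power[of 1] unfolding power_one_right .

lemma integral_std_gauss_id [simp]: "(\<integral>x. x \<partial>std_gauss) = 0"
  using integral_std_normal_moment_odd[of 0] by (simp add: integral_std_gauss)

lemma integral_std_gauss_power2 [simp]: "(\<integral>x. x\<^sup>2 \<partial>std_gauss) = 1"
  using integral_std_normal_moment_even[of 1] by (simp add: integral_std_gauss fact_numeral)

lemma std_gauss_exp_square:
  fixes a :: real
  assumes a: "a < 1 / 2"
  shows "integrable std_gauss (\<lambda>x. exp (a * x\<^sup>2))" "(\<integral>x. exp (a * x\<^sup>2) \<partial>std_gauss) = 1 / sqrt (1 - 2 * a)"
proof -
  define s where "s = 1 / sqrt (1 - 2 * a)"
  have s: "0 < s" "s\<^sup>2 = 1 / (1 - 2 * a)" using a by (simp_all add: s_def power_divide)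
  have density: "std_normal_density x * exp (a * x\<^sup>2) = s * normal_density 0 s x" for x
  proof -
    have "- x\<^sup>2 / (2 * s\<^sup>2) = - x\<^sup>2 / 2 + a * x\<^sup>2" using a unfolding s(2) by (simp add: field_simps)
    then show ?thesis using s(1) by (simp add: normal_density_def real_sqrt_mult exp_add[symmetric])
  qed
  show "integrable std_gauss (\<lambda>x. exp (a * x\<^sup>2))"
    using s(1) by (subst integrable_std_gauss) (simp_all add: density)
  show "(\<integral>x. exp (a * x\<^sup>2) \<partial>std_gauss) = 1 / sqrt (1 - 2 * a)"
    using s(1) by (subst integral_std_gauss) (simp_all add: density flip: s_def)
qed

lemma integral_std_gauss_reflect:
  fixes f :: "real \<Rightarrow> real"
  assumes [measurable]: "f \<in> borel_measurable borel"
  shows "(\<integral>x. f (- x) \<partial>std_gauss) = (\<integral>x. f x \<partial>std_gauss)"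
proof -
  have "(\<integral>x. std_normal_density x * f x \<partial>lborel) = (\<integral>x. std_normal_density (- x) * f (- x) \<partial>lborel)"
    using lborel_integral_real_affine[of "-1" "\<lambda>x. std_normal_density x * f x" 0] by simp
  then show ?thesis by (simp add: integral_std_gauss std_normal_density_def)
qed

lemma binormal_mult_square_integrable:
  fixes f h :: "real \<Rightarrow> real"
  assumes r: "\<bar>r\<bar> \<le> 1" and [measurable]: "f \<in> borel_measurable borel" "h \<in> borel_measurable borel"
    and f: "integrable std_gauss (\<lambda>y. (f y)\<^sup>2)" and h: "integrable std_gauss (\<lambda>y. (h y)\<^sup>2)"
  shows "integrable (binormal r) (\<lambda>p. f (fst p) * h (snd p))" (is ?integrable)
    and "\<bar>\<integral>p. f (fst p) * h (snd p) \<partial>binormal r\<bar> \<le> ((\<integral>y. (f y)\<^sup>2 \<partial>std_gauss) + (\<integral>y. (h y)\<^sup>2 \<partial>std_gauss)) / 2"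
proof -
  have f_fst: "integrable (binormal r) (\<lambda>p. (f (fst p))\<^sup>2)" "(\<integral>p. (f (fst p))\<^sup>2 \<partial>binormal r) = (\<integral>y. (f y)\<^sup>2 \<partial>std_gauss)"
    using f integrable_distr_eq[of fst "binormal r" borel "\<lambda>y. (f y)\<^sup>2"]
      integral_distr[of fst "binormal r" borel "\<lambda>y. (f y)\<^sup>2"]
    by (simp_all add: distr_binormal_fst)
  have h_snd: "integrable (binormal r) (\<lambda>p. (h (snd p))\<^sup>2)" "(\<integral>p. (h (snd p))\<^sup>2 \<partial>binormal r) = (\<integral>y. (h y)\<^sup>2 \<partial>std_gauss)"
    using h integrable_distr_eq[of snd "binormal r" borel "\<lambda>y. (h y)\<^sup>2"]
      integral_distr[of snd "binormal r" borel "\<lambda>y. (h y)\<^sup>2"]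
    by (simp_all add: distr_binormal_snd[OF r])
  have product_le: "\<bar>f (fst p) * h (snd p)\<bar> \<le> ((f (fst p))\<^sup>2 + (h (snd p))\<^sup>2) / 2" for p
    using sum_squares_bound[of "\<bar>f (fst p)\<bar>" "\<bar>h (snd p)\<bar>"] by (simp add: abs_mult)
  have dominating: "integrable (binormal r) (\<lambda>p. ((f (fst p))\<^sup>2 + (h (snd p))\<^sup>2) / 2)"
    using f_fst h_snd by simp
  show integrable_product: ?integrable
  proof (rule Bochner_Integration.integrable_bound[OF dominating])
    show "AE p in binormal r. norm (f (fst p) * h (snd p)) \<le> norm (((f (fst p))\<^sup>2 + (h (snd p))\<^sup>2) / 2)"
      using product_le by (intro AE_I2) (simp add: order_trans[OF product_le abs_ge_self])
  qed measurable
  have "\<bar>\<integral>p. f (fst p) * h (snd p) \<partial>binormal r\<bar> \<le> (\<integral>p. \<bar>f (fst p) * h (snd p)\<bar> \<partial>binormal r)"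
    by (rule integral_abs_bound)
  also have "\<dots> \<le> (\<integral>p. ((f (fst p))\<^sup>2 + (h (snd p))\<^sup>2) / 2 \<partial>binormal r)"
    using integrable_product by (intro integral_mono product_le dominating integrable_abs)
  finally show "\<bar>\<integral>p. f (fst p) * h (snd p) \<partial>binormal r\<bar> \<le> ((\<integral>y. (f y)\<^sup>2 \<partial>std_gauss) + (\<integral>y. (h y)\<^sup>2 \<partial>std_gauss)) / 2"
    using f_fst h_snd by simp
qed

lemma binormal_covariance:
  assumes r: "\<bar>r\<bar> \<le> 1"
  shows "integrable (binormal r) (\<lambda>p. fst p * snd p)" "(\<integral>p. fst p * snd p \<partial>binormal r) = r"
proof -
  show integrable_product: "integrable (binormal r) (\<lambda>p. fst p * snd p)"
    using binormal_mult_square_integrable(1)[OF r, of "\<lambda>y. y" "\<lambda>y. y"] by simp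
  have "(\<integral>v. u * (r * u + sqrt (1 - r\<^sup>2) * v) \<partial>std_gauss) = r * u\<^sup>2" for u
    by (simp add: power2_eq_square)
  then show "(\<integral>p. fst p * snd p \<partial>binormal r) = r"
    by (simp only: integral_binormal[OF integrable_product] fst_conv snd_conv) simp
qed

subsection \<open>Covariance of even functions of correlated Gaussians\<close>

text \<open>The density of the standard bivariate normal law relative to the product of its marginals.\<close>
definition mehler :: "real \<Rightarrow> real \<Rightarrow> real \<Rightarrow> real" where
  "mehler r u y = exp (- (r\<^sup>2 * u\<^sup>2 - 2 * r * u * y + r\<^sup>2 * y\<^sup>2) / (2 * (1 - r\<^sup>2))) / sqrt (1 - r\<^sup>2)"

lemma borel_measurable_mehler [measurable]: "mehler r u \<in> borel_measurable borel"
  unfolding mehler_def by measurable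

lemma mehler_nonneg: "\<bar>r\<bar> \<le> 1 \<Longrightarrow> 0 \<le> mehler r u y"
  by (simp add: mehler_def abs_square_le_1)

lemma std_normal_density_mehler:
  assumes r: "\<bar>r\<bar> < 1"
  shows "std_normal_density y * mehler r u y = std_normal_density ((y - r * u) / sqrt (1 - r\<^sup>2)) / sqrt (1 - r\<^sup>2)"
proof -
  have r2: "r\<^sup>2 < 1" using r by (simp add: abs_square_less_1)
  have "- y\<^sup>2 / 2 + - (r\<^sup>2 * u\<^sup>2 - 2 * r * u * y + r\<^sup>2 * y\<^sup>2) / (2 * (1 - r\<^sup>2))
      = (- y\<^sup>2 * (1 - r\<^sup>2) - (r\<^sup>2 * u\<^sup>2 - 2 * r * u * y + r\<^sup>2 * y\<^sup>2)) / (2 * (1 - r\<^sup>2))"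
    using r2 by (simp add: field_simps)
  also have "- y\<^sup>2 * (1 - r\<^sup>2) - (r\<^sup>2 * u\<^sup>2 - 2 * r * u * y + r\<^sup>2 * y\<^sup>2) = - (y - r * u)\<^sup>2"
    by (simp add: power2_eq_square algebra_simps)
  also have "- (y - r * u)\<^sup>2 / (2 * (1 - r\<^sup>2)) = - ((y - r * u) / sqrt (1 - r\<^sup>2))\<^sup>2 / 2"
    using r2 by (simp add: power_divide)
  finally have "exp (- ((y - r * u) / sqrt (1 - r\<^sup>2))\<^sup>2 / 2)
      = exp (- y\<^sup>2 / 2) * exp (- (r\<^sup>2 * u\<^sup>2 - 2 * r * u * y + r\<^sup>2 * y\<^sup>2) / (2 * (1 - r\<^sup>2)))"
    by (metis exp_add)
  then show ?thesis unfolding mehler_def std_normal_density_def by simp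
qed

lemma integral_std_gauss_mehler:
  fixes g :: "real \<Rightarrow> real"
  assumes [measurable]: "g \<in> borel_measurable borel" and r: "\<bar>r\<bar> < 1"
  shows "(\<integral>v. g (r * u + sqrt (1 - r\<^sup>2) * v) \<partial>std_gauss) = (\<integral>y. g y * mehler r u y \<partial>std_gauss)"
proof -
  define q where "q = sqrt (1 - r\<^sup>2)"
  have q: "0 < q" using r by (simp add: q_def abs_square_less_1)
  have "(\<integral>y. g y * mehler r u y \<partial>std_gauss) = (\<integral>y. std_normal_density ((y - r * u) / q) / q * g y \<partial>lborel)"
    by (subst integral_std_gauss) (simp_all add: q_def mult_ac flip: std_normal_density_mehler[OF r])
  also have "\<dots> = q * (\<integral>v. std_normal_density v / q * g (r * u + q * v) \<partial>lborel)"
    by (subst lborel_integral_real_affine[of q _ "r * u"]) (use q in simp_all)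
  also have "\<dots> = (\<integral>v. std_normal_density v * g (r * u + q * v) \<partial>lborel)"
    using q by simp
  also have "\<dots> = (\<integral>v. g (r * u + q * v) \<partial>std_gauss)"
    by (rule integral_std_gauss[symmetric]) simp
  finally show ?thesis by (simp add: q_def)
qed

lemma mehler_symmetrization:
  assumes "\<bar>r\<bar> < 1"
  shows "(mehler r u y + mehler r u (- y)) / 2
    = exp (- (r\<^sup>2 * (u\<^sup>2 + y\<^sup>2) / (2 * (1 - r\<^sup>2)))) * cosh (r * u * y / (1 - r\<^sup>2)) / sqrt (1 - r\<^sup>2)"
proof -
  define p w t where "p = 1 - r\<^sup>2" and "w = r\<^sup>2 * (u\<^sup>2 + y\<^sup>2) / (2 * p)" and "t = r * u * y / p"
  have "p \<noteq> 0" using assms by (simp add: p_def abs_square_eq_1)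
  then have "- (r\<^sup>2 * u\<^sup>2 - 2 * r * u * y + r\<^sup>2 * y\<^sup>2) / (2 * p) = - w + t"
    and "- (r\<^sup>2 * u\<^sup>2 - 2 * r * u * - y + r\<^sup>2 * (- y)\<^sup>2) / (2 * p) = - w + - t"
    unfolding w_def t_def by (simp_all add: field_simps)
  then have "mehler r u y = exp (- w) * exp t / sqrt p" "mehler r u (- y) = exp (- w) * exp (- t) / sqrt p"
    unfolding mehler_def p_def[symmetric] by (simp_all only: exp_add)
  then show ?thesis
    unfolding p_def[symmetric] w_def[symmetric] t_def[symmetric]
    by (simp add: cosh_field_def distrib_left add_divide_distrib)
qed

lemma cosh_minus_one_le: "cosh t - 1 \<le> t\<^sup>2 / 2 * exp \<bar>t :: real\<bar>"
proof -
  have "cosh t - 1 = (1 - exp (- \<bar>t\<bar>))\<^sup>2 / 2 * exp \<bar>t\<bar>"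
    by (subst cosh_real_abs[symmetric]) (simp add: cosh_field_def power2_diff field_simps exp_minus power2_eq_square)
  also have "\<dots> \<le> \<bar>t\<bar>\<^sup>2 / 2 * exp \<bar>t\<bar>"
    using exp_ge_add_one_self[of "- \<bar>t\<bar>"] by (intro mult_right_mono divide_right_mono power_mono) auto
  finally show ?thesis by simp
qed

lemma abs_scaled_exp_cosh_minus_one_le:
  fixes A w t :: real
  assumes A: "1 \<le> A" and w: "0 \<le> w"
  shows "\<bar>A * (exp (- w) * cosh t) - 1\<bar> \<le> (A - 1) * cosh t + (cosh t - 1) + w"
proof (rule abs_leI)
  have "A * (exp (- w) * cosh t) \<le> A * (1 * cosh t)"
    using A w by (intro mult_left_mono mult_right_mono) auto
  then show "A * (exp (- w) * cosh t) - 1 \<le> (A - 1) * cosh t + (cosh t - 1) + w"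
    using w by (simp add: algebra_simps)
  have "1 * (exp (- w) * 1) \<le> A * (exp (- w) * cosh t)"
    using A by (intro mult_mono cosh_real_ge_1) auto
  moreover have "0 \<le> (A - 1) * cosh t" "0 \<le> cosh t - 1" using A by (simp_all add: cosh_real_ge_1)
  ultimately show "- (A * (exp (- w) * cosh t) - 1) \<le> (A - 1) * cosh t + (cosh t - 1) + w"
    using exp_ge_add_one_self[of "- w"] by linarith
qed

lemma inverse_sqrt_one_minus_bounds:
  fixes x :: real
  assumes x: "0 \<le> x" "x \<le> 1 / 2"
  shows "1 \<le> 1 / sqrt (1 - x)" "1 / sqrt (1 - x) - 1 \<le> 2 * x"
proof -
  have sqrt_bounds: "1 - x \<le> sqrt (1 - x)" "sqrt (1 - x) \<le> 1" "0 < sqrt (1 - x)"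
    using x by (auto intro!: real_le_rsqrt simp: power2_eq_square mult_left_le_one_le)
  then show "1 \<le> 1 / sqrt (1 - x)" by simp
  have "1 / sqrt (1 - x) \<le> 1 / (1 - x)" using sqrt_bounds x by (intro divide_left_mono) auto
  also have "\<dots> = 1 + x * (1 / (1 - x))" using x by (simp add: field_simps)
  also have "\<dots> \<le> 1 + x * 2" using x by (intro add_left_mono mult_left_mono) (auto simp: divide_le_eq)
  finally show "1 / sqrt (1 - x) - 1 \<le> 2 * x" by simp
qed

lemma mehler_exponent_bounds:
  fixes r u y :: real
  assumes r: "\<bar>r\<bar> \<le> 1 / 4"
  shows "r\<^sup>2 * (u\<^sup>2 + y\<^sup>2) / (2 * (1 - r\<^sup>2)) \<le> r\<^sup>2 * (u\<^sup>2 + y\<^sup>2)"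
    and "\<bar>r * u * y / (1 - r\<^sup>2)\<bar> \<le> \<bar>r\<bar> * (u\<^sup>2 + y\<^sup>2) * (8 / 15)"
proof -
  have "r\<^sup>2 \<le> (1 / 4)\<^sup>2" using r by (subst abs_le_square_iff[symmetric]) simp
  then have r2: "r\<^sup>2 \<le> 1 / 16" by (simp add: power2_eq_square)
  then have "r\<^sup>2 * (u\<^sup>2 + y\<^sup>2) / (2 * (1 - r\<^sup>2)) \<le> r\<^sup>2 * (u\<^sup>2 + y\<^sup>2) / 1"
    by (intro divide_left_mono) auto
  then show "r\<^sup>2 * (u\<^sup>2 + y\<^sup>2) / (2 * (1 - r\<^sup>2)) \<le> r\<^sup>2 * (u\<^sup>2 + y\<^sup>2)" by simp
  have uy: "\<bar>u * y\<bar> \<le> (u\<^sup>2 + y\<^sup>2) / 2"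
    using sum_squares_bound[of "\<bar>u\<bar>" "\<bar>y\<bar>"] by (simp add: abs_mult)
  have "\<bar>r * u * y / (1 - r\<^sup>2)\<bar> = \<bar>r\<bar> * \<bar>u * y\<bar> * (1 / (1 - r\<^sup>2))"
    using r2 by (simp add: abs_mult)
  also have "\<dots> \<le> \<bar>r\<bar> * ((u\<^sup>2 + y\<^sup>2) / 2) * (16 / 15)"
    using r2 uy by (intro mult_mono mult_left_mono) (auto simp: divide_le_eq)
  also have "\<dots> = \<bar>r\<bar> * (u\<^sup>2 + y\<^sup>2) * (8 / 15)" by simp
  finally show "\<bar>r * u * y / (1 - r\<^sup>2)\<bar> \<le> \<bar>r\<bar> * (u\<^sup>2 + y\<^sup>2) * (8 / 15)" .
qed

lemma exp_mult_quadratic_le: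
  fixes N :: real
  assumes N: "0 \<le> N"
  shows "exp (2 * N / 15) * (2 + N + N\<^sup>2 / 4) \<le> 40 * exp (N / 4)"
proof -
  have "2 + N + N\<^sup>2 / 4 \<le> 40 * (1 + 7 * N / 60 + (7 * N / 60)\<^sup>2 / 2)"
    using N by (simp add: power2_eq_square field_simps)
  also have "\<dots> \<le> 40 * exp (7 * N / 60)"
    using N by (intro mult_left_mono exp_lower_Taylor_quadratic) simp_all
  finally have "exp (2 * N / 15) * (2 + N + N\<^sup>2 / 4) \<le> exp (2 * N / 15) * (40 * exp (7 * N / 60))"
    by (rule mult_left_mono) simp
  also have "\<dots> = 40 * exp (N / 4)" by (simp add: exp_add[symmetric] field_simps)
  finally show ?thesis .
qed

lemma abs_mehler_symmetrization_minus_one_le: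
  assumes r: "\<bar>r\<bar> \<le> 1 / 4"
  shows "\<bar>(mehler r u y + mehler r u (- y)) / 2 - 1\<bar> \<le> 40 * r\<^sup>2 * exp ((u\<^sup>2 + y\<^sup>2) / 4)"
proof -
  define N A w t E where "N = u\<^sup>2 + y\<^sup>2" and "A = 1 / sqrt (1 - r\<^sup>2)" and "w = r\<^sup>2 * N / (2 * (1 - r\<^sup>2))"
    and "t = r * u * y / (1 - r\<^sup>2)" and "E = exp (2 * N / 15)"
  have N: "0 \<le> N" and E: "1 \<le> E" by (simp_all add: N_def E_def)
  have r2: "r\<^sup>2 \<le> 1 / 2" "r\<^sup>2 < 1"
    using r power_mono[of "\<bar>r\<bar>" "1 / 4" 2] by (simp_all add: power2_eq_square)
  have A: "1 \<le> A" "A - 1 \<le> 2 * r\<^sup>2"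
    unfolding A_def using r2 by (auto intro: inverse_sqrt_one_minus_bounds)
  have w: "0 \<le> w" "w \<le> r\<^sup>2 * N"
    using N r2 mehler_exponent_bounds(1)[OF r, of u y] by (simp_all add: w_def N_def)
  have t: "\<bar>t\<bar> \<le> \<bar>r\<bar> * N * (8 / 15)"
    unfolding t_def N_def by (rule mehler_exponent_bounds(2)[OF r])
  have "\<bar>r\<bar> * N * (8 / 15) \<le> (1 / 4) * N * (8 / 15)" using r N by (intro mult_right_mono) auto
  then have "\<bar>t\<bar> \<le> 2 * N / 15" using t by linarith
  then have exp_t: "exp \<bar>t\<bar> \<le> E" by (simp add: E_def)
  have "exp t + exp (- t) \<le> exp \<bar>t\<bar> + exp \<bar>t\<bar>" by (intro add_mono) simp_all
  then have "cosh t \<le> exp \<bar>t\<bar>" by (simp add: cosh_field_def)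
  then have "cosh t \<le> E" using exp_t by (rule order_trans)
  then have scale: "(A - 1) * cosh t \<le> 2 * r\<^sup>2 * E" using A by (intro mult_mono) auto
  have "\<bar>t\<bar>\<^sup>2 \<le> (\<bar>r\<bar> * N * (8 / 15))\<^sup>2" using t by (intro power_mono) auto
  also have "\<dots> \<le> r\<^sup>2 * (N\<^sup>2 / 2)" by (simp add: power_mult_distrib power_divide mult_left_mono)
  finally have "t\<^sup>2 / 2 * exp \<bar>t\<bar> \<le> r\<^sup>2 * (N\<^sup>2 / 4) * E" using exp_t by (intro mult_mono) auto
  then have cosh_t: "cosh t - 1 \<le> r\<^sup>2 * (N\<^sup>2 / 4) * E" using cosh_minus_one_le[of t] by linarith
  have "r\<^sup>2 * N * 1 \<le> r\<^sup>2 * N * E" using N E by (intro mult_left_mono) auto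
  then have "\<bar>A * (exp (- w) * cosh t) - 1\<bar> \<le> 2 * r\<^sup>2 * E + r\<^sup>2 * (N\<^sup>2 / 4) * E + r\<^sup>2 * N * E"
    using abs_scaled_exp_cosh_minus_one_le[OF A(1) w(1), of t] scale cosh_t w(2) by linarith
  also have "\<dots> = r\<^sup>2 * (E * (2 + N + N\<^sup>2 / 4))" by (simp add: algebra_simps)
  also have "\<dots> \<le> r\<^sup>2 * (40 * exp (N / 4))"
    unfolding E_def by (intro mult_left_mono exp_mult_quadratic_le N) simp
  finally have "\<bar>A * (exp (- w) * cosh t) - 1\<bar> \<le> 40 * r\<^sup>2 * exp (N / 4)" by simp
  moreover have "(mehler r u y + mehler r u (- y)) / 2 = A * (exp (- w) * cosh t)"
    using r by (subst mehler_symmetrization) (simp_all add: A_def w_def t_def N_def)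
  ultimately show ?thesis by (simp only: N_def)
qed

text \<open>The exponent leaves room for the factor \<open>exp (y\<^sup>2 / 4)\<close> of the kernel bound: \<open>3 / 20 + 1 / 4 < 1 / 2\<close>.\<close>
locale even_centered_function =
  fixes g :: "real \<Rightarrow> real" and K :: real
  assumes measurable_g [measurable]: "g \<in> borel_measurable borel"
    and even: "\<And>y. g (- y) = g y"
    and growth: "\<And>y. \<bar>g y\<bar> \<le> K * exp (3 * y\<^sup>2 / 20)"
    and mean: "(\<integral>y. g y \<partial>std_gauss) = 0"
begin

lemma K_nonneg: "0 \<le> K"
  using growth[of 0] by (simp add: order_trans[OF abs_ge_zero])

lemma integrable_exp_bound: "integrable std_gauss (\<lambda>y. c * exp (2 / 5 * y\<^sup>2))"
  by (intro integrable_mult_right std_gauss_exp_square) simp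

lemma integral_exp_bound: "(\<integral>y. c * exp (2 / 5 * y\<^sup>2) \<partial>std_gauss) = c * sqrt 5"
proof -
  have "1 / sqrt (1 - 2 * (2 / 5)) = sqrt (5 :: real)" by (simp add: real_sqrt_divide)
  then show ?thesis using std_gauss_exp_square(2)[of "2 / 5"] by simp
qed

lemma weighted_le: "\<bar>g y\<bar> * exp (y\<^sup>2 / 4) \<le> K * exp (2 / 5 * y\<^sup>2)"
proof -
  have "\<bar>g y\<bar> * exp (y\<^sup>2 / 4) \<le> K * exp (3 * y\<^sup>2 / 20) * exp (y\<^sup>2 / 4)"
    by (intro mult_right_mono growth) simp
  also have "\<dots> = K * exp (2 / 5 * y\<^sup>2)"
    by (simp add: mult.assoc exp_add[symmetric] field_simps)
  finally show ?thesis .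
qed

lemma square_le: "(g y)\<^sup>2 \<le> K\<^sup>2 * exp (2 / 5 * y\<^sup>2)"
proof -
  have "(g y)\<^sup>2 \<le> (K * exp (3 * y\<^sup>2 / 20))\<^sup>2"
    using growth[of y] by (subst abs_le_square_iff[symmetric]) simp
  also have "\<dots> = K\<^sup>2 * exp (3 / 10 * y\<^sup>2)"
    by (simp add: power_mult_distrib flip: exp_double)
  also have "\<dots> \<le> K\<^sup>2 * exp (2 / 5 * y\<^sup>2)" by (intro mult_left_mono) simp_all
  finally show ?thesis .
qed

lemma integrable_weighted: "integrable std_gauss (\<lambda>y. \<bar>g y\<bar> * exp (y\<^sup>2 / 4))"
  by (rule Bochner_Integration.integrable_bound[OF integrable_exp_bound[of K]])
    (use weighted_le in \<open>auto intro!: AE_I2 intro: order_trans[OF _ abs_ge_self]\<close>)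

lemma integral_weighted_le: "(\<integral>y. \<bar>g y\<bar> * exp (y\<^sup>2 / 4) \<partial>std_gauss) \<le> K * sqrt 5"
  using integral_mono[OF integrable_weighted integrable_exp_bound weighted_le] by (simp only: integral_exp_bound)

lemma integrable_square: "integrable std_gauss (\<lambda>y. (g y)\<^sup>2)"
  by (rule Bochner_Integration.integrable_bound[OF integrable_exp_bound[of "K\<^sup>2"]])
    (use square_le in \<open>auto intro!: AE_I2\<close>)

lemma integral_square_le: "(\<integral>y. (g y)\<^sup>2 \<partial>std_gauss) \<le> K\<^sup>2 * sqrt 5"
  using integral_mono[OF integrable_square integrable_exp_bound square_le] by (simp only: integral_exp_bound)

lemma integrable_g: "integrable std_gauss g"
  using integrable_square by (rule std_gauss.square_integrable_imp_integrable[rotated]) simp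

lemma abs_mult_mehler_symmetrization_le:
  assumes r: "\<bar>r\<bar> \<le> 1 / 4"
  shows "\<bar>g y * ((mehler r u y + mehler r u (- y)) / 2 - 1)\<bar> \<le> 40 * r\<^sup>2 * exp (u\<^sup>2 / 4) * (\<bar>g y\<bar> * exp (y\<^sup>2 / 4))"
proof -
  have "\<bar>g y * ((mehler r u y + mehler r u (- y)) / 2 - 1)\<bar> \<le> \<bar>g y\<bar> * (40 * r\<^sup>2 * exp ((u\<^sup>2 + y\<^sup>2) / 4))"
    unfolding abs_mult by (intro mult_left_mono abs_mehler_symmetrization_minus_one_le r) simp
  also have "exp ((u\<^sup>2 + y\<^sup>2) / 4) = exp (u\<^sup>2 / 4) * exp (y\<^sup>2 / 4)" by (simp add: exp_add[symmetric] add_divide_distrib)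
  finally show ?thesis by (simp add: mult_ac)
qed

text \<open>Evenness removes the term linear in \<open>r\<close> from the kernel and centring removes the constant term.\<close>
lemma integral_mult_mehler:
  assumes r: "\<bar>r\<bar> \<le> 1" and remainder: "integrable std_gauss (\<lambda>y. g y * ((mehler r u y + mehler r u (- y)) / 2 - 1))"
  shows "(\<integral>y. g y * mehler r u y \<partial>std_gauss) = (\<integral>y. g y * ((mehler r u y + mehler r u (- y)) / 2 - 1) \<partial>std_gauss)"
proof -
  define D f where "D y = g y * ((mehler r u y + mehler r u (- y)) / 2 - 1)" and "f y = g y * mehler r u y" for y
  have [measurable]: "f \<in> borel_measurable borel" unfolding f_def by measurable
  have integrable_D: "integrable std_gauss D" using remainder by (simp only: D_def[abs_def])
  have reflected: "f (- y) = 2 * (D y + g y) - f y" for y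
    by (simp add: f_def D_def even field_simps)
  have "\<bar>f y\<bar> \<le> 2 * (\<bar>D y\<bar> + \<bar>g y\<bar>)" for y
  proof -
    have "\<bar>g y\<bar> * \<bar>mehler r u y\<bar> \<le> \<bar>g y\<bar> * \<bar>mehler r u y + mehler r u (- y)\<bar>"
      using mehler_nonneg[OF r] by (intro mult_left_mono) auto
    then have "\<bar>f y\<bar> \<le> \<bar>f y + f (- y)\<bar>"
      by (simp only: f_def even distrib_left[symmetric] abs_mult)
    also have "\<dots> \<le> 2 * (\<bar>D y\<bar> + \<bar>g y\<bar>)" unfolding reflected by simp
    finally show ?thesis .
  qed
  moreover have dominating: "integrable std_gauss (\<lambda>y. 2 * (\<bar>D y\<bar> + \<bar>g y\<bar>))"
    using integrable_D integrable_g by simp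
  ultimately have "integrable std_gauss f"
    by (intro Bochner_Integration.integrable_bound[OF dominating]) simp_all
  then have "(\<integral>y. f (- y) \<partial>std_gauss) = 2 * (\<integral>y. D y \<partial>std_gauss) - (\<integral>y. f y \<partial>std_gauss)"
    unfolding reflected using integrable_D integrable_g by (simp add: mean)
  then have "(\<integral>y. f y \<partial>std_gauss) = (\<integral>y. D y \<partial>std_gauss)"
    by (simp add: integral_std_gauss_reflect)
  then show ?thesis by (simp only: f_def D_def)
qed

lemma abs_conditional_mean_le:
  assumes r: "\<bar>r\<bar> \<le> 1 / 4"
  shows "\<bar>\<integral>v. g (r * u + sqrt (1 - r\<^sup>2) * v) \<partial>std_gauss\<bar> \<le> 40 * r\<^sup>2 * exp (u\<^sup>2 / 4) * (K * sqrt 5)"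
proof -
  define D where "D y = g y * ((mehler r u y + mehler r u (- y)) / 2 - 1)" for y
  have [measurable]: "D \<in> borel_measurable borel" unfolding D_def mehler_def by measurable
  have D_le: "\<bar>D y\<bar> \<le> 40 * r\<^sup>2 * exp (u\<^sup>2 / 4) * (\<bar>g y\<bar> * exp (y\<^sup>2 / 4))" for y
    unfolding D_def by (rule abs_mult_mehler_symmetrization_le[OF r])
  have integrable_D: "integrable std_gauss D"
    by (rule Bochner_Integration.integrable_bound
        [OF integrable_mult_right[OF integrable_weighted, of "40 * r\<^sup>2 * exp (u\<^sup>2 / 4)"]])
      (use D_le in \<open>auto intro!: AE_I2 simp: abs_mult\<close>)
  then have "(\<integral>v. g (r * u + sqrt (1 - r\<^sup>2) * v) \<partial>std_gauss) = (\<integral>y. D y \<partial>std_gauss)"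
    unfolding D_def using r by (subst integral_mult_mehler[symmetric]) (auto intro!: integral_std_gauss_mehler)
  then have "\<bar>\<integral>v. g (r * u + sqrt (1 - r\<^sup>2) * v) \<partial>std_gauss\<bar> \<le> (\<integral>y. \<bar>D y\<bar> \<partial>std_gauss)"
    using integral_abs_bound[of std_gauss D] by simp
  also have "\<dots> \<le> (\<integral>y. 40 * r\<^sup>2 * exp (u\<^sup>2 / 4) * (\<bar>g y\<bar> * exp (y\<^sup>2 / 4)) \<partial>std_gauss)"
    using integrable_D by (intro integral_mono D_le integrable_abs integrable_mult_right integrable_weighted)
  also have "\<dots> \<le> 40 * r\<^sup>2 * exp (u\<^sup>2 / 4) * (K * sqrt 5)"
    unfolding integral_mult_right_zero by (intro mult_left_mono integral_weighted_le) simp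
  finally show ?thesis .
qed

lemma integrable_binormal_mult:
  "\<bar>r\<bar> \<le> 1 \<Longrightarrow> integrable (binormal r) (\<lambda>p. g (fst p) * g (snd p))"
  by (intro binormal_mult_square_integrable integrable_square) auto

lemma abs_covariance_le_of_small_correlation:
  assumes r: "\<bar>r\<bar> \<le> 1 / 4"
  shows "\<bar>\<integral>p. g (fst p) * g (snd p) \<partial>binormal r\<bar> \<le> 200 * K\<^sup>2 * r\<^sup>2"
proof -
  define G where "G u = (\<integral>v. g (r * u + sqrt (1 - r\<^sup>2) * v) \<partial>std_gauss)" for u
  have "(\<integral>p. g (fst p) * g (snd p) \<partial>binormal r) = (\<integral>u. g u * G u \<partial>std_gauss)"
    using r by (simp add: integral_binormal integrable_binormal_mult G_def)
  then have "\<bar>\<integral>p. g (fst p) * g (snd p) \<partial>binormal r\<bar> \<le> (\<integral>u. \<bar>g u * G u\<bar> \<partial>std_gauss)"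
    using integral_abs_bound[of std_gauss "\<lambda>u. g u * G u"] by simp
  also have "\<dots> \<le> (\<integral>u. 40 * r\<^sup>2 * (K * sqrt 5) * (\<bar>g u\<bar> * exp (u\<^sup>2 / 4)) \<partial>std_gauss)"
  proof (rule integral_mono')
    show "integrable std_gauss (\<lambda>u. 40 * r\<^sup>2 * (K * sqrt 5) * (\<bar>g u\<bar> * exp (u\<^sup>2 / 4)))"
      by (intro integrable_mult_right integrable_weighted)
    show "\<bar>g u * G u\<bar> \<le> 40 * r\<^sup>2 * (K * sqrt 5) * (\<bar>g u\<bar> * exp (u\<^sup>2 / 4))" for u
      using mult_left_mono[OF abs_conditional_mean_le[OF r, of u, folded G_def], of "\<bar>g u\<bar>"]
      by (simp add: abs_mult mult_ac)
  qed (use K_nonneg in simp)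
  also have "\<dots> \<le> 40 * r\<^sup>2 * (K * sqrt 5) * (K * sqrt 5)"
    unfolding integral_mult_right_zero using K_nonneg by (intro mult_left_mono integral_weighted_le) auto
  also have "\<dots> = 200 * K\<^sup>2 * r\<^sup>2" by (simp add: power2_eq_square)
  finally show ?thesis .
qed

lemma abs_covariance_le:
  assumes r: "\<bar>r\<bar> \<le> 1"
  shows "\<bar>\<integral>p. g (fst p) * g (snd p) \<partial>binormal r\<bar> \<le> 200 * K\<^sup>2 * r\<^sup>2"
proof (cases "\<bar>r\<bar> \<le> 1 / 4")
  case False
  then have "(1 / 4)\<^sup>2 \<le> r\<^sup>2" by (subst abs_le_square_iff[symmetric]) simp
  then have r2: "1 \<le> 16 * r\<^sup>2" by (simp add: power2_eq_square)
  have sqrt5: "sqrt 5 \<le> 3" by (intro real_le_lsqrt) auto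
  have "\<bar>\<integral>p. g (fst p) * g (snd p) \<partial>binormal r\<bar> \<le> (\<integral>y. (g y)\<^sup>2 \<partial>std_gauss)"
    using binormal_mult_square_integrable(2)[OF r measurable_g measurable_g integrable_square integrable_square] by simp
  also have "\<dots> \<le> K\<^sup>2 * sqrt 5" by (rule integral_square_le)
  also have "\<dots> \<le> K\<^sup>2 * (3 * (16 * r\<^sup>2))" using sqrt5 r2 by (intro mult_left_mono) auto
  also have "\<dots> \<le> 200 * K\<^sup>2 * r\<^sup>2" by simp
  finally show ?thesis .
qed (rule abs_covariance_le_of_small_correlation)

end

subsection \<open>Hard thresholding\<close>

definition tail_prob :: "real \<Rightarrow> real" where
  "tail_prob \<tau> = measure std_gauss {z. \<tau> \<le> \<bar>z\<bar>}"

definition tail_second_moment :: "real \<Rightarrow> real" where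
  "tail_second_moment \<tau> = (\<integral>z. indicator {z. \<tau> \<le> \<bar>z\<bar>} z * z\<^sup>2 \<partial>std_gauss)"

lemma integrable_tail_second_moment: "integrable std_gauss (\<lambda>z. indicator {z. \<tau> \<le> \<bar>z\<bar>} z * z\<^sup>2)"
  by (rule Bochner_Integration.integrable_bound[OF integrable_std_gauss_power[of 2]]) (auto split: split_indicator)

lemma integrable_tail_indicator: "integrable std_gauss (\<lambda>z. indicator {z. \<tau> \<le> \<bar>z\<bar>} z :: real)"
  by (rule integrable_real_indicator) (auto simp: std_gauss.emeasure_eq_measure)

lemma std_normal_density_double_le:
  assumes "8 * ln 2 \<le> 3 * w\<^sup>2"
  shows "std_normal_density (2 * w) \<le> std_normal_density w / 16"
proof -
  have "exp (4 * ln 2) \<le> exp (3 * w\<^sup>2 / 2)" using assms by simp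
  moreover have "exp (4 * ln 2) = (16 :: real)" using exp_of_nat_mult[of 4 "ln 2 :: real"] by simp
  ultimately have "exp (- (3 * w\<^sup>2 / 2)) \<le> 1 / 16" by (simp add: exp_minus field_simps)
  then have "std_normal_density w * exp (- (3 * w\<^sup>2 / 2)) \<le> std_normal_density w * (1 / 16)"
    by (intro mult_left_mono) auto
  moreover have "std_normal_density (2 * w) = std_normal_density w * exp (- (3 * w\<^sup>2 / 2))"
    by (simp add: std_normal_density_def exp_add[symmetric] power_mult_distrib field_simps)
  ultimately show ?thesis by simp
qed

lemma tail_second_moment_double_le:
  assumes \<tau>: "0 \<le> \<tau>" "8 * ln 2 \<le> 3 * \<tau>\<^sup>2"
  shows "tail_second_moment (2 * \<tau>) \<le> tail_second_moment \<tau> / 2"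
proof -
  have "tail_second_moment (2 * \<tau>) = (\<integral>z. std_normal_density z * (indicator {z. 2 * \<tau> \<le> \<bar>z\<bar>} z * z\<^sup>2) \<partial>lborel)"
    unfolding tail_second_moment_def by (rule integral_std_gauss) simp
  also have "\<dots> = 2 * (\<integral>w. std_normal_density (2 * w) * (indicator {z. 2 * \<tau> \<le> \<bar>z\<bar>} (2 * w) * (2 * w)\<^sup>2) \<partial>lborel)"
    by (subst lborel_integral_real_affine[of 2 _ 0]) simp_all
  also have "\<dots> \<le> 2 * (\<integral>w. (1 / 4) * (std_normal_density w * (indicator {z. \<tau> \<le> \<bar>z\<bar>} w * w\<^sup>2)) \<partial>lborel)"
  proof (intro mult_left_mono integral_mono')
    show "integrable lborel (\<lambda>w. (1 / 4) * (std_normal_density w * (indicator {z. \<tau> \<le> \<bar>z\<bar>} w * w\<^sup>2)))"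
      using integrable_tail_second_moment[of \<tau>] by (subst (asm) integrable_std_gauss) auto
    fix w :: real
    show "std_normal_density (2 * w) * (indicator {z. 2 * \<tau> \<le> \<bar>z\<bar>} (2 * w) * (2 * w)\<^sup>2)
        \<le> (1 / 4) * (std_normal_density w * (indicator {z. \<tau> \<le> \<bar>z\<bar>} w * w\<^sup>2))"
    proof (cases "\<tau> \<le> \<bar>w\<bar>")
      case True
      then have "\<tau>\<^sup>2 \<le> w\<^sup>2" using \<tau>(1) by (simp add: abs_le_square_iff[symmetric])
      then have "std_normal_density (2 * w) * (4 * w\<^sup>2) \<le> std_normal_density w / 16 * (4 * w\<^sup>2)"
        using \<tau>(2) by (intro mult_right_mono std_normal_density_double_le) auto
      then show ?thesis using True by (simp add: power_mult_distrib abs_mult)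
    qed (simp add: abs_mult)
  qed (simp_all add: indicator_def)
  also have "\<dots> = tail_second_moment \<tau> / 2"
    unfolding tail_second_moment_def by (subst integral_std_gauss) simp_all
  finally show ?thesis .
qed

text \<open>The part of the integral beyond \<open>2 \<tau>\<close> is at most half of the whole and is absorbed.\<close>
lemma tail_second_moment_le:
  assumes \<tau>: "0 \<le> \<tau>" "8 * ln 2 \<le> 3 * \<tau>\<^sup>2"
  shows "tail_second_moment \<tau> \<le> 8 * \<tau>\<^sup>2 * tail_prob \<tau>"
proof -
  let ?I = "\<lambda>\<tau> z. indicator {z. \<tau> \<le> \<bar>z\<bar>} z :: real"
  have "tail_second_moment \<tau> \<le> (\<integral>z. 4 * \<tau>\<^sup>2 * ?I \<tau> z + ?I (2 * \<tau>) z * z\<^sup>2 \<partial>std_gauss)"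
    unfolding tail_second_moment_def
  proof (rule integral_mono[OF integrable_tail_second_moment])
    show "integrable std_gauss (\<lambda>z. 4 * \<tau>\<^sup>2 * ?I \<tau> z + ?I (2 * \<tau>) z * z\<^sup>2)"
      by (intro Bochner_Integration.integrable_add integrable_mult_right integrable_tail_indicator
          integrable_tail_second_moment)
    fix z :: real
    show "?I \<tau> z * z\<^sup>2 \<le> 4 * \<tau>\<^sup>2 * ?I \<tau> z + ?I (2 * \<tau>) z * z\<^sup>2"
    proof (cases "2 * \<tau> \<le> \<bar>z\<bar>")
      case False
      then have "\<bar>z\<bar> \<le> \<bar>2 * \<tau>\<bar>" using \<tau>(1) by simp
      then have "z\<^sup>2 \<le> (2 * \<tau>)\<^sup>2" by (simp only: abs_le_square_iff)
      then show ?thesis using False by (simp add: power_mult_distrib split: split_indicator)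
    qed (use \<tau>(1) in simp)
  qed
  also have "\<dots> = 4 * \<tau>\<^sup>2 * tail_prob \<tau> + tail_second_moment (2 * \<tau>)"
    using integrable_tail_indicator integrable_tail_second_moment by (simp add: tail_second_moment_def tail_prob_def)
  finally show ?thesis using tail_second_moment_double_le[OF \<tau>] by linarith
qed

definition hard_threshold :: "real \<Rightarrow> real \<Rightarrow> real \<Rightarrow> real" where
  "hard_threshold \<tau> \<beta> y = (if \<tau> < \<bar>y\<bar> then y\<^sup>2 - \<beta> else 0)"

lemma hard_threshold_minus [simp]: "hard_threshold \<tau> \<beta> (- y) = hard_threshold \<tau> \<beta> y"
  by (simp add: hard_threshold_def)

lemma borel_measurable_hard_threshold [measurable]: "hard_threshold \<tau> \<beta> \<in> borel_measurable borel"
  unfolding hard_threshold_def by measurable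

lemma integral_hard_threshold: "(\<integral>y. hard_threshold \<tau> \<beta> y \<partial>std_gauss) = tail_second_moment \<tau> - \<beta> * tail_prob \<tau>"
proof -
  let ?I = "\<lambda>y. indicator {z. \<tau> \<le> \<bar>z\<bar>} y :: real"
  have "(\<integral>y. hard_threshold \<tau> \<beta> y \<partial>std_gauss) = (\<integral>y. std_normal_density y * hard_threshold \<tau> \<beta> y \<partial>lborel)"
    by (rule integral_std_gauss) simp
  also have "\<dots> = (\<integral>y. std_normal_density y * (?I y * y\<^sup>2 - \<beta> * ?I y) \<partial>lborel)"
  proof (rule integral_cong_AE)
    have "AE y in lborel. y \<noteq> \<tau>" "AE y in lborel. y \<noteq> - \<tau>" by (rule AE_lborel_singleton)+
    then show "AE y in lborel. std_normal_density y * hard_threshold \<tau> \<beta> y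
        = std_normal_density y * (?I y * y\<^sup>2 - \<beta> * ?I y)"
      by eventually_elim (auto simp: hard_threshold_def split: split_indicator)
  qed measurable
  also have "\<dots> = (\<integral>y. ?I y * y\<^sup>2 - \<beta> * ?I y \<partial>std_gauss)" by (rule integral_std_gauss[symmetric]) simp
  also have "\<dots> = tail_second_moment \<tau> - \<beta> * tail_prob \<tau>"
    using integrable_tail_indicator integrable_tail_second_moment by (simp add: tail_second_moment_def tail_prob_def)
  finally show ?thesis .
qed

lemma abs_hard_threshold_minus_square_le:
  assumes "0 \<le> \<tau>" "0 \<le> \<beta>" "\<beta> \<le> 8 * \<tau>\<^sup>2"
  shows "\<bar>hard_threshold \<tau> \<beta> y - y\<^sup>2\<bar> \<le> 8 * \<tau>\<^sup>2"
proof (cases "\<tau> < \<bar>y\<bar>")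
  case False
  then have "y\<^sup>2 \<le> \<tau>\<^sup>2" using assms(1) by (simp add: abs_le_square_iff[symmetric])
  then have "y\<^sup>2 \<le> 8 * \<tau>\<^sup>2" using zero_le_power2[of \<tau>] by linarith
  then show ?thesis using False by (simp add: hard_threshold_def)
qed (use assms in \<open>simp add: hard_threshold_def\<close>)

lemma abs_hard_threshold_le_exp:
  assumes "0 \<le> \<tau>" "0 \<le> \<beta>" "\<beta> \<le> 8 * \<tau>\<^sup>2"
  shows "\<bar>hard_threshold \<tau> \<beta> y\<bar> \<le> 88 * exp (- \<tau>\<^sup>2 / 18) * exp (3 * y\<^sup>2 / 20)"
proof (cases "\<tau> < \<bar>y\<bar>")
  case True
  then have \<tau>y: "\<tau>\<^sup>2 \<le> y\<^sup>2" using assms(1) by (simp add: abs_le_square_iff[symmetric])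
  then have "\<bar>hard_threshold \<tau> \<beta> y\<bar> \<le> 8 * y\<^sup>2"
    using True assms unfolding hard_threshold_def abs_le_iff by simp
  also have "\<dots> \<le> 88 * exp (17 * y\<^sup>2 / 180)"
    using exp_ge_add_one_self[of "17 * y\<^sup>2 / 180"] zero_le_power2[of y] by linarith
  also have "\<dots> \<le> 88 * (exp (17 * y\<^sup>2 / 180) * exp ((y\<^sup>2 - \<tau>\<^sup>2) / 18))"
    using \<tau>y by simp
  also have "\<dots> = 88 * exp (- \<tau>\<^sup>2 / 18) * exp (3 * y\<^sup>2 / 20)"
    by (simp add: exp_add[symmetric] field_simps)
  finally show ?thesis .
qed (simp add: hard_threshold_def)

lemma even_centered_hard_threshold:
  assumes "0 \<le> \<tau>" "0 \<le> \<beta>" "\<beta> \<le> 8 * \<tau>\<^sup>2" "tail_second_moment \<tau> = \<beta> * tail_prob \<tau>"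
  shows "even_centered_function (hard_threshold \<tau> \<beta>) (88 * exp (- \<tau>\<^sup>2 / 18))"
proof
  show "\<bar>hard_threshold \<tau> \<beta> y\<bar> \<le> 88 * exp (- \<tau>\<^sup>2 / 18) * exp (3 * y\<^sup>2 / 20)" for y
    using assms by (intro abs_hard_threshold_le_exp)
qed (simp_all add: integral_hard_threshold assms)

lemma even_centered_square_minus_one: "even_centered_function (\<lambda>y. y\<^sup>2 - 1) 7"
proof
  fix y :: real
  have "3 * y\<^sup>2 / 20 + 1 \<le> exp (3 * y\<^sup>2 / 20)" using exp_ge_add_one_self[of "3 * y\<^sup>2 / 20"] by linarith
  then show "\<bar>y\<^sup>2 - 1\<bar> \<le> 7 * exp (3 * y\<^sup>2 / 20)" using zero_le_power2[of y] unfolding abs_le_iff by linarith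
qed simp_all

lemma tau_nonneg: "0 \<le> tau s \<rho>"
  by (simp add: tau_def)

lemma tau_square: "(tau s \<rho>)\<^sup>2 = 9 * ln (1 + \<rho>\<^sup>2 / (real s)\<^sup>2)"
  by (simp add: tau_def power_mult_distrib)

lemma beta_bounds:
  assumes "1 \<le> s" "real s \<le> \<rho>"
  shows "0 \<le> beta s \<rho>" "beta s \<rho> \<le> 8 * (tau s \<rho>)\<^sup>2" "tail_second_moment (tau s \<rho>) = beta s \<rho> * tail_prob (tau s \<rho>)"
proof -
  let ?\<tau> = "tau s \<rho>"
  have beta_eq: "beta s \<rho> = tail_second_moment ?\<tau> / tail_prob ?\<tau>"
    by (simp add: beta_def tail_second_moment_def tail_prob_def)
  have nonneg: "0 \<le> tail_second_moment ?\<tau>" "0 \<le> tail_prob ?\<tau>"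
    unfolding tail_second_moment_def tail_prob_def by (intro Bochner_Integration.integral_nonneg) auto
  have "8 * ln 2 \<le> 3 * ?\<tau>\<^sup>2"
    using ln2_le_ln_one_plus_ratio[OF assms] ln2_ge_two_thirds unfolding tau_square by linarith
  then have moment_le: "tail_second_moment ?\<tau> \<le> 8 * ?\<tau>\<^sup>2 * tail_prob ?\<tau>"
    by (intro tail_second_moment_le tau_nonneg)
  show "0 \<le> beta s \<rho>" using nonneg by (simp add: beta_eq)
  show "beta s \<rho> \<le> 8 * ?\<tau>\<^sup>2"
    using moment_le nonneg by (cases "tail_prob ?\<tau> = 0") (simp_all add: beta_eq divide_le_eq)
  show "tail_second_moment ?\<tau> = beta s \<rho> * tail_prob ?\<tau>"
    using moment_le nonneg by (cases "tail_prob ?\<tau> = 0") (simp_all add: beta_eq)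
qed

subsection \<open>The upper bound\<close>

text \<open>If \<open>V\<close> dominates \<open>U\<close> the bound is \<open>2 V\<close>; otherwise \<open>\<bar>\<surd>|Q| - t\<bar> t \<le> \<bar>|Q| - t\<^sup>2\<bar> \<le> 2 \<bar>U\<bar>\<close>.\<close>
lemma sqrt_abs_error_le:
  fixes Q t U V :: real
  assumes t: "0 \<le> t" and U_eq_0: "t = 0 \<Longrightarrow> U = 0" and error: "\<bar>Q - t\<^sup>2 - U\<bar> \<le> V"
  shows "(sqrt \<bar>Q\<bar> - t)\<^sup>2 \<le> 4 / t\<^sup>2 * U\<^sup>2 + 2 * V"
proof -
  define q where "q = sqrt \<bar>Q\<bar>"
  have q: "0 \<le> q" "q\<^sup>2 = \<bar>Q\<bar>" by (simp_all add: q_def)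
  have V_nonneg: "0 \<le> V" using error by linarith
  have "\<bar>q - t\<bar> * (q + t) = \<bar>(q - t) * (q + t)\<bar>" using q(1) t by (simp add: abs_mult)
  also have "\<dots> = \<bar>\<bar>Q\<bar> - t\<^sup>2\<bar>" by (simp add: power2_eq_square algebra_simps flip: q(2))
  also have "\<dots> \<le> \<bar>U\<bar> + V" using error zero_le_power2[of t] by linarith
  finally have factored: "\<bar>q - t\<bar> * (q + t) \<le> \<bar>U\<bar> + V" .
  have "(q - t)\<^sup>2 \<le> 4 / t\<^sup>2 * U\<^sup>2 + 2 * V"
  proof (cases "\<bar>U\<bar> \<le> V")
    case True
    have "(q - t)\<^sup>2 = \<bar>q - t\<bar> * \<bar>q - t\<bar>" by (simp add: power2_eq_square)
    also have "\<dots> \<le> \<bar>q - t\<bar> * (q + t)" using q t by (intro mult_left_mono) auto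
    also have "\<dots> \<le> 2 * V" using factored True by linarith
    also have "\<dots> \<le> 4 / t\<^sup>2 * U\<^sup>2 + 2 * V" by simp
    finally show ?thesis .
  next
    case False
    then have "0 < t" using U_eq_0 V_nonneg t by fastforce
    have "\<bar>q - t\<bar> * t \<le> \<bar>q - t\<bar> * (q + t)" using q by (intro mult_left_mono) auto
    also have "\<dots> \<le> 2 * \<bar>U\<bar>" using factored False by linarith
    finally have "(\<bar>q - t\<bar> * t)\<^sup>2 \<le> (2 * \<bar>U\<bar>)\<^sup>2" using t by (intro power_mono) auto
    then have "(q - t)\<^sup>2 \<le> 4 / t\<^sup>2 * U\<^sup>2" using \<open>0 < t\<close> by (simp add: power_mult_distrib field_simps)
    then show ?thesis using V_nonneg by linarith
  qed
  then show ?thesis by (simp add: q_def)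
qed

lemma nn_integral_sqrt_abs_error_le:
  fixes Q U V :: "'z \<Rightarrow> real"
  assumes t: "0 \<le> t" and U_eq_0: "\<And>z. t = 0 \<Longrightarrow> U z = 0" and error: "\<And>z. \<bar>Q z - t\<^sup>2 - U z\<bar> \<le> V z"
    and integrable_U: "integrable M (\<lambda>z. (U z)\<^sup>2)" and U_le: "(\<integral>z. (U z)\<^sup>2 \<partial>M) \<le> 4 * \<kappa> * t\<^sup>2" and \<kappa>: "0 \<le> \<kappa>"
    and integrable_V: "integrable M V" and v_le: "(\<integral>z. V z \<partial>M) \<le> v"
  shows "(\<integral>\<^sup>+z. ennreal ((sqrt \<bar>Q z\<bar> - t)\<^sup>2) \<partial>M) \<le> ennreal (16 * \<kappa> + 2 * v)"
proof -
  have V_nonneg: "0 \<le> V z" for z using error[of z] by linarith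
  have integrable_bound: "integrable M (\<lambda>z. 4 / t\<^sup>2 * (U z)\<^sup>2 + 2 * V z)"
    using integrable_U integrable_V by (intro Bochner_Integration.integrable_add integrable_mult_right)
  have "(\<integral>\<^sup>+z. ennreal ((sqrt \<bar>Q z\<bar> - t)\<^sup>2) \<partial>M) \<le> (\<integral>\<^sup>+z. ennreal (4 / t\<^sup>2 * (U z)\<^sup>2 + 2 * V z) \<partial>M)"
    by (intro nn_integral_mono ennreal_leI sqrt_abs_error_le t U_eq_0 error)
  also have "\<dots> = ennreal (\<integral>z. 4 / t\<^sup>2 * (U z)\<^sup>2 + 2 * V z \<partial>M)"
    using integrable_bound V_nonneg by (intro nn_integral_eq_integral) auto
  also have "\<dots> = ennreal (4 / t\<^sup>2 * (\<integral>z. (U z)\<^sup>2 \<partial>M) + 2 * (\<integral>z. V z \<partial>M))"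
    using integrable_U integrable_V by simp
  also have "\<dots> \<le> ennreal (16 * \<kappa> + 2 * v)"
  proof (intro ennreal_leI add_mono mult_left_mono v_le)
    have "4 / t\<^sup>2 * (\<integral>z. (U z)\<^sup>2 \<partial>M) \<le> 4 / t\<^sup>2 * (4 * \<kappa> * t\<^sup>2)" using U_le by (intro mult_left_mono) auto
    also have "\<dots> \<le> 16 * \<kappa>" using \<kappa> by (cases "t = 0") auto
    finally show "4 / t\<^sup>2 * (\<integral>z. (U z)\<^sup>2 \<partial>M) \<le> 16 * \<kappa>" .
  qed simp
  finally show ?thesis .
qed

lemma (in prob_space) expectation_abs_le_sqrt:
  assumes [measurable]: "W \<in> borel_measurable M" and integrable_square: "integrable M (\<lambda>z. (W z)\<^sup>2)"
    and w_bound: "expectation (\<lambda>z. (W z)\<^sup>2) \<le> w\<^sup>2" "0 \<le> w"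
  shows "integrable M (\<lambda>z. \<bar>W z\<bar>)" "expectation (\<lambda>z. \<bar>W z\<bar>) \<le> (w :: real)"
proof -
  show integrable_abs_W: "integrable M (\<lambda>z. \<bar>W z\<bar>)"
    by (rule integrable_abs[OF square_integrable_imp_integrable[OF _ integrable_square]]) fact
  have "variance (\<lambda>z. \<bar>W z\<bar>) = expectation (\<lambda>z. (W z)\<^sup>2) - (expectation (\<lambda>z. \<bar>W z\<bar>))\<^sup>2"
    using integrable_square by (subst variance_eq[OF integrable_abs_W]) simp_all
  then have "(expectation (\<lambda>z. \<bar>W z\<bar>))\<^sup>2 \<le> w\<^sup>2"
    using variance_positive[of "\<lambda>z. \<bar>W z\<bar>"] w_bound(1) by linarith
  then show "expectation (\<lambda>z. \<bar>W z\<bar>) \<le> w" using w_bound(2) by (rule power2_le_imp_le)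
qed

lemma integral_square_sum:
  fixes X :: "'i \<Rightarrow> 'z \<Rightarrow> real"
  assumes "\<And>i j. i \<in> I \<Longrightarrow> j \<in> I \<Longrightarrow> integrable M (\<lambda>z. X i z * X j z)"
  shows "integrable M (\<lambda>z. (\<Sum>i\<in>I. X i z)\<^sup>2)"
    and "(\<integral>z. (\<Sum>i\<in>I. X i z)\<^sup>2 \<partial>M) = (\<Sum>i\<in>I. \<Sum>j\<in>I. \<integral>z. X i z * X j z \<partial>M)"
  unfolding power2_eq_square sum_product using assms by auto

lemma quadratic_form_le_frob_norm:
  fixes S :: "nat \<Rightarrow> nat \<Rightarrow> real" and \<theta> :: "nat \<Rightarrow> real"
  shows "(\<Sum>i<d. \<Sum>j<d. \<theta> i * \<theta> j * S i j) \<le> frob_norm d S * (\<Sum>i<d. (\<theta> i)\<^sup>2)"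
proof (rule power2_le_imp_le)
  have pairs: "(\<Sum>i<d. \<Sum>j<d. f i j) = (\<Sum>p\<in>{..<d} \<times> {..<d}. f (fst p) (snd p))" for f :: "nat \<Rightarrow> nat \<Rightarrow> real"
    by (simp add: sum.cartesian_product case_prod_beta')
  have "(\<Sum>i<d. \<Sum>j<d. \<theta> i * \<theta> j * S i j)\<^sup>2 \<le> (\<Sum>i<d. \<Sum>j<d. (\<theta> i * \<theta> j)\<^sup>2) * (\<Sum>i<d. \<Sum>j<d. (S i j)\<^sup>2)"
    unfolding pairs by (rule Cauchy_Schwarz_ineq_sum)
  also have "(\<Sum>i<d. \<Sum>j<d. (\<theta> i * \<theta> j)\<^sup>2) = (\<Sum>i<d. (\<theta> i)\<^sup>2)\<^sup>2"
    by (simp only: power_mult_distrib power2_eq_square[of "sum _ _"] sum_product)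
  also have "(\<Sum>i<d. \<Sum>j<d. (S i j)\<^sup>2) = (frob_norm d S)\<^sup>2"
    by (simp add: frob_norm_def sum_nonneg)
  finally show "(\<Sum>i<d. \<Sum>j<d. \<theta> i * \<theta> j * S i j)\<^sup>2 \<le> (frob_norm d S * (\<Sum>i<d. (\<theta> i)\<^sup>2))\<^sup>2"
    by (simp add: power_mult_distrib mult.commute)
qed (simp add: frob_norm_def sum_nonneg)

lemma quadratic_form_le_l0norm:
  fixes S :: "nat \<Rightarrow> nat \<Rightarrow> real" and \<theta> :: "nat \<Rightarrow> real"
  assumes S: "\<And>i j. i < d \<Longrightarrow> j < d \<Longrightarrow> \<bar>S i j\<bar> \<le> 1"
  shows "(\<Sum>i<d. \<Sum>j<d. \<theta> i * \<theta> j * S i j) \<le> real (l0norm d \<theta>) * (\<Sum>i<d. (\<theta> i)\<^sup>2)"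
proof -
  have "\<theta> i * \<theta> j * S i j \<le> \<bar>\<theta> i\<bar> * \<bar>\<theta> j\<bar>" if "i < d" "j < d" for i j
    using abs_ge_self[of "\<theta> i * \<theta> j * S i j"] mult_left_mono[OF S[OF that], of "\<bar>\<theta> i\<bar> * \<bar>\<theta> j\<bar>"]
    by (simp add: abs_mult)
  then have "(\<Sum>i<d. \<Sum>j<d. \<theta> i * \<theta> j * S i j) \<le> (\<Sum>i<d. \<Sum>j<d. \<bar>\<theta> i\<bar> * \<bar>\<theta> j\<bar>)"
    by (intro sum_mono) simp
  also have "\<dots> = (\<Sum>i<d. of_bool (\<theta> i \<noteq> 0) * \<bar>\<theta> i\<bar>)\<^sup>2"
    unfolding power2_eq_square sum_product by (intro sum.cong refl) auto
  also have "\<dots> \<le> (\<Sum>i<d. (of_bool (\<theta> i \<noteq> 0))\<^sup>2) * (\<Sum>i<d. \<bar>\<theta> i\<bar>\<^sup>2)"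
    by (rule Cauchy_Schwarz_ineq_sum)
  also have "(\<Sum>i<d. (of_bool (\<theta> i \<noteq> 0))\<^sup>2) = (\<Sum>i<d. if \<theta> i \<noteq> 0 then 1 else (0 :: real))"
    by (intro sum.cong) auto
  also have "\<dots> = real (l0norm d \<theta>)"
    by (simp add: l0norm_def sum.If_cases Int_def)
  finally show ?thesis by simp
qed

locale gaussian_noise = prob_space M for M :: "'z measure" +
  fixes d :: nat and S :: "nat \<Rightarrow> nat \<Rightarrow> real" and X :: "nat \<Rightarrow> 'z \<Rightarrow> real"
  assumes is_cov: "is_cov d S"
    and unit_variance: "\<And>i. i < d \<Longrightarrow> S i i = 1"
    and measurable_noise [measurable]: "\<And>i. X i \<in> borel_measurable M"
    and distr_noise_pair: "\<And>i j. i < d \<Longrightarrow> j < d \<Longrightarrow> distr M (borel \<Otimes>\<^sub>M borel) (\<lambda>z. (X i z, X j z)) = binormal (S i j)"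
begin

lemma abs_correlation_le: "i < d \<Longrightarrow> j < d \<Longrightarrow> \<bar>S i j\<bar> \<le> 1"
  by (intro abs_correlation_le_1[OF is_cov] unit_variance)

lemma integral_noise_pair:
  fixes F :: "real \<times> real \<Rightarrow> real"
  assumes "i < d" "j < d" "integrable (binormal (S i j)) F"
  shows "integrable M (\<lambda>z. F (X i z, X j z))" "expectation (\<lambda>z. F (X i z, X j z)) = (\<integral>p. F p \<partial>binormal (S i j))"
proof -
  have [measurable]: "F \<in> borel_measurable (borel \<Otimes>\<^sub>M borel)"
    using borel_measurable_integrable[OF assms(3)] by simp
  show "integrable M (\<lambda>z. F (X i z, X j z))"
    using assms(3) unfolding distr_noise_pair[OF assms(1,2), symmetric] by (subst (asm) integrable_distr_eq) simp_all
  show "expectation (\<lambda>z. F (X i z, X j z)) = (\<integral>p. F p \<partial>binormal (S i j))"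
    unfolding distr_noise_pair[OF assms(1,2), symmetric] by (rule integral_distr[symmetric]) simp_all
qed

lemma covariance_noise:
  assumes "i < d" "j < d"
  shows "integrable M (\<lambda>z. X i z * X j z)" "expectation (\<lambda>z. X i z * X j z) = S i j"
  using integral_noise_pair[OF assms, of "\<lambda>p. fst p * snd p"] binormal_covariance[OF abs_correlation_le[OF assms]]
  by simp_all

lemma second_moment_noise:
  assumes "i < d"
  shows "integrable M (\<lambda>z. (X i z)\<^sup>2)" "expectation (\<lambda>z. (X i z)\<^sup>2) = 1"
  using covariance_noise[OF assms assms] unit_variance[OF assms] by (simp_all add: power2_eq_square)

lemma second_moment_noise_sum:
  assumes "J \<subseteq> {..<d}"
  shows "integrable M (\<lambda>z. \<Sum>i\<in>J. (X i z)\<^sup>2 + b)" "expectation (\<lambda>z. \<Sum>i\<in>J. (X i z)\<^sup>2 + b) = real (card J) * (1 + b)"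
proof -
  have summand: "integrable M (\<lambda>z. (X i z)\<^sup>2 + b)" "expectation (\<lambda>z. (X i z)\<^sup>2 + b) = 1 + b" if "i \<in> J" for i
    using second_moment_noise[of i] that assms by (auto simp: prob_space)
  then show "integrable M (\<lambda>z. \<Sum>i\<in>J. (X i z)\<^sup>2 + b)" by simp
  show "expectation (\<lambda>z. \<Sum>i\<in>J. (X i z)\<^sup>2 + b) = real (card J) * (1 + b)"
    using summand by (subst Bochner_Integration.integral_sum) simp_all
qed

lemma second_moment_linear_form:
  shows "integrable M (\<lambda>z. (\<Sum>i<d. w i * X i z)\<^sup>2)"
    and "expectation (\<lambda>z. (\<Sum>i<d. w i * X i z)\<^sup>2) = (\<Sum>i<d. \<Sum>j<d. w i * w j * S i j)"
proof -
  have rearrange: "(w i * X i z) * (w j * X j z) = w i * w j * (X i z * X j z)" for i j z by simp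
  have pair: "integrable M (\<lambda>z. (w i * X i z) * (w j * X j z))"
    "expectation (\<lambda>z. (w i * X i z) * (w j * X j z)) = w i * w j * S i j" if "i < d" "j < d" for i j
    unfolding rearrange using covariance_noise[OF that] by simp_all
  show "integrable M (\<lambda>z. (\<Sum>i<d. w i * X i z)\<^sup>2)"
    using pair by (intro integral_square_sum) auto
  show "expectation (\<lambda>z. (\<Sum>i<d. w i * X i z)\<^sup>2) = (\<Sum>i<d. \<Sum>j<d. w i * w j * S i j)"
    using pair by (subst integral_square_sum) auto
qed

lemma second_moment_sum_even_centered:
  assumes g: "even_centered_function g K" and J: "J \<subseteq> {..<d}"
  shows "integrable M (\<lambda>z. (\<Sum>i\<in>J. g (X i z))\<^sup>2)"
    and "expectation (\<lambda>z. (\<Sum>i\<in>J. g (X i z))\<^sup>2) \<le> 200 * K\<^sup>2 * (frob_norm d S)\<^sup>2"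
proof -
  interpret even_centered_function g K by fact
  have pair: "integrable M (\<lambda>z. g (X i z) * g (X j z))"
    "expectation (\<lambda>z. g (X i z) * g (X j z)) \<le> 200 * K\<^sup>2 * (S i j)\<^sup>2" if "i \<in> J" "j \<in> J" for i j
  proof -
    have ij: "i < d" "j < d" using that J by auto
    note r = abs_correlation_le[OF ij]
    show "integrable M (\<lambda>z. g (X i z) * g (X j z))" "expectation (\<lambda>z. g (X i z) * g (X j z)) \<le> 200 * K\<^sup>2 * (S i j)\<^sup>2"
      using integral_noise_pair[OF ij integrable_binormal_mult[OF r]] abs_covariance_le[OF r] by simp_all
  qed
  show "integrable M (\<lambda>z. (\<Sum>i\<in>J. g (X i z))\<^sup>2)"
    using pair by (intro integral_square_sum) auto
  have "expectation (\<lambda>z. (\<Sum>i\<in>J. g (X i z))\<^sup>2) = (\<Sum>i\<in>J. \<Sum>j\<in>J. expectation (\<lambda>z. g (X i z) * g (X j z)))"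
    using pair by (intro integral_square_sum) auto
  also have "\<dots> \<le> (\<Sum>i\<in>J. \<Sum>j\<in>J. 200 * K\<^sup>2 * (S i j)\<^sup>2)"
    by (intro sum_mono pair)
  also have "\<dots> \<le> (\<Sum>i<d. \<Sum>j<d. 200 * K\<^sup>2 * (S i j)\<^sup>2)"
  proof -
    have "(\<Sum>i\<in>J. \<Sum>j\<in>J. 200 * K\<^sup>2 * (S i j)\<^sup>2) \<le> (\<Sum>i\<in>J. \<Sum>j<d. 200 * K\<^sup>2 * (S i j)\<^sup>2)"
      using J by (intro sum_mono sum_mono2) auto
    also have "\<dots> \<le> (\<Sum>i<d. \<Sum>j<d. 200 * K\<^sup>2 * (S i j)\<^sup>2)"
      using J by (intro sum_mono2) (auto intro: sum_nonneg)
    finally show ?thesis .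
  qed
  also have "\<dots> = 200 * K\<^sup>2 * (frob_norm d S)\<^sup>2"
    by (simp add: frob_norm_def sum_nonneg flip: sum_distrib_left)
  finally show "expectation (\<lambda>z. (\<Sum>i\<in>J. g (X i z))\<^sup>2) \<le> 200 * K\<^sup>2 * (frob_norm d S)\<^sup>2" .
qed

lemma expectation_abs_sum_even_centered:
  assumes g: "even_centered_function g K" and J: "J \<subseteq> {..<d}"
  shows "integrable M (\<lambda>z. \<bar>\<Sum>i\<in>J. g (X i z)\<bar>)"
    and "expectation (\<lambda>z. \<bar>\<Sum>i\<in>J. g (X i z)\<bar>) \<le> 15 * K * frob_norm d S"
proof -
  interpret even_centered_function g K by fact
  note moment = second_moment_sum_even_centered[OF g J]
  note moment(2)
  also have "200 * K\<^sup>2 * (frob_norm d S)\<^sup>2 \<le> 225 * K\<^sup>2 * (frob_norm d S)\<^sup>2"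
    by (intro mult_right_mono) auto
  also have "\<dots> = (15 * K * frob_norm d S)\<^sup>2" by (simp add: power_mult_distrib)
  finally have second_moment_le: "expectation (\<lambda>z. (\<Sum>i\<in>J. g (X i z))\<^sup>2) \<le> (15 * K * frob_norm d S)\<^sup>2" .
  have nonneg: "0 \<le> 15 * K * frob_norm d S" using K_nonneg by (simp add: frob_norm_def sum_nonneg)
  have [measurable]: "(\<lambda>z. \<Sum>i\<in>J. g (X i z)) \<in> borel_measurable M" by measurable
  show "integrable M (\<lambda>z. \<bar>\<Sum>i\<in>J. g (X i z)\<bar>)" "expectation (\<lambda>z. \<bar>\<Sum>i\<in>J. g (X i z)\<bar>) \<le> 15 * K * frob_norm d S"
    by (rule expectation_abs_le_sqrt[OF _ moment(1) second_moment_le nonneg]; measurable)+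
qed

lemma nn_integral_norm_error_le:
  assumes g: "even_centered_function g K" and J: "J \<subseteq> {..<d}"
    and error: "\<And>z. \<bar>Q z - (\<Sum>i<d. (\<theta> i)\<^sup>2) - (\<Sum>i<d. 2 * \<theta> i * X i z)\<bar> \<le> R z + \<bar>\<Sum>i\<in>J. g (X i z)\<bar>"
    and R: "integrable M R" "expectation R \<le> r"
    and \<kappa>: "(\<Sum>i<d. \<Sum>j<d. \<theta> i * \<theta> j * S i j) \<le> \<kappa> * (\<Sum>i<d. (\<theta> i)\<^sup>2)" "0 \<le> \<kappa>"
  shows "(\<integral>\<^sup>+z. ennreal ((sqrt \<bar>Q z\<bar> - l2norm d \<theta>)\<^sup>2) \<partial>M) \<le> ennreal (16 * \<kappa> + 2 * (r + 15 * K * frob_norm d S))"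
proof (rule nn_integral_sqrt_abs_error_le)
  have l2norm: "0 \<le> l2norm d \<theta>" "(l2norm d \<theta>)\<^sup>2 = (\<Sum>i<d. (\<theta> i)\<^sup>2)"
    by (simp_all add: l2norm_def sum_nonneg)
  show "0 \<le> l2norm d \<theta>" by (rule l2norm)
  show "\<bar>Q z - (l2norm d \<theta>)\<^sup>2 - (\<Sum>i<d. 2 * \<theta> i * X i z)\<bar> \<le> R z + \<bar>\<Sum>i\<in>J. g (X i z)\<bar>" for z
    unfolding l2norm(2) by (rule error)
  show "(\<Sum>i<d. 2 * \<theta> i * X i z) = 0" if "l2norm d \<theta> = 0" for z
    using that sum_nonneg_eq_0_iff[of "{..<d}" "\<lambda>i. (\<theta> i)\<^sup>2"] by (simp add: l2norm_def)
  show "integrable M (\<lambda>z. (\<Sum>i<d. 2 * \<theta> i * X i z)\<^sup>2)" by (rule second_moment_linear_form)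
  have "expectation (\<lambda>z. (\<Sum>i<d. 2 * \<theta> i * X i z)\<^sup>2) = 4 * (\<Sum>i<d. \<Sum>j<d. \<theta> i * \<theta> j * S i j)"
    unfolding second_moment_linear_form sum_distrib_left by (simp add: mult_ac)
  then show "expectation (\<lambda>z. (\<Sum>i<d. 2 * \<theta> i * X i z)\<^sup>2) \<le> 4 * \<kappa> * (l2norm d \<theta>)\<^sup>2"
    using \<kappa>(1) by (simp add: l2norm(2))
  note even_sum = expectation_abs_sum_even_centered[OF g J]
  show "integrable M (\<lambda>z. R z + \<bar>\<Sum>i\<in>J. g (X i z)\<bar>)"
    using R(1) even_sum(1) by (rule Bochner_Integration.integrable_add)
  show "expectation (\<lambda>z. R z + \<bar>\<Sum>i\<in>J. g (X i z)\<bar>) \<le> r + 15 * K * frob_norm d S"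
    using R even_sum by simp
qed fact

end

lemma sum_hard_threshold_error_le:
  fixes d :: nat and \<theta> x :: "nat \<Rightarrow> real"
  defines "I \<equiv> {i\<in>{..<d}. \<theta> i \<noteq> 0}"
  assumes "0 \<le> \<tau>" "0 \<le> \<beta>" "\<beta> \<le> 8 * \<tau>\<^sup>2"
  shows "\<bar>(\<Sum>i<d. hard_threshold \<tau> \<beta> (\<theta> i + x i)) - (\<Sum>i<d. (\<theta> i)\<^sup>2) - (\<Sum>i<d. 2 * \<theta> i * x i)\<bar>
    \<le> (\<Sum>i\<in>I. (x i)\<^sup>2 + 8 * \<tau>\<^sup>2) + \<bar>\<Sum>i\<in>{..<d} - I. hard_threshold \<tau> \<beta> (x i)\<bar>"
proof -
  define e where "e i = hard_threshold \<tau> \<beta> (\<theta> i + x i) - (\<theta> i)\<^sup>2 - 2 * \<theta> i * x i" for i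
  have "I \<subseteq> {..<d}" by (auto simp: I_def)
  have "\<bar>e i\<bar> \<le> (x i)\<^sup>2 + 8 * \<tau>\<^sup>2" for i
  proof -
    have "e i = (hard_threshold \<tau> \<beta> (\<theta> i + x i) - (\<theta> i + x i)\<^sup>2) + (x i)\<^sup>2"
      by (simp add: e_def power2_sum)
    then show ?thesis
      using abs_hard_threshold_minus_square_le[OF assms(2-4), of "\<theta> i + x i"] zero_le_power2[of "x i"] by linarith
  qed
  then have "\<bar>\<Sum>i\<in>I. e i\<bar> \<le> (\<Sum>i\<in>I. (x i)\<^sup>2 + 8 * \<tau>\<^sup>2)"
    by (intro order_trans[OF sum_abs] sum_mono)
  moreover have "(\<Sum>i\<in>{..<d} - I. e i) = (\<Sum>i\<in>{..<d} - I. hard_threshold \<tau> \<beta> (x i))"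
    by (intro sum.cong) (auto simp: I_def e_def)
  moreover have "(\<Sum>i<d. hard_threshold \<tau> \<beta> (\<theta> i + x i)) - (\<Sum>i<d. (\<theta> i)\<^sup>2) - (\<Sum>i<d. 2 * \<theta> i * x i)
      = (\<Sum>i\<in>{..<d} - I. e i) + (\<Sum>i\<in>I. e i)"
    using sum.subset_diff[OF \<open>I \<subseteq> {..<d}\<close>, of e] by (simp add: e_def sum_subtractf)
  ultimately show ?thesis by linarith
qed

lemma Q_tilde_sparse:
  "real s \<le> \<rho> \<Longrightarrow> Q_tilde d s \<rho> 1 Y = (\<Sum>i<d. hard_threshold (tau s \<rho>) (beta s \<rho>) (Y i))"
  by (simp add: Q_tilde_def hard_threshold_def cong: if_cong)

lemma exp_tau_square_mult_le:
  assumes "1 \<le> s" "0 \<le> \<rho>"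
  shows "exp (- (tau s \<rho>)\<^sup>2 / 18) * \<rho> \<le> real s"
proof (rule power2_le_imp_le)
  have denominator_pos: "0 < 1 + \<rho>\<^sup>2 / (real s)\<^sup>2" by (intro add_pos_nonneg) auto
  have "(exp (- (tau s \<rho>)\<^sup>2 / 18))\<^sup>2 = exp (- ln (1 + \<rho>\<^sup>2 / (real s)\<^sup>2))"
    unfolding tau_square by (simp flip: exp_double)
  also have "\<dots> = 1 / (1 + \<rho>\<^sup>2 / (real s)\<^sup>2)" using denominator_pos by (simp add: exp_minus inverse_eq_divide)
  also have "\<dots> = (real s)\<^sup>2 / ((real s)\<^sup>2 + \<rho>\<^sup>2)" using assms by (simp add: field_simps)
  finally have "(exp (- (tau s \<rho>)\<^sup>2 / 18) * \<rho>)\<^sup>2 = (real s)\<^sup>2 * (\<rho>\<^sup>2 / ((real s)\<^sup>2 + \<rho>\<^sup>2))"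
    by (simp add: power_mult_distrib)
  also have "\<dots> \<le> (real s)\<^sup>2 * 1" using assms by (intro mult_left_mono) (auto simp: divide_le_eq_1 add_pos_nonneg)
  finally show "(exp (- (tau s \<rho>)\<^sup>2 / 18) * \<rho>)\<^sup>2 \<le> (real s)\<^sup>2" by simp
qed simp

context gaussian_noise
begin

lemma N_tilde_error_dense:
  assumes S: "frob_norm d S \<le> \<rho>" and s: "\<rho> < real s" and \<rho>: "0 \<le> \<rho>"
  shows "(\<integral>\<^sup>+z. ennreal ((N_tilde d s \<rho> 1 (\<lambda>i. \<theta> i + X i z) - l2norm d \<theta>)\<^sup>2) \<partial>M) \<le> ennreal (5000 * phi s (\<rho>\<^sup>2))"
proof -
  have error: "Q_tilde d s \<rho> 1 (\<lambda>i. \<theta> i + X i z) - (\<Sum>i<d. (\<theta> i)\<^sup>2) - (\<Sum>i<d. 2 * \<theta> i * X i z)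
      = (\<Sum>i<d. (X i z)\<^sup>2 - 1)" for z
    using s by (simp add: Q_tilde_def power2_sum sum_subtractf sum.distrib)
  have "(\<integral>\<^sup>+z. ennreal ((sqrt \<bar>Q_tilde d s \<rho> 1 (\<lambda>i. \<theta> i + X i z)\<bar> - l2norm d \<theta>)\<^sup>2) \<partial>M)
      \<le> ennreal (16 * \<rho> + 2 * (0 + 15 * 7 * frob_norm d S))"
  proof (rule nn_integral_norm_error_le[OF even_centered_square_minus_one, where J="{..<d}" and R="\<lambda>_. 0"])
    show "(\<Sum>i<d. \<Sum>j<d. \<theta> i * \<theta> j * S i j) \<le> \<rho> * (\<Sum>i<d. (\<theta> i)\<^sup>2)"
      using quadratic_form_le_frob_norm mult_right_mono[OF S] by (rule order_trans) (simp add: sum_nonneg)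
  qed (simp_all add: error \<rho>)
  also have "\<dots> \<le> ennreal (5000 * phi s (\<rho>\<^sup>2))"
    using S s \<rho> by (intro ennreal_leI) (simp add: phi_def)
  finally show ?thesis by (simp add: N_tilde_def)
qed

lemma N_tilde_error_sparse:
  assumes S: "frob_norm d S \<le> \<rho>" and s: "1 \<le> s" "real s \<le> \<rho>" and \<theta>: "l0norm d \<theta> \<le> s"
  shows "(\<integral>\<^sup>+z. ennreal ((N_tilde d s \<rho> 1 (\<lambda>i. \<theta> i + X i z) - l2norm d \<theta>)\<^sup>2) \<partial>M) \<le> ennreal (5000 * phi s (\<rho>\<^sup>2))"
proof -
  define \<tau> where "\<tau> = tau s \<rho>"
  define I where "I = {i\<in>{..<d}. \<theta> i \<noteq> 0}"
  have support: "I \<subseteq> {..<d}" "real (card I) \<le> real s" using \<theta> by (auto simp: I_def l0norm_def)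
  define l where "l = ln (1 + \<rho>\<^sup>2 / (real s)\<^sup>2)"
  have l_ge: "2 / 3 \<le> l" using ln2_le_ln_one_plus_ratio[OF s] ln2_ge_two_thirds by (simp add: l_def)
  note \<beta> = beta_bounds[OF s, folded \<tau>_def]
  have \<tau>: "0 \<le> \<tau>" "\<tau>\<^sup>2 = 9 * l" unfolding \<tau>_def l_def by (rule tau_nonneg, rule tau_square)
  have support_moment_le: "expectation (\<lambda>z. \<Sum>i\<in>I. (X i z)\<^sup>2 + 8 * \<tau>\<^sup>2) \<le> real s * (1 + 8 * \<tau>\<^sup>2)"
    unfolding second_moment_noise_sum(2)[OF support(1)] using support(2) by (rule mult_right_mono) simp
  have "(\<integral>\<^sup>+z. ennreal ((sqrt \<bar>Q_tilde d s \<rho> 1 (\<lambda>i. \<theta> i + X i z)\<bar> - l2norm d \<theta>)\<^sup>2) \<partial>M)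
      \<le> ennreal (16 * real s + 2 * (real s * (1 + 8 * \<tau>\<^sup>2) + 15 * (88 * exp (- \<tau>\<^sup>2 / 18)) * frob_norm d S))"
  proof (rule nn_integral_norm_error_le[OF even_centered_hard_threshold[OF \<tau>(1) \<beta>] _ _
        second_moment_noise_sum(1)[OF support(1)] support_moment_le])
    show "\<bar>Q_tilde d s \<rho> 1 (\<lambda>i. \<theta> i + X i z) - (\<Sum>i<d. (\<theta> i)\<^sup>2) - (\<Sum>i<d. 2 * \<theta> i * X i z)\<bar>
        \<le> (\<Sum>i\<in>I. (X i z)\<^sup>2 + 8 * \<tau>\<^sup>2) + \<bar>\<Sum>i\<in>{..<d} - I. hard_threshold \<tau> (beta s \<rho>) (X i z)\<bar>" for z
      unfolding Q_tilde_sparse[OF s(2)] \<tau>_def[symmetric] I_def by (rule sum_hard_threshold_error_le[OF \<tau>(1) \<beta>(1,2)])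
    have "(\<Sum>i<d. \<Sum>j<d. \<theta> i * \<theta> j * S i j) \<le> real (l0norm d \<theta>) * (\<Sum>i<d. (\<theta> i)\<^sup>2)"
      by (intro quadratic_form_le_l0norm abs_correlation_le)
    also have "\<dots> \<le> real s * (\<Sum>i<d. (\<theta> i)\<^sup>2)"
      using \<theta> by (intro mult_right_mono sum_nonneg) auto
    finally show "(\<Sum>i<d. \<Sum>j<d. \<theta> i * \<theta> j * S i j) \<le> real s * (\<Sum>i<d. (\<theta> i)\<^sup>2)" .
  qed simp_all
  also have "\<dots> \<le> ennreal (5000 * phi s (\<rho>\<^sup>2))"
  proof (rule ennreal_leI)
    have "exp (- \<tau>\<^sup>2 / 18) * frob_norm d S \<le> exp (- \<tau>\<^sup>2 / 18) * \<rho>" using S by (rule mult_left_mono) simp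
    also have "\<dots> \<le> real s" unfolding \<tau>_def using s by (intro exp_tau_square_mult_le) auto
    finally have "16 * real s + 2 * (real s * (1 + 8 * \<tau>\<^sup>2) + 15 * (88 * exp (- \<tau>\<^sup>2 / 18)) * frob_norm d S)
        \<le> real s * (2658 + 144 * l)"
      unfolding \<tau>(2) by (simp add: algebra_simps)
    also have "\<dots> \<le> real s * (5000 * l)" using l_ge by (intro mult_left_mono) auto
    also have "\<dots> = 5000 * phi s (\<rho>\<^sup>2)" using s by (simp add: phi_def l_def)
    finally show "16 * real s + 2 * (real s * (1 + 8 * \<tau>\<^sup>2) + 15 * (88 * exp (- \<tau>\<^sup>2 / 18)) * frob_norm d S)
        \<le> 5000 * phi s (\<rho>\<^sup>2)" .
  qed
  finally show ?thesis by (simp add: N_tilde_def)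
qed

end

lemma gaussian_noise_of_Theta:
  assumes "(\<theta>, S) \<in> Theta s d \<rho>"
  shows "gaussian_noise (gauss_vec d) d S (noise d S)"
proof (intro gaussian_noise.intro gaussian_noise_axioms.intro)
  show "prob_space (gauss_vec d)" by (rule gauss_vec.prob_space_axioms)
  show cov: "is_cov d S" using assms by (simp add: Theta_def)
  show diag: "S i i = 1" if "i < d" for i using assms that by (simp add: Theta_def)
  show "noise d S i \<in> borel_measurable (gauss_vec d)" for i by measurable
  show "distr (gauss_vec d) (borel \<Otimes>\<^sub>M borel) (\<lambda>z. (noise d S i z, noise d S j z)) = binormal (S i j)" if "i < d" "j < d" for i j
    using dot_cov_factor[OF cov] diag that by (intro distr_gauss_vec_dot_pair) auto
qed

lemma N_tilde_estimator: "N_tilde d s \<rho> \<sigma> \<in> estimators d"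
  unfolding estimators_def N_tilde_def Q_tilde_def by measurable

lemma N_tilde_scale:
  assumes \<sigma>: "0 < \<sigma>"
  shows "N_tilde d s \<rho> \<sigma> (\<lambda>i\<in>{..<d}. \<theta> i + \<sigma> * e i) = \<sigma> * N_tilde d s \<rho> 1 (\<lambda>i. \<theta> i / \<sigma> + e i)"
proof -
  have factor: "\<theta> i + \<sigma> * e i = \<sigma> * (\<theta> i / \<sigma> + e i)" for i using \<sigma> by (simp add: field_simps)
  have "Q_tilde d s \<rho> \<sigma> (\<lambda>i\<in>{..<d}. \<theta> i + \<sigma> * e i) = \<sigma>\<^sup>2 * Q_tilde d s \<rho> 1 (\<lambda>i. \<theta> i / \<sigma> + e i)"
    unfolding Q_tilde_def factor using \<sigma>
    by (simp add: sum_distrib_left if_distrib[where f="\<lambda>x. \<sigma>\<^sup>2 * x"] abs_mult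
        power_mult_distrib right_diff_distrib cong: if_cong)
  then show ?thesis using \<sigma> by (simp add: N_tilde_def abs_mult real_sqrt_mult)
qed

lemma l2norm_scale: "0 \<le> c \<Longrightarrow> l2norm d (\<lambda>i. c * x i) = c * l2norm d x"
  by (simp add: l2norm_def power_mult_distrib real_sqrt_mult flip: sum_distrib_left)

lemma N_tilde_risk_le:
  assumes parameter: "(\<theta>, S) \<in> Theta s d \<rho>" and s: "1 \<le> s" and \<rho>: "0 \<le> \<rho>" and \<sigma>: "0 < \<sigma>"
  shows "risk d (N_tilde d s \<rho> \<sigma>) \<theta> \<sigma> S \<le> ennreal (5000 * \<sigma>\<^sup>2 * phi s (\<rho>\<^sup>2))"
proof -
  let ?\<theta> = "\<lambda>i. \<theta> i / \<sigma>"
  interpret gaussian_noise "gauss_vec d" d S "noise d S"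
    using parameter by (rule gaussian_noise_of_Theta)
  have "frob_norm d S \<le> \<rho>" "l0norm d ?\<theta> \<le> s" using parameter \<sigma> by (auto simp: Theta_def l0norm_def)
  then have unit_noise: "(\<integral>\<^sup>+z. ennreal ((N_tilde d s \<rho> 1 (\<lambda>i. ?\<theta> i + noise d S i z) - l2norm d ?\<theta>)\<^sup>2) \<partial>gauss_vec d)
      \<le> ennreal (5000 * phi s (\<rho>\<^sup>2))"
    using N_tilde_error_dense N_tilde_error_sparse s \<rho> by (cases "real s \<le> \<rho>") auto
  have "l2norm d \<theta> = \<sigma> * l2norm d ?\<theta>" using \<sigma> l2norm_scale[of \<sigma> d ?\<theta>] by simp
  then have "risk d (N_tilde d s \<rho> \<sigma>) \<theta> \<sigma> S
      = (\<integral>\<^sup>+z. ennreal (\<sigma>\<^sup>2) * ennreal ((N_tilde d s \<rho> 1 (\<lambda>i. ?\<theta> i + noise d S i z) - l2norm d ?\<theta>)\<^sup>2) \<partial>gauss_vec d)"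
    unfolding risk_eq[OF N_tilde_estimator] N_tilde_scale[OF \<sigma>]
    by (simp add: ennreal_mult[symmetric] power_mult_distrib[symmetric] right_diff_distrib)
  also have "\<dots>
      = ennreal (\<sigma>\<^sup>2) * (\<integral>\<^sup>+z. ennreal ((N_tilde d s \<rho> 1 (\<lambda>i. ?\<theta> i + noise d S i z) - l2norm d ?\<theta>)\<^sup>2) \<partial>gauss_vec d)"
    by (rule nn_integral_cmult) (unfold N_tilde_def Q_tilde_def, measurable)
  also have "\<dots> \<le> ennreal (\<sigma>\<^sup>2) * ennreal (5000 * phi s (\<rho>\<^sup>2))"
    using unit_noise by (rule mult_left_mono) simp
  also have "\<dots> = ennreal (5000 * \<sigma>\<^sup>2 * phi s (\<rho>\<^sup>2))"
    by (simp add: ennreal_mult'[symmetric] mult_ac)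
  finally show ?thesis .
qed

lemma worst_risk_N_tilde_le:
  assumes "1 \<le> s" "0 \<le> \<rho>" "0 < \<sigma>"
  shows "worst_risk s d \<rho> \<sigma> (N_tilde d s \<rho> \<sigma>) \<le> ennreal (5000 * \<sigma>\<^sup>2 * phi s (\<rho>\<^sup>2))"
  using N_tilde_risk_le[OF _ assms] by (intro SUP_least) auto

theorem theorem4:
  "\<exists>c C :: real. 0 < c \<and> c \<le> C \<and>
    (\<forall>(d::nat) (s::nat) (\<rho>::real) (\<sigma>::real).
       1 \<le> d \<longrightarrow> 1 \<le> s \<longrightarrow> s \<le> d \<longrightarrow> sqrt (real d) \<le> \<rho> \<longrightarrow> \<rho> \<le> real d \<longrightarrow> 0 < \<sigma> \<longrightarrow>
       (SUP p\<in>Theta s d \<rho>. risk d (N_tilde d s \<rho> \<sigma>) (fst p) \<sigma> (snd p))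
          \<le> ennreal (C * \<sigma>\<^sup>2 * phi s (\<rho>\<^sup>2))
     \<and> ennreal (c * \<sigma>\<^sup>2)
          \<le> (INF T\<in>estimators d. SUP p\<in>Theta s d \<rho>.
                risk d T (fst p) \<sigma> (snd p) / ennreal (phi s (\<rho>\<^sup>2)))
     \<and> (INF T\<in>estimators d. SUP p\<in>Theta s d \<rho>.
                risk d T (fst p) \<sigma> (snd p) / ennreal (phi s (\<rho>\<^sup>2)))
          \<le> ennreal (C * \<sigma>\<^sup>2))"
proof (rule exI[of _ "1 / 256"], rule exI[of _ 5000], intro conjI allI impI)
  fix d s :: nat and \<rho> \<sigma> :: real
  assume "1 \<le> d" and s: "1 \<le> s" "s \<le> d" and \<rho>: "sqrt (real d) \<le> \<rho>" "\<rho> \<le> real d" and \<sigma>: "0 < \<sigma>"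
  then have "0 < sqrt (real d)" by simp
  then have \<rho>_pos: "0 < \<rho>" using \<rho>(1) by linarith
  let ?\<phi> = "phi s (\<rho>\<^sup>2)" and ?W = "worst_risk s d \<rho> \<sigma>"
  have cancel: "ennreal (x * ?\<phi>) / ennreal ?\<phi> = ennreal x" if "0 \<le> x" for x
    using phi_pos[OF s(1) \<rho>_pos] that by (simp add: divide_ennreal)
  show upper: "?W (N_tilde d s \<rho> \<sigma>) \<le> ennreal (5000 * \<sigma>\<^sup>2 * ?\<phi>)"
    using s \<rho>_pos \<sigma> by (intro worst_risk_N_tilde_le) auto
  have "ennreal (1 / 256 * \<sigma>\<^sup>2) \<le> ?W T / ennreal ?\<phi>" if "T \<in> estimators d" for T
    using divide_right_mono_ennreal[OF worst_risk_ge_phi, of s d \<rho> T \<sigma> "ennreal ?\<phi>"]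
      cancel[of "1 / 256 * \<sigma>\<^sup>2"] s \<rho> that
    by simp
  then show "ennreal (1 / 256 * \<sigma>\<^sup>2) \<le> (INF T\<in>estimators d. SUP p\<in>Theta s d \<rho>. risk d T (fst p) \<sigma> (snd p) / ennreal ?\<phi>)"
    by (intro INF_greatest) (simp add: SUP_divide_ennreal)
  have "?W (N_tilde d s \<rho> \<sigma>) / ennreal ?\<phi> \<le> ennreal (5000 * \<sigma>\<^sup>2)"
    using divide_right_mono_ennreal[OF upper, of "ennreal ?\<phi>"] by (simp add: cancel)
  then show "(INF T\<in>estimators d. SUP p\<in>Theta s d \<rho>. risk d T (fst p) \<sigma> (snd p) / ennreal ?\<phi>) \<le> ennreal (5000 * \<sigma>\<^sup>2)"
    by (intro INF_lower2[OF N_tilde_estimator]) (simp add: SUP_divide_ennreal)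
qed simp_all

end
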